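(* Let $d\geq 3$ and $c\neq 0$ with $c<\lambda(d)$. Let $\omega>0$ and let $Q$ be a radial $H^1$-solution of $-\Delta Q-c|x|^{-2}Q+\omega Q=|Q|^{4/d}Q$. Then the standing wave $e^{i\omega t}Q(x)$ is unstable in the following sense: there exists a sequence $(u_{0,n})_{n\geq1}\subset H^1$ with $u_{0,n}\to Q$ strongly in $H^1$ as $n\to\infty$ such that, for every $n\geq1$, the corresponding solution $u_n$ of the $L^2$-critical equation with initial data $u_{0,n}$ blows up in finite time.
   Context: Let $\lambda(d)=\left(\frac{d-2}{2}\right)^2$. The $L^2$-critical equation is $i\partial_t u+\Delta u+c|x|^{-2}u=-|u|^{4/d}u$ on $\mathbb R^+\times\mathbb R^d$, $u(0)=u_0\in H^1$, where $-\Delta-c|x|^{-2}$ is a self-adjoint extension (e.g. Friedrichs) of its action on $C_0^\infty(\mathbb R^d\setminus\{0\})$. For each $u_0\in H^1$ there is a unique maximal solution $u\in C([0,T),H^1)$; it blows up in finite time if $T<\infty$, in which case $\|\nabla u(t)\|_{L^2}\to\infty$ as $t\uparrow T$.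
   Formalization: The formal statement additionally assumes that Q is not zero almost everywhere; for Q = 0 the claim is false, since initial data small in H^1 give global solutions. *)

theory Defs
  imports "HOL-Analysis.Analysis"
begin

definition lam :: "real \<Rightarrow> real" where
  "lam d = ((d - 2) / 2)^2"

definition pd :: "(real^'d \<Rightarrow> real) \<Rightarrow> 'd \<Rightarrow> real^'d \<Rightarrow> real" where
  "pd \<phi> j x = deriv (\<lambda>t. \<phi> (x + t *\<^sub>R axis j 1)) 0"

definition test_fun :: "(real^'d \<Rightarrow> real) \<Rightarrow> bool" where
  "test_fun \<phi> \<longleftrightarrow> bounded {x. \<phi> x \<noteq> 0} \<and>
     (\<forall>j. \<exists>D. continuous_on UNIV D \<and>
        (\<forall>x. ((\<lambda>t. \<phi> (x + t *\<^sub>R axis j 1)) has_real_derivative D x) (at 0)))"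

definition L2 :: "(real^'d \<Rightarrow> complex) \<Rightarrow> bool" where
  "L2 u \<longleftrightarrow> u \<in> borel_measurable lborel \<and> integrable lborel (\<lambda>x. (cmod (u x))^2)"

definition has_weak_partial :: "(real^'d \<Rightarrow> complex) \<Rightarrow> 'd \<Rightarrow> (real^'d \<Rightarrow> complex) \<Rightarrow> bool" where
  "has_weak_partial u j g \<longleftrightarrow>
     (\<forall>\<phi>. test_fun \<phi> \<longrightarrow>
        (LINT x|lborel. u x * of_real (pd \<phi> j x)) = - (LINT x|lborel. g x * of_real (\<phi> x)))"

definition H1 :: "(real^'d \<Rightarrow> complex) \<Rightarrow> bool" where
  "H1 u \<longleftrightarrow> L2 u \<and> (\<forall>j. \<exists>g. L2 g \<and> has_weak_partial u j g)"

text \<open>The weak partial derivative (unique up to null sets).\<close>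
definition wpd :: "(real^'d \<Rightarrow> complex) \<Rightarrow> 'd \<Rightarrow> real^'d \<Rightarrow> complex" where
  "wpd u j = (SOME g. L2 g \<and> has_weak_partial u j g)"

definition L2_norm :: "(real^'d \<Rightarrow> complex) \<Rightarrow> real" where
  "L2_norm u = sqrt (LINT x|lborel. (cmod (u x))^2)"

definition grad_norm :: "(real^'d \<Rightarrow> complex) \<Rightarrow> real" where
  "grad_norm u = sqrt (\<Sum>j\<in>UNIV. (LINT x|lborel. (cmod (wpd u j x))^2))"

definition H1_dist :: "(real^'d \<Rightarrow> complex) \<Rightarrow> (real^'d \<Rightarrow> complex) \<Rightarrow> real" where
  "H1_dist u v = sqrt ((LINT x|lborel. (cmod (u x - v x))^2)
      + (\<Sum>j\<in>UNIV. (LINT x|lborel. (cmod (wpd u j x - wpd v j x))^2)))"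

definition nonlin :: "'d itself \<Rightarrow> complex \<Rightarrow> complex" where
  "nonlin _ z = of_real (cmod z powr (4 / real CARD('d))) * z"

text \<open>Weak (H^{-1}) form of the operator -Delta - c|x|^{-2} applied to u, paired with a
  test function phi (form-sense; for c < lam d the Friedrichs extension has form domain H^1).\<close>
definition op_pair :: "real \<Rightarrow> (real^'d \<Rightarrow> complex) \<Rightarrow> (real^'d \<Rightarrow> real) \<Rightarrow> complex" where
  "op_pair c u \<phi> = (\<Sum>j\<in>UNIV. (LINT x|lborel. wpd u j x * of_real (pd \<phi> j x)))
      - of_real c * (LINT x|lborel. of_real (1 / (norm x)^2) * u x * of_real (\<phi> x))"

definition ground_eq :: "real \<Rightarrow> real \<Rightarrow> (real^'d \<Rightarrow> complex) \<Rightarrow> bool" where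
  "ground_eq c \<omega> Q \<longleftrightarrow> H1 Q \<and>
     (\<forall>\<phi>. test_fun \<phi> \<longrightarrow>
        op_pair c Q \<phi> + of_real \<omega> * (LINT x|lborel. Q x * of_real (\<phi> x))
        = (LINT x|lborel. nonlin TYPE('d) (Q x) * of_real (\<phi> x)))"

definition radial :: "(real^'d \<Rightarrow> complex) \<Rightarrow> bool" where
  "radial Q \<longleftrightarrow> (\<exists>q. AE x in lborel. Q x = q (norm x))"

definition nls_solution :: "real \<Rightarrow> (real^'d \<Rightarrow> complex) \<Rightarrow> real \<Rightarrow> (real \<Rightarrow> real^'d \<Rightarrow> complex) \<Rightarrow> bool" where
  "nls_solution c u0 T u \<longleftrightarrow> 0 < T \<and>
     (\<forall>t\<in>{0..<T}. H1 (u t)) \<and>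
     (\<forall>t\<in>{0..<T}. ((\<lambda>s. H1_dist (u s) (u t)) \<longlongrightarrow> 0) (at t within {0..<T})) \<and>
     (AE x in lborel. u 0 x = u0 x) \<and>
     (\<forall>\<phi>. test_fun \<phi> \<longrightarrow> (\<forall>t\<in>{0<..<T}. \<exists>D.
        ((\<lambda>s. LINT x|lborel. u s x * of_real (\<phi> x)) has_vector_derivative D) (at t) \<and>
        \<i> * D = op_pair c (u t) \<phi> - (LINT x|lborel. nonlin TYPE('d) (u t x) * of_real (\<phi> x))))"

definition blows_up :: "real \<Rightarrow> (real^'d \<Rightarrow> complex) \<Rightarrow> bool" where
  "blows_up c u0 \<longleftrightarrow> (\<exists>T u. nls_solution c u0 T u \<and>
      filterlim (\<lambda>t. grad_norm (u t)) at_top (at_left T))"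

end

theory Submission
  imports Defs "HOL-Probability.Conditional_Expectation"
begin

text \<open>
  The equation is invariant under the pseudo-conformal transformation, which turns the standing wave
  into the explicit solution
  \<open>u(t,x) = \<mu>\<^bsup>-d/2\<^esup> exp (\<i> \<omega> t/\<mu> - \<i> a |x|\<^sup>2/(4\<mu>)) Q (x/\<mu>)\<close> with \<open>\<mu> = 1 - a t\<close>.  It blows up at
  \<open>t = 1/a\<close>, and its initial value \<open>exp (- \<i> a |x|\<^sup>2/4) Q\<close> tends to \<open>Q\<close> in \<open>H\<^sup>1\<close> as \<open>a \<rightarrow> 0\<close>, provided
  that \<open>|x| Q\<close> is square integrable.

  This decay comes from the radial profile \<open>q\<close> of \<open>Q\<close>.  By two applications of the du Bois-Reymond
  lemma \<open>q\<close> is a classical solution of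
  \<open>(r\<^bsup>d-1\<^esup> q')' = r\<^bsup>d-1\<^esup> V q\<close> on \<open>r > 0\<close> with \<open>V = \<omega> - c/r\<^sup>2 - |q|\<^bsup>4/d\<^esup>\<close>.  Since \<open>q \<rightarrow> 0\<close> at infinity, \<open>V \<ge> \<omega>/2\<close> for large \<open>r\<close>, so
  that \<open>J = r\<^bsup>d-1\<^esup> Re (cnj q * q')\<close> is nonpositive, increasing and satisfies \<open>|J| \<le> K J'\<close>; then
  \<open>(r\<^sup>2 J)' \<ge> r\<^sup>2 J'/2\<close> bounds \<open>\<integral> r\<^bsup>d+1\<^esup> |q|\<^sup>2\<close>.
\<close>

section \<open>Test functions and the fundamental lemma\<close>

text \<open>Two features of the weak formulation shape the proof. Solutions are tested only against
  real functions, whereas the substitution x = \<mu> y moves the complex chirp onto the test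
  function. Recombining real and imaginary parts needs genuinely integrable terms, also across the
  origin; this is why |x|^-2 Q and |Q|^(4/d) Q are shown to be locally integrable, from the bound
  |q(r)| <= C r^(-(d-2)/2) near 0. Moreover, H1 convergence of dilations is obtained from pointwise
  convergence together with convergence of norms, which asks for representatives of Q and of its
  gradient that are continuous off the origin. Differentiating the chirp produces a term of size |x|
  |Q|, hence the role of the decay. The transformed gradient has L2 norm of order 1/\<mu>, hence the
  blow-up. In the equation the potential, by homogeneity of degree -2, and the nonlinearity, by the
  exponent 4/d, pick up the same factor \<mu>^-2 as the Laplacian; the terms created by the chirp
  cancel against the time derivative once the weak gradient of Q is tested with the products of
  coordinates and the chirped test function.\<close>

definition has_cont_gradient :: "('a::euclidean_space \<Rightarrow> real) \<Rightarrow> ('a \<Rightarrow> 'a) \<Rightarrow> bool" where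
  "has_cont_gradient \<phi> D \<longleftrightarrow>
     (\<forall>x. (\<phi> has_derivative (\<lambda>h. D x \<bullet> h)) (at x)) \<and> continuous_on UNIV D"

text \<open>The set \<open>U\<close> records where the support lies: off the origin for radial tests
  of the singular equation, in \<open>{0<..}\<close> for profiles, and \<open>UNIV\<close> for the
  class of \<open>test_fun\<close>. Keeping the gradient \<open>D\<close> as a parameter makes the
  partials of products and compositions explicit.\<close>

definition C1_bump :: "'a::euclidean_space set \<Rightarrow> ('a \<Rightarrow> real) \<Rightarrow> ('a \<Rightarrow> 'a) \<Rightarrow> bool" where
  "C1_bump U \<phi> D \<longleftrightarrow> has_cont_gradient \<phi> D \<and>
     (\<exists>K. compact K \<and> K \<subseteq> U \<and> (\<forall>x. x \<notin> K \<longrightarrow> \<phi> x = 0))"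

lemma has_cont_gradientI:
  assumes "\<And>x. (\<phi> has_derivative (\<lambda>h. D x \<bullet> h)) (at x)" "continuous_on UNIV D"
  shows "has_cont_gradient \<phi> D"
  using assms by (auto simp: has_cont_gradient_def)

lemma has_cont_gradient_derivative:
  "has_cont_gradient \<phi> D \<Longrightarrow> (\<phi> has_derivative (\<lambda>h. D x \<bullet> h)) (at x within S)"
  unfolding has_cont_gradient_def by (blast intro: has_derivative_at_withinI)

lemma has_cont_gradient_continuous:
  assumes "has_cont_gradient \<phi> D"
  shows "continuous_on S D" "continuous_on S \<phi>"
proof -
  show "continuous_on S D" using assms by (auto simp: has_cont_gradient_def intro: continuous_on_subset)
  show "continuous_on S \<phi>"
    by (rule has_derivative_continuous_on[OF has_cont_gradient_derivative[OF assms]])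
qed

lemma has_cont_gradient_measurable:
  assumes "has_cont_gradient \<phi> D"
  shows "\<phi> \<in> borel_measurable borel" "D \<in> borel_measurable borel"
  using has_cont_gradient_continuous[OF assms, of UNIV] by (auto intro: borel_measurable_continuous_onI)

lemma has_cont_gradient_mult:
  assumes "has_cont_gradient f F" "has_cont_gradient g G"
  shows "has_cont_gradient (\<lambda>x. f x * g x) (\<lambda>x. f x *\<^sub>R G x + g x *\<^sub>R F x)"
proof (rule has_cont_gradientI)
  show "((\<lambda>x. f x * g x) has_derivative (\<lambda>h. (f x *\<^sub>R G x + g x *\<^sub>R F x) \<bullet> h)) (at x)" for x
    using has_derivative_mult[OF has_cont_gradient_derivative[OF assms(1)] has_cont_gradient_derivative[OF assms(2)], of x UNIV]
    by (simp add: algebra_simps inner_add_left)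
qed (intro continuous_intros has_cont_gradient_continuous[OF assms(1)] has_cont_gradient_continuous[OF assms(2)])

lemma has_cont_gradient_compose:
  assumes "has_cont_gradient f F" "\<And>y. (g has_real_derivative g' y) (at y)" "continuous_on UNIV g'"
  shows "has_cont_gradient (\<lambda>x. g (f x)) (\<lambda>x. g' (f x) *\<^sub>R F x)"
proof (rule has_cont_gradientI)
  have g: "(g has_derivative (\<lambda>h. g' y * h)) (at y)" for y
    using assms(2)[of y] by (simp add: has_field_derivative_def)
  show "((\<lambda>x. g (f x)) has_derivative (\<lambda>h. (g' (f x) *\<^sub>R F x) \<bullet> h)) (at x)" for x
    using has_derivative_compose[OF has_cont_gradient_derivative[OF assms(1), of x UNIV] g] by simp
  show "continuous_on UNIV (\<lambda>x. g' (f x) *\<^sub>R F x)"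
    by (intro continuous_intros has_cont_gradient_continuous[OF assms(1)]
        continuous_on_compose2[OF assms(3)]) auto
qed

lemma has_cont_gradient_prod:
  assumes "finite S" "\<And>i. i \<in> S \<Longrightarrow> \<exists>F. has_cont_gradient (f i) F"
  shows "\<exists>F. has_cont_gradient (\<lambda>x. \<Prod>i\<in>S. f i x) F"
  using assms
proof (induction S rule: finite_induct)
  case empty
  then show ?case by (auto intro!: exI[of _ "\<lambda>_. 0"] has_cont_gradientI)
next
  case (insert i S)
  then obtain F G where "has_cont_gradient (f i) F" "has_cont_gradient (\<lambda>x. \<Prod>i\<in>S. f i x) G" by blast
  from has_cont_gradient_mult[OF this] insert(1,2) show ?case by auto
qed

lemma has_cont_gradient_affine: "has_cont_gradient (\<lambda>x. (x - a) \<bullet> i) (\<lambda>_. i)"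
  by (rule has_cont_gradientI) (auto intro!: derivative_eq_intros simp: inner_commute)

lemma has_cont_gradient_uminus:
  assumes "has_cont_gradient f F" shows "has_cont_gradient (\<lambda>x. - f x) (\<lambda>x. - F x)"
proof -
  have "(uminus has_real_derivative - 1) (at y)" for y :: real
    by (auto intro!: derivative_eq_intros)
  from has_cont_gradient_compose[OF assms this] show ?thesis by simp
qed

text \<open>The square of the positive part is the simplest C1 function that is positive exactly on
  the open half line; products of it describe boxes.\<close>

lemma has_real_derivative_pos_square:
  "((\<lambda>y::real. (max 0 y)\<^sup>2) has_real_derivative 2 * max 0 y) (at y)"
proof -
  consider "y < 0" | "y > 0" | "y = 0" by linarith
  then show ?thesis
  proof cases
    case 1
    have "((\<lambda>y::real. 0) has_real_derivative 0) (at y)" by simp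
    then have "((\<lambda>y::real. (max 0 y)\<^sup>2) has_real_derivative 0) (at y)"
      by (rule has_field_derivative_transform_within_open[of _ _ _ "{..<0}"]) (use 1 in auto)
    with 1 show ?thesis by simp
  next
    case 2
    have "((\<lambda>y::real. y\<^sup>2) has_real_derivative 2 * y) (at y)" by (auto intro!: derivative_eq_intros)
    then have "((\<lambda>y::real. (max 0 y)\<^sup>2) has_real_derivative 2*y) (at y)"
      by (rule has_field_derivative_transform_within_open[of _ _ _ "{0<..}"]) (use 2 in auto)
    with 2 show ?thesis by simp
  next
    case 3
    have "((\<lambda>h::real. ((max 0 (0+h))\<^sup>2 - (max 0 0)\<^sup>2) / h) \<longlongrightarrow> 0) (at 0)"
    proof (rule Lim_null_comparison)
      show "\<forall>\<^sub>F h in at 0. norm (((max 0 (0+h))\<^sup>2 - (max 0 0)\<^sup>2) / h) \<le> \<bar>h::real\<bar>"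
        by (auto simp: max_def power2_eq_square)
      show "((\<lambda>h::real. \<bar>h\<bar>) \<longlongrightarrow> 0) (at 0)" by (auto intro!: tendsto_eq_intros)
    qed
    then show ?thesis using 3 by (simp add: DERIV_def)
  qed
qed

text \<open>The product \<open>\<psi>\<close> of squared positive parts, two for each coordinate, is
  C1 and positive exactly on the box, so 1 - 1/(1 + n \<psi>) tends to 1 inside and is 0 outside. C1
  regularity is all that the test class asks for.\<close>

lemma box_indicator_limit:
  fixes a b :: "'a::euclidean_space"
  shows "\<exists>\<phi> :: nat \<Rightarrow> 'a \<Rightarrow> real. (\<forall>n. \<exists>D. has_cont_gradient (\<phi> n) D) \<and>
    (\<forall>n x. 0 \<le> \<phi> n x) \<and> (\<forall>n x. \<phi> n x \<le> indicator (box a b) x) \<and>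
    (\<forall>x. (\<lambda>n. \<phi> n x) \<longlonglongrightarrow> indicator (box a b) x)"
proof -
  define s :: "real \<Rightarrow> real" where "s y = (max 0 y)\<^sup>2" for y
  define \<psi> :: "'a \<Rightarrow> real" where "\<psi> x = (\<Prod>i\<in>Basis. s ((x-a)\<bullet>i) * s (-((x-b)\<bullet>i)))" for x
  define \<phi> where "\<phi> n x = 1 - 1 / (1 + real n * \<psi> x)" for n x
  have s: "(s has_real_derivative 2 * max 0 y) (at y)" for y
    unfolding s_def by (rule has_real_derivative_pos_square)
  have cs: "continuous_on UNIV (\<lambda>y::real. 2 * max 0 y)" by (intro continuous_intros)
  have s0: "s y \<ge> 0" for y by (simp add: s_def)
  have spos: "s y > 0 \<longleftrightarrow> y > 0" for y by (auto simp: s_def max_def)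
  have psi0: "\<psi> x \<ge> 0" for x unfolding \<psi>_def by (intro prod_nonneg) (auto simp: s0)
  have psibox: "\<psi> x > 0 \<longleftrightarrow> x \<in> box a b" for x
  proof -
    have "\<psi> x > 0 \<longleftrightarrow> \<psi> x \<noteq> 0" using psi0[of x] by linarith
    also have "\<dots> \<longleftrightarrow> (\<forall>i\<in>Basis. s ((x-a)\<bullet>i) \<noteq> 0 \<and> s (-((x-b)\<bullet>i)) \<noteq> 0)"
      by (auto simp: \<psi>_def)
    also have "\<dots> \<longleftrightarrow> (\<forall>i\<in>Basis. s ((x-a)\<bullet>i) > 0 \<and> s (-((x-b)\<bullet>i)) > 0)"
    proof -
      have "s y \<noteq> 0 \<longleftrightarrow> s y > 0" for y using s0[of y] by linarith
      then show ?thesis by simp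
    qed
    also have "\<dots> \<longleftrightarrow> x \<in> box a b"
      by (auto simp: spos mem_box inner_diff_left)
    finally show ?thesis .
  qed
  obtain F where F: "has_cont_gradient \<psi> F"
  proof -
    have "\<exists>F. has_cont_gradient (\<lambda>x. s ((x-a)\<bullet>i) * s (-((x-b)\<bullet>i))) F" for i
      using has_cont_gradient_mult[OF has_cont_gradient_compose[OF has_cont_gradient_affine s cs]
          has_cont_gradient_compose[OF has_cont_gradient_uminus[OF has_cont_gradient_affine] s cs]] by blast
    from has_cont_gradient_prod[OF finite_Basis this, of "\<lambda>i. i"] that show ?thesis unfolding \<psi>_def by blast
  qed
  have pos: "1 + real n * \<psi> x > 0" for n x using psi0[of x] by (simp add: add_pos_nonneg)
  show ?thesis
  proof (intro exI[of _ \<phi>] conjI allI)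
    show "\<exists>D. has_cont_gradient (\<phi> n) D" for n
    proof -
      have "has_cont_gradient (\<phi> n) (\<lambda>x. (real n / (1 + real n * \<psi> x)^2) *\<^sub>R F x)"
      proof (rule has_cont_gradientI)
        fix x
        have "((\<lambda>y. 1 - 1 / (1 + real n * y)) has_real_derivative (real n / (1 + real n * \<psi> x)^2)) (at (\<psi> x))"
          using pos[of n x] by (auto intro!: derivative_eq_intros simp: power2_eq_square)
        then have "((\<lambda>y. 1 - 1 / (1 + real n * y)) has_derivative (\<lambda>h. (real n / (1 + real n * \<psi> x)^2) * h)) (at (\<psi> x))"
          unfolding has_field_derivative_def .
        from has_derivative_compose[OF has_cont_gradient_derivative[OF F, of x UNIV] this]
        show "(\<phi> n has_derivative (\<lambda>h. ((real n / (1 + real n * \<psi> x)^2) *\<^sub>R F x) \<bullet> h)) (at x)"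
          by (simp add: \<phi>_def[abs_def])
        show "continuous_on UNIV (\<lambda>x. (real n / (1 + real n * \<psi> x)^2) *\<^sub>R F x)"
          by (intro continuous_intros has_cont_gradient_continuous[OF F]) (metis pos less_irrefl power_eq_0_iff)+
      qed
      then show ?thesis by blast
    qed
    show "0 \<le> \<phi> n x" for n x using pos[of n x] psi0[of x] by (simp add: \<phi>_def divide_le_eq)
    show "\<phi> n x \<le> indicator (box a b) x" for n x
    proof (cases "x \<in> box a b")
      case True then show ?thesis using pos[of n x] by (simp add: \<phi>_def)
    next
      case False then have "\<psi> x = 0" using psibox[of x] psi0[of x] by linarith
      then show ?thesis by (simp add: \<phi>_def)
    qed
    show "(\<lambda>n. \<phi> n x) \<longlonglongrightarrow> indicator (box a b) x" for x
    proof (cases "x \<in> box a b")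
      case True
      then have p: "\<psi> x > 0" using psibox by simp
      have "filterlim (\<lambda>n. 1 + real n * \<psi> x) at_top sequentially"
        by (intro filterlim_tendsto_add_at_top[OF tendsto_const] filterlim_at_top_mult_tendsto_pos[OF tendsto_const p] filterlim_real_sequentially)
      then have "(\<lambda>n. 1 - 1 / (1 + real n * \<psi> x)) \<longlonglongrightarrow> 1 - 0"
        by (intro tendsto_diff[OF tendsto_const] real_tendsto_divide_at_top[OF tendsto_const])
      then show ?thesis using True by (simp add: \<phi>_def)
    next
      case False then have "\<psi> x = 0" using psibox[of x] psi0[of x] by linarith
      then show ?thesis using False by (simp add: \<phi>_def)
    qed
  qed
qed

section \<open>Functions that vanish when paired with every bump\<close>

text \<open>Dynkin's argument: boxes are stable under intersection and generate the Borel sets, and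
  the sets on which \<open>F\<close> integrates to 0 are closed under complements and disjoint
  unions. A density whose integrals all vanish is null.\<close>

lemma AE_zero_of_integral_box_zero:
  fixes F :: "'a::euclidean_space \<Rightarrow> complex"
  assumes F: "integrable lborel F" and box: "\<And>a b. (LINT x:box a b|lborel. F x) = 0"
  shows "AE x in lborel. F x = 0"
proof -
  let ?E = "range (\<lambda>(a, b). box a b :: 'a set)"
  have meas: "A \<in> sets lborel" if "A \<in> sigma_sets UNIV ?E" for A :: "'a set"
    using that by (simp add: borel_eq_box)
  have iF: "set_integrable lborel A F" if "A \<in> sets lborel" for A
    unfolding set_integrable_def using integrable_mult_indicator[OF that F] by simp
  have un: "(LINT x:(\<Union>i. A i)|lborel. F x) = 0"
    if A: "range A \<subseteq> sets lborel" "disjoint_family A" "\<And>i. (LINT x:A i|lborel. F x) = 0" for A :: "nat \<Rightarrow> 'a set"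
  proof -
    have "(LINT x:(\<Union>i. A i)|lborel. F x) = (\<Sum>i. (LINT x:(A i)|lborel. F x))"
      using A(1,2) by (intro lebesgue_integral_countable_add iF) (auto simp: disjoint_family_on_def)
    then show ?thesis using A(3) by simp
  qed
  \<comment> \<open>Complements need the integral over the whole space, which is the limit of the
    integrals over growing boxes.\<close>
  have tot: "(LINT x:UNIV|lborel. F x) = 0"
  proof -
    have "(\<lambda>n. LINT x:(box (- real n *\<^sub>R One) (real n *\<^sub>R One))|lborel. F x) \<longlonglongrightarrow> (LINT x:(\<Union>n::nat. box (- real n *\<^sub>R One) (real n *\<^sub>R One))|lborel. F x)"
    proof (rule set_integral_cont_up)
      show "incseq (\<lambda>n. box (- real n *\<^sub>R One) (real n *\<^sub>R One) :: 'a set)"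
      proof (rule incseq_SucI)
        fix n show "box (- real n *\<^sub>R One) (real n *\<^sub>R One :: 'a) \<subseteq> box (- real (Suc n) *\<^sub>R One) (real (Suc n) *\<^sub>R One)"
          by (rule subset_box_imp) simp
      qed
    qed (auto intro: iF)
    then show ?thesis using box by (simp add: UN_box_eq_UNIV LIMSEQ_const_iff)
  qed
  have all: "(LINT x:A|lborel. F x) = 0" if "A \<in> sets lborel" for A
  proof -
    have st: "Int_stable ?E" by (auto simp: Int_stable_def box_Int_box)
    have "A \<in> sigma_sets UNIV ?E" using that by (simp add: borel_eq_box)
    with st have "Int_stable ?E" "?E \<subseteq> Pow UNIV" "A \<in> sigma_sets UNIV ?E" by auto
    then show ?thesis
    proof (induction rule: sigma_sets_induct_disjoint)
      case (basic A) then show ?case using box by auto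
    next
      case empty show ?case by (simp add: set_lebesgue_integral_def)
    next
      case (compl A)
      have "(LINT x:A \<union> (UNIV - A)|lborel. F x) = (LINT x:A|lborel. F x) + (LINT x:UNIV - A|lborel. F x)"
        using meas[OF compl(1)] by (intro set_integral_Un iF) auto
      then show ?case using compl tot by simp
    next
      case (union A)
      then show ?case using meas by (intro un) auto
    qed
  qed
  show ?thesis
    by (rule sigma_finite_measure.density_unique_banach[OF sigma_finite_lborel F]) (use all in \<open>auto simp: set_lebesgue_integral_def\<close>)
qed

text \<open>Bumps approximate the indicator of every box inside a closed box contained in
  \<open>U\<close>; this gives f = 0 a.e. on that closed box, and \<open>U\<close> is a countable
  union of such boxes.\<close>

lemma fundamental_lemma:
  fixes f :: "'a::euclidean_space \<Rightarrow> complex"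
  assumes "open U" and int: "\<And>a b. cbox a b \<subseteq> U \<Longrightarrow> set_integrable lborel (cbox a b) f"
    and zero: "\<And>\<phi> D. C1_bump U \<phi> D \<Longrightarrow> (LINT x|lborel. f x * of_real (\<phi> x)) = 0"
  shows "AE x in lborel. x \<in> U \<longrightarrow> f x = 0"
proof -
  have cb: "AE x in lborel. x \<in> cbox a b \<longrightarrow> f x = 0" if ab: "cbox a b \<subseteq> U" for a b
  proof -
    let ?F = "\<lambda>x. indicator (box a b) x *\<^sub>R f x"
    have F: "integrable lborel ?F"
      using set_integrable_subset[OF int[OF ab], of "box a b"] box_subset_cbox[of a b]
      by (simp add: set_integrable_def)
    have "AE x in lborel. ?F x = 0"
    proof (rule AE_zero_of_integral_box_zero[OF F])
      fix l u :: 'a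
      \<comment> \<open>Restricting \<open>f\<close> to \<open>box a b\<close> turns the integral
        over an arbitrary box into one over the smaller box \<open>box l' u'\<close>, whose bumps
        are supported in \<open>U\<close>.\<close>
      obtain l' u' where lu: "box a b \<inter> box l u = box l' u'" by (simp add: box_Int_box)
      obtain \<phi> where \<phi>: "\<And>n. \<exists>D. has_cont_gradient (\<phi> n) D" "\<And>n x. 0 \<le> \<phi> n x" "\<And>n x. \<phi> n x \<le> indicator (box l' u') x"
        "\<And>x. (\<lambda>n. \<phi> n x) \<longlonglongrightarrow> indicator (box l' u') x"
        using box_indicator_limit[of l' u'] by blast
      have sub: "box l' u' \<subseteq> cbox a b" using lu box_subset_cbox[of a b] by blast
      have z: "\<phi> n x = 0" if "x \<notin> box l' u'" for n x
        using \<phi>(2)[of n x] \<phi>(3)[of n x] that by simp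
      have "(LINT x|lborel. f x * of_real (\<phi> n x)) = 0" for n
      proof -
        obtain D where "has_cont_gradient (\<phi> n) D" using \<phi>(1) by blast
        then have "C1_bump U (\<phi> n) D" unfolding C1_bump_def using ab sub z
          by (intro conjI exI[of _ "cbox a b"]) auto
        then show ?thesis by (rule zero)
      qed
      then have e0: "(LINT x|lborel. ?F x * of_real (\<phi> n x)) = 0" for n
      proof -
        have "?F x * of_real (\<phi> n x) = f x * of_real (\<phi> n x)" for x
          using z[of x n] lu by (cases "x \<in> box l' u'") (auto simp: indicator_def)
        then show ?thesis using \<open>(LINT x|lborel. f x * of_real (\<phi> n x)) = 0\<close> by simp
      qed
      have "(\<lambda>n. LINT x|lborel. ?F x * of_real (\<phi> n x)) \<longlonglongrightarrow> (LINT x|lborel. ?F x * of_real (indicator (box l' u') x))"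
      proof (rule integral_dominated_convergence[where w="\<lambda>x. norm (?F x)"])
        show "(\<lambda>x. ?F x * of_real (\<phi> n x)) \<in> borel_measurable lborel" for n
        proof -
          have [measurable]: "\<phi> n \<in> borel_measurable borel" using \<phi>(1)[of n] has_cont_gradient_measurable by blast
          have [measurable]: "?F \<in> borel_measurable borel" using borel_measurable_integrable[OF F] by simp
          show ?thesis by measurable
        qed
        show "AE x in lborel. (\<lambda>n. ?F x * of_real (\<phi> n x)) \<longlonglongrightarrow> ?F x * of_real (indicator (box l' u') x)"
          by (intro AE_I2 tendsto_intros \<phi>(4))
        show "AE x in lborel. norm (?F x * of_real (\<phi> n x)) \<le> norm (?F x)" for n
        proof (intro AE_I2)
          fix x
          have "\<bar>\<phi> n x\<bar> \<le> 1" using \<phi>(2)[of n x] \<phi>(3)[of n x] by (auto simp: indicator_def of_bool_def split: if_splits)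
          then show "norm (?F x * of_real (\<phi> n x)) \<le> norm (?F x)"
            by (auto simp: norm_mult mult_left_le indicator_def)
        qed
        have [measurable]: "?F \<in> borel_measurable borel" using borel_measurable_integrable[OF F] by simp
        show "(\<lambda>x. ?F x * of_real (indicator (box l' u') x)) \<in> borel_measurable lborel" by measurable
        show "integrable lborel (\<lambda>x. norm (?F x))" by (rule integrable_norm[OF F])
      qed
      then have "(LINT x|lborel. ?F x * of_real (indicator (box l' u') x)) = 0"
        unfolding e0 by (simp only: LIMSEQ_const_iff)
      moreover have "?F x * of_real (indicator (box l' u') x) = indicator (box l u) x *\<^sub>R ?F x" for x
        using lu by (auto simp: indicator_def)
      ultimately show "(LINT x:box l u|lborel. ?F x) = 0"
        by (simp add: set_lebesgue_integral_def)
    qed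
    \<comment> \<open>The argument sees only the open box; its boundary is a null set.\<close>
    moreover have "AE x in lborel. x \<notin> cbox a b - box a b"
      by (intro AE_not_in) (simp add: null_sets_def emeasure_lborel_cbox_eq emeasure_lborel_box_eq emeasure_Diff box_subset_cbox)
    ultimately show ?thesis by eventually_elim (auto simp: indicator_def split: if_splits)
  qed
  \<comment> \<open>Boxes with rational corners exhaust an open set and are countably many.\<close>
  define a' where "a' = (\<lambda>f. (\<Sum>(i::'a)\<in>Basis. fst (f i::real\<times>real) *\<^sub>R i))"
  define b' where "b' = (\<lambda>f. (\<Sum>(i::'a)\<in>Basis. snd (f i::real\<times>real) *\<^sub>R i))"
  define I where "I = {f\<in>Basis \<rightarrow>\<^sub>E \<rat> \<times> \<rat>. cbox (a' f) (b' f) \<subseteq> U}"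
  have U: "U = (\<Union>f\<in>I. cbox (a' f) (b' f))"
    unfolding I_def a'_def b'_def by (rule open_UNION_cbox[OF assms(1)])
  have "countable I" unfolding I_def
    by (rule countable_subset[of _ "Basis \<rightarrow>\<^sub>E \<rat> \<times> \<rat>"]) (auto intro!: countable_PiE countable_SIGMA countable_rat)
  then have "AE x in lborel. \<forall>f'\<in>I. x \<in> cbox (a' f') (b' f') \<longrightarrow> f x = 0"
    by (subst AE_ball_countable) (auto simp: I_def intro!: cb)
  then show ?thesis by eventually_elim (use U in auto)
qed

section \<open>The du Bois-Reymond lemma on the half line\<close>

lemma C1_bump_real:
  assumes "C1_bump {0<..} \<zeta> \<zeta>'"
  obtains a b where "0 < a" "a < b" "\<And>r. (\<zeta> has_real_derivative \<zeta>' r) (at r)" "continuous_on UNIV \<zeta>'"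
    "\<And>r. r \<notin> {a..b} \<Longrightarrow> \<zeta> r = 0" "\<And>r. r \<notin> {a..b} \<Longrightarrow> \<zeta>' r = 0"
proof -
  obtain K where K: "compact K" "K \<subseteq> {0<..}" "\<And>x. x \<notin> K \<Longrightarrow> \<zeta> x = 0"
    using assms unfolding C1_bump_def by blast
  obtain b0 where b0: "\<And>x. x \<in> K \<Longrightarrow> x \<le> b0"
  proof (cases "K = {}")
    case False
    then obtain m where "m \<in> K" "\<And>x. x \<in> K \<Longrightarrow> x \<le> m" using compact_attains_sup[OF K(1)] by blast
    with that[of m] show ?thesis by auto
  qed (use that[of 1] in auto)
  obtain a0 where a0: "a0 > 0" "\<And>x. x \<in> K \<Longrightarrow> a0 \<le> x"
  proof (cases "K = {}")
    case False
    then obtain m where "m \<in> K" "\<And>x. x \<in> K \<Longrightarrow> m \<le> x" using compact_attains_inf[OF K(1)] by blast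
    with K(2) that[of m] show ?thesis by auto
  qed (use that[of 1] in auto)
  have d: "(\<zeta> has_real_derivative \<zeta>' r) (at r)" for r
    using assms unfolding C1_bump_def has_cont_gradient_def has_field_derivative_def
    by (simp add: inner_real_def)
  \<comment> \<open>The support may be empty or a single point, so the right end is enlarged to
    force a < b.\<close>
  show ?thesis
  proof (rule that[of a0 "max b0 a0 + 1"])
    show "continuous_on UNIV \<zeta>'" using assms unfolding C1_bump_def has_cont_gradient_def by blast
    show z: "\<zeta> r = 0" if "r \<notin> {a0..max b0 a0 + 1}" for r
      using K(3)[of r] a0(2)[of r] b0[of r] that by force
    show "\<zeta>' r = 0" if "r \<notin> {a0..max b0 a0 + 1}" for r
    proof -
      have "open (- {a0..max b0 a0 + 1})" by (rule open_Compl) simp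
      have "((\<lambda>_. 0) has_real_derivative \<zeta>' r) (at r)"
        by (rule has_field_derivative_transform_within_open[OF d \<open>open (- {a0..max b0 a0 + 1})\<close>]) (use z that in auto)
      then show ?thesis using DERIV_unique[OF _ DERIV_const] by blast
    qed
  qed (use a0 d in auto)
qed

lemma C1_bump_realI:
  assumes "0 < a" "\<And>r. (\<zeta> has_real_derivative \<zeta>' r) (at r)" "continuous_on UNIV \<zeta>'"
    "\<And>r. r \<notin> {a..b} \<Longrightarrow> \<zeta> r = 0"
  shows "C1_bump {0<..} \<zeta> \<zeta>'"
  unfolding C1_bump_def
proof (intro conjI exI[of _ "{a..b}"] has_cont_gradientI)
  show "(\<zeta> has_derivative (\<lambda>h. \<zeta>' x \<bullet> h)) (at x)" for x
    using assms(2)[of x] by (simp add: has_field_derivative_def inner_real_def)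
qed (use assms in auto)

lemma antiderivative_real:
  fixes \<theta> :: "real \<Rightarrow> real"
  assumes "continuous_on UNIV \<theta>"
  shows "((\<lambda>u. LBINT y=0..u. \<theta> y) has_real_derivative \<theta> r) (at r)"
proof -
  let ?a = "- \<bar>r\<bar> - 1" and ?b = "\<bar>r\<bar> + 1"
  have "((\<lambda>u. LBINT y=(0::real)..u. \<theta> y) has_vector_derivative \<theta> r) (at r within {?a..?b})"
    by (rule interval_integral_FTC2) (use assms continuous_on_subset in auto)
  then have "((\<lambda>u. LBINT y=0..u. \<theta> y) has_vector_derivative \<theta> r) (at r)"
  proof -
    have "?a < r \<and> r < ?b" by linarith
    then have "at r within {?a..?b} = at r" by (intro at_within_interior) simp
    then show ?thesis using \<open>(_ has_vector_derivative _) (at r within _)\<close> by (simp add: zero_ereal_def)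
  qed
  then show ?thesis by (simp add: has_real_derivative_iff_has_vector_derivative)
qed

lemma integrable_loc_mult_bump:
  fixes f :: "real \<Rightarrow> complex"
  assumes f: "\<And>a b. 0 < a \<Longrightarrow> set_integrable lborel {a..b} f"
    and h: "continuous_on UNIV h" "\<And>r. r \<notin> {a..b} \<Longrightarrow> h r = (0::real)" "0 < a"
  shows "integrable lborel (\<lambda>r. f r * of_real (h r))"
proof -
  have "compact (h ` {a..b})" by (intro compact_continuous_image continuous_on_subset[OF h(1)]) auto
  then obtain M where M: "\<And>r. r \<in> {a..b} \<Longrightarrow> \<bar>h r\<bar> \<le> M"
    using compact_imp_bounded[THEN bounded_iff[THEN iffD1]] by fastforce
  have [measurable]: "h \<in> borel_measurable borel" by (rule borel_measurable_continuous_onI[OF h(1)])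
  have eq: "(\<lambda>r. f r * of_real (h r)) = (\<lambda>r. (indicator {a..b} r *\<^sub>R f r) * of_real (h r))"
    using h(2) by (auto simp: indicator_def fun_eq_iff)
  have I: "integrable lborel (\<lambda>r. indicator {a..b} r *\<^sub>R f r)" using f[OF h(3)] by (simp add: set_integrable_def)
  show ?thesis unfolding eq
  proof (rule Bochner_Integration.integrable_bound)
    show "integrable lborel (\<lambda>r. M * norm (indicator {a..b} r *\<^sub>R f r))"
      by (rule integrable_mult_right[OF integrable_norm[OF I]])
    show "(\<lambda>r. (indicator {a..b} r *\<^sub>R f r) * of_real (h r)) \<in> borel_measurable lborel"
      using borel_measurable_integrable[OF I] by measurable
    show "AE r in lborel. norm ((indicator {a..b} r *\<^sub>R f r) * of_real (h r)) \<le> norm (M * norm (indicator {a..b} r *\<^sub>R f r))"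
    proof (intro AE_I2)
      fix r show "norm ((indicator {a..b} r *\<^sub>R f r) * of_real (h r)) \<le> norm (M * norm (indicator {a..b} r *\<^sub>R f r))"
        using M[of r] by (cases "r \<in> {a..b}") (auto simp: norm_mult mult.commute intro!: mult_right_mono)
    qed
  qed
qed

text \<open>Subtracting from \<open>\<psi>\<close> its integral times a fixed bump
  \<open>\<rho>\<close> of integral 1 leaves a function \<open>\<theta>\<close> of integral 0, whose
  primitive is compactly supported and hence admissible in \<open>zero\<close>. The constant is the
  pairing of \<open>w\<close> with \<open>\<rho>\<close>.\<close>

lemma AE_const_of_weak_derivative_zero:
  fixes w :: "real \<Rightarrow> complex"
  assumes w: "\<And>a b. 0 < a \<Longrightarrow> set_integrable lborel {a..b} w"
    and zero: "\<And>\<zeta> \<zeta>' :: real \<Rightarrow> real. C1_bump {0<..} \<zeta> \<zeta>' \<Longrightarrow> (LINT r|lborel. w r * of_real (\<zeta>' r)) = 0"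
  shows "\<exists>k. AE r in lborel. 0 < r \<longrightarrow> w r = k"
proof -
  \<comment> \<open>The integral of (r - 1)(2 - r) over [1,2] is 1/6. Continuity of
    \<open>\<rho>\<close> is enough, because only primitives have to be C1.\<close>
  define \<rho> :: "real \<Rightarrow> real" where "\<rho> r = 6 * (max 0 (r - 1) * max 0 (2 - r))" for r
  have \<rho>c: "continuous_on UNIV \<rho>" unfolding \<rho>_def by (intro continuous_intros)
  have \<rho>0: "\<rho> r = 0" if "r \<notin> {1..2}" for r using that by (auto simp: \<rho>_def)
  have \<rho>1: "(LINT r|lborel. \<rho> r) = 1"
  proof -
    have "\<rho> r = (6 * ((r-1)*(2-r))) * indicator {1..2} r" for r
      by (auto simp: \<rho>_def indicator_def)
    then have "(LINT r|lborel. \<rho> r) = (LINT r|lborel. (6 * ((r-1)*(2-r))) * indicator {1..2} r)" by simp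
    also have "\<dots> = (- 2 * 2^3 + 9 * 2^2 - 12 * 2) - (- 2 * 1^3 + 9 * 1^2 - 12 * 1)"
      by (rule integral_FTC_Icc_real[where F="\<lambda>r. - 2 * r^3 + 9 * r^2 - 12 * r"])
        (auto intro!: derivative_eq_intros continuous_intros simp: power2_eq_square algebra_simps)
    finally show ?thesis by simp
  qed
  define k where "k = (LINT r|lborel. w r * of_real (\<rho> r))"
  have "AE r in lborel. r \<in> {0<..} \<longrightarrow> w r - k = 0"
  proof (rule fundamental_lemma)
    show "set_integrable lborel (cbox a b) (\<lambda>r. w r - k)" if "cbox a b \<subseteq> {0<..}" for a b
    proof (cases "a \<le> b")
      case True
      then have "0 < a" using that by auto
      then show ?thesis using w[of a b] by (intro set_integral_diff) (auto simp: set_integrable_def intro!: integrable_scaleR_left integrable_real_indicator simp: emeasure_lborel_Icc_eq)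
    qed (simp add: set_integrable_def)
    fix \<psi> D :: "real \<Rightarrow> real" assume "C1_bump {0<..} \<psi> D"
    then obtain a b where ab: "0 < a" "a < b" "\<And>r. (\<psi> has_real_derivative D r) (at r)" "\<And>r. r \<notin> {a..b} \<Longrightarrow> \<psi> r = 0"
      by (rule C1_bump_real) blast
    have \<psi>c: "continuous_on UNIV \<psi>" using ab(3) by (meson DERIV_continuous_on has_field_derivative_at_within)
    define m where "m = (LINT r|lborel. \<psi> r)"
    define \<theta> where "\<theta> r = \<psi> r - m * \<rho> r" for r
    have \<theta>c: "continuous_on UNIV \<theta>" unfolding \<theta>_def by (intro continuous_intros \<psi>c \<rho>c)
    let ?a = "min a 1" and ?b = "max b 2"
    have \<theta>0: "\<theta> r = 0" if "r \<notin> {?a..?b}" for r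
    proof -
      have "r \<notin> {a..b}" "r \<notin> {1..2}" using that by auto
      then show ?thesis using ab(4)[of r] \<rho>0[of r] by (simp add: \<theta>_def)
    qed
    have conc: "integrable lborel h" if "continuous_on UNIV h" "\<And>r. r \<notin> {?a..?b} \<Longrightarrow> h r = 0" for h :: "real \<Rightarrow> real"
    proof -
      have "set_integrable lborel {?a..?b} h"
        using that(1) by (intro borel_integrable_atLeastAtMost') (auto intro: continuous_on_subset)
      then have "integrable lborel (\<lambda>r. indicator {?a..?b} r *\<^sub>R h r)" by (simp add: set_integrable_def)
      moreover have "(\<lambda>r. indicator {?a..?b} r *\<^sub>R h r) = h" using that(2) by (auto simp: indicator_def fun_eq_iff)
      ultimately show ?thesis by simp
    qed
    have i\<psi>: "integrable lborel \<psi>" by (rule conc[OF \<psi>c], rule ab(4)) auto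
    have i\<rho>: "integrable lborel \<rho>" by (rule conc[OF \<rho>c], rule \<rho>0) auto
    have int\<theta>: "(LINT r|lborel. \<theta> r) = 0" unfolding \<theta>_def using i\<psi> i\<rho> \<rho>1 by (simp add: m_def)
    \<comment> \<open>Normalised at the left end, the primitive vanishes to the left because
      \<theta> = 0 there, and to the right because \<open>\<theta>\<close> has integral 0.\<close>
    define Z where "Z r = (LBINT y=0..r. \<theta> y)" for r :: real
    have Zd: "(Z has_real_derivative \<theta> r) (at r)" for r
      unfolding Z_def by (rule antiderivative_real[OF \<theta>c])
    define \<zeta> where "\<zeta> r = Z r - Z ?a" for r
    have \<zeta>d: "(\<zeta> has_real_derivative \<theta> r) (at r)" for r
      unfolding \<zeta>_def using DERIV_diff[OF Zd DERIV_const] by simp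
    have \<zeta>b: "\<zeta> ?b = 0"
    proof -
      have "(LINT r|lborel. \<theta> r * indicator {?a..?b} r) = Z ?b - Z ?a"
        by (rule integral_FTC_Icc_real) (use Zd \<theta>c ab in \<open>auto intro: continuous_on_interior simp: continuous_on_eq_continuous_at\<close>)
      moreover have "\<theta> r * indicator {?a..?b} r = \<theta> r" for r using \<theta>0[of r] by (cases "r \<in> {?a..?b}") auto
      then have "(LINT r|lborel. \<theta> r * indicator {?a..?b} r) = (LINT r|lborel. \<theta> r)" by (simp only:)
      ultimately show ?thesis using int\<theta> by (simp add: \<zeta>_def)
    qed
    have lo: "\<zeta> r = 0" if "r < ?a" for r
    proof -
      have "\<exists>z. z > r \<and> z < ?a \<and> \<zeta> ?a - \<zeta> r = (?a - r) * \<theta> z"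
        by (rule MVT2[OF that]) (use \<zeta>d in auto)
      then obtain z where z: "z < ?a" "\<zeta> ?a - \<zeta> r = (?a - r) * \<theta> z" by blast
      have "\<theta> z = 0" by (rule \<theta>0) (use z(1) in auto)
      then show ?thesis using z(2) by (simp add: \<zeta>_def)
    qed
    have hi: "\<zeta> r = 0" if "?b < r" for r
    proof -
      have "\<exists>z. z > ?b \<and> z < r \<and> \<zeta> r - \<zeta> ?b = (r - ?b) * \<theta> z"
        by (rule MVT2[OF that]) (use \<zeta>d in auto)
      then obtain z where z: "z > ?b" "\<zeta> r - \<zeta> ?b = (r - ?b) * \<theta> z" by blast
      have "\<theta> z = 0" by (rule \<theta>0) (use z(1) in auto)
      then show ?thesis using z(2) \<zeta>b by simp
    qed
    have "C1_bump {0<..} \<zeta> \<theta>"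
    proof (rule C1_bump_realI[of ?a _ _ ?b])
      show "\<zeta> r = 0" if "r \<notin> {?a..?b}" for r
      proof -
        have "r < ?a \<or> ?b < r" using that by (simp only: atLeastAtMost_iff not_le de_Morgan_conj)
        then show ?thesis using lo hi by blast
      qed
    qed (use ab \<zeta>d \<theta>c in auto)
    then have "(LINT r|lborel. w r * of_real (\<theta> r)) = 0" by (rule zero)
    moreover have iw\<psi>: "integrable lborel (\<lambda>r. w r * of_real (\<psi> r))"
      by (rule integrable_loc_mult_bump[OF w \<psi>c ab(4) ab(1)])
    moreover have "integrable lborel (\<lambda>r. w r * of_real (\<rho> r))"
      by (rule integrable_loc_mult_bump[OF w \<rho>c \<rho>0]) auto
    ultimately have "(LINT r|lborel. w r * of_real (\<psi> r)) = of_real m * k"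
      unfolding \<theta>_def k_def by (simp add: algebra_simps)
    then show "(LINT r|lborel. (w r - k) * of_real (\<psi> r)) = 0"
      using iw\<psi> i\<psi> by (simp add: left_diff_distrib m_def)
  qed simp
  then show ?thesis by auto
qed


section \<open>Primitives of locally integrable functions on the half line\<close>

text \<open>The base point lies inside the half line because the integrands are controlled only on
  intervals [a,b] with a > 0 and need not be integrable up to 0.\<close>

definition primitive :: "(real \<Rightarrow> complex) \<Rightarrow> real \<Rightarrow> complex" where
  "primitive g r = (LBINT s=1..r. g s)"

lemma primitive_shift:
  assumes g: "\<And>a b. 0 < a \<Longrightarrow> set_integrable lborel {a..b} g" and a: "0 < a" "a \<le> r"
  shows "primitive g r = primitive g a + (LINT s:{a..r}|lborel. g s)"
proof -
  have "interval_lebesgue_integrable lborel (min (ereal 1) (min (ereal a) (ereal r))) (max (ereal 1) (max (ereal a) (ereal r))) g"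
  proof -
    have "set_integrable lborel {min 1 (min a r)<..<max 1 (max a r)} g"
      by (rule set_integrable_subset[OF g[of "min 1 (min a r)" "max 1 (max a r)"]]) (use a in auto)
    moreover have "min (ereal 1) (min (ereal a) (ereal r)) = ereal (min 1 (min a r))"
        "max (ereal 1) (max (ereal a) (ereal r)) = ereal (max 1 (max a r))"
      by (simp_all only: ereal_min ereal_max)
    moreover have "min 1 (min a r) \<le> max 1 (max a r)" by simp
    ultimately show ?thesis
      unfolding interval_lebesgue_integrable_def by (metis einterval_eq_Icc ereal_less_eq(3))
  qed
  from interval_integral_sum[OF this]
  have "(LBINT s=ereal 1..ereal a. g s) + (LBINT s=ereal a..ereal r. g s) = (LBINT s=ereal 1..ereal r. g s)" .
  then show ?thesis using interval_integral_Icc[OF a(2), of g] by (simp add: primitive_def one_ereal_def)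
qed

lemma primitive_continuous:
  assumes g: "\<And>a b. 0 < a \<Longrightarrow> set_integrable lborel {a..b} g"
  shows "continuous_on {0<..} (primitive g)"
proof -
  have "isCont (primitive g) r" if "r > 0" for r
  proof -
    have "continuous_on {r/2..r+1} (\<lambda>x. primitive g (r/2) + integral {r/2..x} g)"
      using g[of "r/2" "r+1"] that
      by (intro continuous_intros indefinite_integral_continuous_1 set_borel_integral_eq_integral(1)) auto
    moreover have "primitive g (r/2) + integral {r/2..x} g = primitive g x" if "x \<in> {r/2..r+1}" for x
      using primitive_shift[of g "r/2" x] g \<open>r > 0\<close> that set_borel_integral_eq_integral(2)[OF g[of "r/2" x]] by auto
    ultimately have "continuous_on {r/2..r+1} (primitive g)"
      using continuous_on_cong[OF refl, of "{r/2..r+1}" "primitive g" "\<lambda>x. primitive g (r/2) + integral {r/2..x} g"] by simp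
    then show ?thesis by (rule continuous_on_interior) (use that in auto)
  qed
  then show ?thesis by (intro continuous_at_imp_continuous_on) auto
qed

text \<open>For a merely locally integrable \<open>g\<close> there is no classical product rule;
  integration by parts is Fubini's theorem on the triangle s <= r.\<close>

lemma primitive_weak_derivative:
  assumes g: "\<And>a b. 0 < a \<Longrightarrow> set_integrable lborel {a..b} g" and "C1_bump {0<..} \<zeta> \<zeta>'"
  shows "(LINT r|lborel. primitive g r * of_real (\<zeta>' r)) = - (LINT r|lborel. g r * of_real (\<zeta> r))"
proof -
  obtain a b where ab: "0 < a" "a < b" "\<And>r. (\<zeta> has_real_derivative \<zeta>' r) (at r)" "continuous_on UNIV \<zeta>'"
    "\<And>r. r \<notin> {a..b} \<Longrightarrow> \<zeta> r = 0" "\<And>r. r \<notin> {a..b} \<Longrightarrow> \<zeta>' r = 0"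
    using C1_bump_real[OF assms(2)] by metis
  define gI where "gI s = indicator {a..b} s *\<^sub>R g s" for s
  have igI: "integrable lborel gI" unfolding gI_def using g[OF ab(1)] by (simp add: set_integrable_def)
  have [measurable]: "gI \<in> borel_measurable borel" using borel_measurable_integrable[OF igI] by simp
  have [measurable]: "\<zeta>' \<in> borel_measurable borel" by (rule borel_measurable_continuous_onI[OF ab(4)])
  \<comment> \<open>The right end b + 1 lies beyond the support, so the boundary term there drops
    out.\<close>
  have FTC: "(LINT r|lborel. \<zeta>' r * indicator {s..b+1} r) = - \<zeta> s" if "s \<le> b + 1" for s
  proof -
    have "(LINT r|lborel. \<zeta>' r * indicator {s..b+1} r) = \<zeta> (b+1) - \<zeta> s"
      by (rule integral_FTC_Icc_real[OF that]) (use ab(3,4) in \<open>auto simp: continuous_on_eq_continuous_at\<close>)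
    then show ?thesis using ab(5)[of "b+1"] by simp
  qed
  have i\<zeta>': "integrable lborel \<zeta>'"
  proof -
    have "set_integrable lborel {a..b} \<zeta>'"
      using ab(4) by (intro borel_integrable_atLeastAtMost') (auto intro: continuous_on_subset)
    then have "integrable lborel (\<lambda>r. indicator {a..b} r *\<^sub>R \<zeta>' r)" by (simp add: set_integrable_def)
    moreover have "(\<lambda>r. indicator {a..b} r *\<^sub>R \<zeta>' r) = \<zeta>'" using ab(6) by (auto simp: indicator_def fun_eq_iff)
    ultimately show ?thesis by simp
  qed
  have int0: "(LINT r|lborel. \<zeta>' r) = 0"
  proof -
    have "\<zeta>' r * indicator {a/2..b+1} r = \<zeta>' r" for r using ab(1) ab(6)[of r] by (cases "r \<in> {a..b}") auto
    then have "(LINT r|lborel. \<zeta>' r) = (LINT r|lborel. \<zeta>' r * indicator {a/2..b+1} r)" by (simp only:)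
    then show ?thesis using FTC[of "a/2"] ab(1,2) ab(5)[of "a/2"] by simp
  qed
  \<comment> \<open>Integrating out \<open>s\<close> gives \<open>\<zeta>'\<close> times the
    primitive based at \<open>a\<close>; integrating out \<open>r\<close> gives -g \<zeta>.\<close>
  define h where "h r s = of_real (\<zeta>' r) * gI s * of_real (indicator {..r} s)" for r s
  have ih: "integrable (lborel \<Otimes>\<^sub>M lborel) (case_prod h)"
  proof (rule Bochner_Integration.integrable_bound)
    show "integrable (lborel \<Otimes>\<^sub>M lborel) (\<lambda>(r,s). of_real (\<zeta>' r) * gI s)"
    proof (rule lborel_pair.Fubini_integrable)
      show "integrable lborel (\<lambda>x. LINT y|lborel. norm (case (x,y) of (r,s) \<Rightarrow> of_real (\<zeta>' r) * gI s))"
        using i\<zeta>' by (auto simp: norm_mult)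
      show "AE x in lborel. integrable lborel (\<lambda>y. case (x,y) of (r,s) \<Rightarrow> of_real (\<zeta>' r) * gI s)"
        using igI by auto
    qed measurable
    have "Measurable.pred (borel \<Otimes>\<^sub>M borel) (\<lambda>p::real\<times>real. snd p \<le> fst p)" by measurable
    then have "{p::real\<times>real. snd p \<le> fst p} \<in> sets (borel \<Otimes>\<^sub>M borel)" by (simp add: pred_def space_pair_measure)
    moreover have "indicator {..r} s = (indicator {p::real\<times>real. snd p \<le> fst p} (r,s) :: real)" for r s
      by (auto simp: indicator_def)
    ultimately show "case_prod h \<in> borel_measurable (lborel \<Otimes>\<^sub>M lborel)"
      unfolding h_def by (simp add: split_beta')
    show "AE x in lborel \<Otimes>\<^sub>M lborel. norm (case_prod h x) \<le> norm (case x of (r,s) \<Rightarrow> of_real (\<zeta>' r) * gI s)"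
      by (intro AE_I2) (auto simp: h_def norm_mult indicator_def)
  qed
  have e1: "(LINT s|lborel. h r s) = of_real (\<zeta>' r) * (LINT s:{a..r}|lborel. g s)" for r
  proof (cases "r \<in> {a..b}")
    case True
    have "h r s = of_real (\<zeta>' r) * (indicator {a..r} s *\<^sub>R g s)" for s
      using True by (auto simp: h_def gI_def indicator_def)
    then have "(LINT s|lborel. h r s) = (LINT s|lborel. of_real (\<zeta>' r) * (indicator {a..r} s *\<^sub>R g s))" by (simp only:)
    also have "\<dots> = of_real (\<zeta>' r) * (LINT s|lborel. indicator {a..r} s *\<^sub>R g s)"
      by (rule integral_mult_right_zero)
    finally show ?thesis by (simp add: set_lebesgue_integral_def)
  next
    case False then show ?thesis using ab(6) by (simp add: h_def)
  qed
  have e2: "(LINT r|lborel. h r s) = - (g s * of_real (\<zeta> s))" for s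
  proof (cases "s \<in> {a..b}")
    case True
    have "h r s = g s * of_real (\<zeta>' r * indicator {s..b+1} r)" for r
      using True ab(6)[of r] by (cases "r \<in> {a..b}") (auto simp: h_def gI_def indicator_def)
    then have "(LINT r|lborel. h r s) = g s * (LINT r|lborel. of_real (\<zeta>' r * indicator {s..b+1} r))"
      by simp
    also have "\<dots> = g s * of_real (- \<zeta> s)" using FTC[of s] True by (simp only: integral_complex_of_real) auto
    finally show ?thesis by simp
  next
    case False then show ?thesis using ab(5) by (simp add: h_def gI_def)
  qed
  have eqp: "primitive g r * of_real (\<zeta>' r) = primitive g a * of_real (\<zeta>' r) + (LINT s|lborel. h r s)" for r
  proof (cases "r \<in> {a..b}")
    case True then show ?thesis using primitive_shift[OF g ab(1), of r] by (simp add: e1 algebra_simps)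
  next
    case False then show ?thesis using ab(6) by (simp add: e1)
  qed
  have "(LINT r|lborel. primitive g r * of_real (\<zeta>' r)) = (LINT r|lborel. primitive g a * of_real (\<zeta>' r)) + (LINT r|lborel. LINT s|lborel. h r s)"
    unfolding eqp using i\<zeta>' lborel_pair.integrable_fst'[OF ih]
    by (intro Bochner_Integration.integral_add) auto
  also have "(LINT r|lborel. primitive g a * of_real (\<zeta>' r)) = 0" using int0 by simp
  also have "(LINT r|lborel. LINT s|lborel. h r s) = (LINT s|lborel. LINT r|lborel. h r s)"
    using lborel_pair.Fubini_integral[OF ih] by simp
  finally show ?thesis by (simp add: e2)
qed

text \<open>The difference of \<open>f\<close> and the primitive of \<open>g\<close> has weak
  derivative 0, hence is a.e. constant.\<close>

lemma AE_eq_primitive: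
  fixes f g :: "real \<Rightarrow> complex"
  assumes f: "\<And>a b. 0 < a \<Longrightarrow> set_integrable lborel {a..b} f"
    and g: "\<And>a b. 0 < a \<Longrightarrow> set_integrable lborel {a..b} g"
    and weak: "\<And>\<zeta> \<zeta>' :: real \<Rightarrow> real. C1_bump {0<..} \<zeta> \<zeta>' \<Longrightarrow>
      (LINT r|lborel. f r * of_real (\<zeta>' r)) = - (LINT r|lborel. g r * of_real (\<zeta> r))"
  shows "\<exists>k. AE r in lborel. 0 < r \<longrightarrow> f r = k + primitive g r"
proof -
  have p: "set_integrable lborel {a..b} (primitive g)" if "0 < a" for a b
    using that by (intro borel_integrable_atLeastAtMost' continuous_on_subset[OF primitive_continuous[OF g]]) auto
  have "\<exists>k. AE r in lborel. 0 < r \<longrightarrow> f r - primitive g r = k"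
  proof (rule AE_const_of_weak_derivative_zero)
    show "set_integrable lborel {a..b} (\<lambda>r. f r - primitive g r)" if "0 < a" for a b
      by (intro set_integral_diff f p that)
    fix \<zeta> \<zeta>' :: "real \<Rightarrow> real" assume C: "C1_bump {0<..} \<zeta> \<zeta>'"
    obtain a b where ab: "0 < a" "continuous_on UNIV \<zeta>'" "\<And>r. r \<notin> {a..b} \<Longrightarrow> \<zeta>' r = 0"
      using C1_bump_real[OF C] by metis
    have "integrable lborel (\<lambda>r. f r * of_real (\<zeta>' r))" "integrable lborel (\<lambda>r. primitive g r * of_real (\<zeta>' r))"
      using integrable_loc_mult_bump[OF f ab(2,3,1)] integrable_loc_mult_bump[OF p ab(2,3,1)] by auto
    then show "(LINT r|lborel. (f r - primitive g r) * of_real (\<zeta>' r)) = 0"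
      using weak[OF C] primitive_weak_derivative[OF g C] by (simp add: left_diff_distrib)
  qed
  then obtain k where "AE r in lborel. 0 < r \<longrightarrow> f r - primitive g r = k" by blast
  then have "AE r in lborel. 0 < r \<longrightarrow> f r = k + primitive g r"
    by eventually_elim (auto simp: algebra_simps)
  then show ?thesis by blast
qed

section \<open>Polar coordinates and radial averages\<close>

definition sphere_area :: "'a::euclidean_space itself \<Rightarrow> real" where
  "sphere_area _ = real DIM('a) * unit_ball_vol (real DIM('a))"

lemma sphere_area_pos: "sphere_area TYPE('a::euclidean_space) > 0"
  by (simp add: sphere_area_def)

text \<open>The density of |x| under Lebesgue measure. The indicator makes it a function on the
  whole line, so that \<open>density\<close> applies without restricting the measure.\<close>

definition radial_weight :: "'a::euclidean_space itself \<Rightarrow> real \<Rightarrow> real" where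
  "radial_weight T r = indicator {0<..} r * (sphere_area T * r ^ (DIM('a) - 1))"

lemma radial_weight_measurable [measurable]: "radial_weight T \<in> borel_measurable borel"
  unfolding radial_weight_def by measurable

lemma radial_weight_nonneg: "radial_weight T r \<ge> 0"
  using sphere_area_pos[where 'a='a] by (auto simp: radial_weight_def indicator_def sphere_area_def)

text \<open>Polar coordinates for radial integrands, with no measure on the sphere: both sides give
  the half line below a the volume of the ball of radius a, since the weight is the derivative of
  \<open>unit_ball_vol\<close> times r^d, and half lines determine the measure.\<close>

lemma distr_norm:
  "distr (lborel :: 'a::euclidean_space measure) borel norm = density lborel (\<lambda>r. ennreal (radial_weight TYPE('a) r))"
  (is "?M = ?N")
proof (rule measure_eqI_generator_eq[where E="range lessThan" and \<Omega>=UNIV and A="\<lambda>n. {..<real n}"])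
  show "Int_stable (range lessThan :: real set set)"
    by (auto simp: Int_stable_def lessThan_Int_lessThan simp del: lessThan_Int_lessThan) (metis Int_commute lessThan_subset_iff inf.absorb_iff2 linear rangeI)
  have d: "DIM('a) \<ge> 1" by (simp add: Suc_leI)
  have M: "emeasure ?M {..<a} = ennreal (if a \<le> 0 then 0 else unit_ball_vol (real DIM('a)) * a ^ DIM('a))" for a
  proof -
    have "norm -` {..<a} \<inter> space lborel = ball (0::'a) a" by (auto simp: dist_norm)
    then have "emeasure ?M {..<a} = emeasure lborel (ball (0::'a) a)" by (subst emeasure_distr) auto
    then show ?thesis using emeasure_ball[of a "0::'a"] by (cases "a \<le> 0") (auto simp: ball_empty)
  qed
  have N: "emeasure ?N {..<a} = ennreal (if a \<le> 0 then 0 else unit_ball_vol (real DIM('a)) * a ^ DIM('a))" for a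
  proof (cases "a \<le> 0")
    case True
    then have "emeasure ?N {..<a} = (\<integral>\<^sup>+r. 0 \<partial>(lborel :: real measure))"
      by (subst emeasure_density) (auto intro!: nn_integral_cong simp: radial_weight_def indicator_def simp del: nn_integral_const)
    then show ?thesis using True by simp
  next
    case False
    let ?f = "\<lambda>r. sphere_area TYPE('a) * r ^ (DIM('a) - 1)"
    have "emeasure ?N {..<a} = (\<integral>\<^sup>+r. ennreal (radial_weight TYPE('a) r) * indicator {..<a} r \<partial>lborel)"
      by (subst emeasure_density) auto
    also have "\<dots> = (\<integral>\<^sup>+r. ennreal (?f r) * indicator {0..a} r \<partial>lborel)"
    proof (rule nn_integral_cong_AE)
      have "AE r in lborel. r \<noteq> (0::real)" "AE r in lborel. r \<noteq> a" by (rule AE_lborel_singleton)+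
      then show "AE r in lborel. ennreal (radial_weight TYPE('a) r) * indicator {..<a} r = ennreal (?f r) * indicator {0..a} r"
        by eventually_elim (auto simp: radial_weight_def indicator_def)
    qed
    also have "\<dots> = unit_ball_vol (real DIM('a)) * a ^ DIM('a) - unit_ball_vol (real DIM('a)) * 0 ^ DIM('a)"
    proof (rule nn_integral_FTC_Icc)
      show "((\<lambda>r. unit_ball_vol (real DIM('a)) * r ^ DIM('a)) has_real_derivative ?f x) (at x)" for x
        by (auto intro!: derivative_eq_intros simp: sphere_area_def)
      show "?f x \<ge> 0" if "x \<in> {0..a}" for x using sphere_area_pos[where 'a='a] that by auto
    qed (use False in auto)
    finally show ?thesis using False by simp
  qed
  show "emeasure ?M X = emeasure ?N X" if "X \<in> range lessThan" for X
    using that M N by auto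
  show "emeasure ?M {..<real i} \<noteq> \<infinity>" for i using M[of "real i"] by auto
  show "(\<Union>i. {..<real i}) = (UNIV :: real set)" using reals_Archimedean2 by auto
qed (auto simp: borel_Iio)

lemma
  fixes f :: "real \<Rightarrow> 'b::{banach, second_countable_topology}"
  assumes [measurable]: "f \<in> borel_measurable borel"
  shows integrable_norm_iff: "integrable (lborel :: 'a::euclidean_space measure) (\<lambda>x. f (norm x)) \<longleftrightarrow>
      integrable lborel (\<lambda>r. radial_weight TYPE('a) r *\<^sub>R f r)" (is ?I)
    and integral_norm_eq: "(LINT x|(lborel :: 'a::euclidean_space measure). f (norm x)) = (LINT r|lborel. radial_weight TYPE('a) r *\<^sub>R f r)" (is ?E)
proof -
  show ?I
    using integrable_distr_eq[of norm "lborel :: 'a measure" borel f] integrable_density[of f lborel "radial_weight TYPE('a)"]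
    by (simp add: distr_norm radial_weight_nonneg)
  show ?E
    using integral_distr[of norm "lborel :: 'a measure" borel f] integral_density[of f lborel "radial_weight TYPE('a)"]
    by (simp add: distr_norm radial_weight_nonneg)
qed

lemma radial_weight_eq_0_iff: "radial_weight TYPE('a::euclidean_space) r = 0 \<longleftrightarrow> r \<le> 0"
  using sphere_area_pos[where 'a='a] by (auto simp: radial_weight_def indicator_def)

lemma AE_normI:
  assumes "AE r in lborel. 0 < r \<longrightarrow> P r"
  shows "AE x in (lborel :: 'a::euclidean_space measure). P (norm x)"
proof -
  have "AE r in distr (lborel :: 'a measure) borel norm. P r"
    unfolding distr_norm using assms
    by (subst AE_density) (auto simp: ennreal_eq_0_iff radial_weight_eq_0_iff radial_weight_nonneg less_le not_le)
  then show ?thesis by (rule AE_distrD[rotated]) auto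
qed

lemma AE_norm_iff:
  assumes [measurable]: "Measurable.pred borel P"
  shows "(AE x in (lborel :: 'a::euclidean_space measure). P (norm x)) \<longleftrightarrow> (AE r in lborel. 0 < r \<longrightarrow> P r)"
proof -
  have "(AE x in (lborel :: 'a measure). P (norm x)) \<longleftrightarrow> (AE r in distr (lborel :: 'a measure) borel norm. P r)"
    by (subst AE_distr_iff) auto
  also have "\<dots> \<longleftrightarrow> (AE r in lborel. 0 < r \<longrightarrow> P r)"
    unfolding distr_norm 
    by (subst AE_density) (auto simp: ennreal_eq_0_iff radial_weight_eq_0_iff radial_weight_nonneg less_le not_le)
  finally show ?thesis .
qed

text \<open>
  The profile in \<^const>\<open>radial\<close> is an arbitrary function.  A superlevel set of \<open>Q\<close> is, up to a null
  set, a countable union of compact sets, and their images under the norm are compact.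
\<close>

lemma radial_superlevel_borel:
  fixes Q :: "'a::euclidean_space \<Rightarrow> real"
  assumes [measurable]: "Q \<in> borel_measurable borel" and q: "AE x in lborel. Q x = q (norm x)"
  shows "\<exists>S\<in>sets borel. AE x in lborel. Q x > a \<longleftrightarrow> norm x \<in> S"
proof -
  \<comment> \<open>Off the null set \<open>Z\<close> the relation with the profile \<open>q\<close>
    is exact. Discarding \<open>Z\<close> before taking images matters, since the image of a null
    set under the norm need not be null.\<close>
  obtain Z where Z: "Z \<in> null_sets lborel" "\<And>x. x \<notin> Z \<Longrightarrow> Q x = q (norm x)"
  proof -
    obtain N where "{x \<in> space lborel. \<not> Q x = q (norm x)} \<subseteq> N" "emeasure lborel N = 0" "N \<in> sets lborel"
      using q by (rule AE_E)
    then have "N \<in> null_sets lborel" "\<And>x. x \<notin> N \<Longrightarrow> Q x = q (norm x)" by auto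
    then show ?thesis by (rule that)
  qed
  have "{x. Q x > a} \<in> sets borel" by measurable
  moreover have "Z \<in> sets borel" using null_setsD2[OF Z(1)] by simp
  ultimately have "{x. Q x > a} - Z \<in> sets lborel" by simp
  then have "{x. Q x > a} - Z \<in> sets lebesgue" by (rule sets_completionI_sets)
  then obtain C T where CT: "fsigma C" "T \<in> null_sets lebesgue" "C \<union> T = {x. Q x > a} - Z"
    by (rule lebesgue_set_almost_fsigma)
  obtain F :: "nat \<Rightarrow> 'a set" where F: "\<And>n. compact (F n)" "C = (\<Union>n. F n)"
    using fsigma_Union_compact[THEN iffD1, OF CT(1)] by (auto simp: subset_eq)
  have "compact (norm ` F n)" for n by (intro compact_continuous_image continuous_intros F)
  then have S: "norm ` C \<in> sets borel" unfolding F(2) image_UN by (intro sets.countable_UN) (auto intro: borel_compact)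
  have "AE x in lborel. x \<notin> Z" by (rule AE_not_in[OF Z(1)])
  moreover have "AE x in lborel. x \<notin> T"
    using AE_not_in[OF CT(2)] by (simp add: AE_completion_iff)
  ultimately have "AE x in lborel. Q x > a \<longleftrightarrow> norm x \<in> norm ` C"
  proof eventually_elim
    case (elim x)
    show ?case
    proof
      assume "Q x > a"
      then have "x \<in> C" using CT(3) elim by blast
      then show "norm x \<in> norm ` C" by blast
    next
      \<comment> \<open>A point with the same norm as some y in \<open>C\<close> has the same value
        of \<open>q\<close>, hence the same value of \<open>Q\<close> because neither point lies in
        \<open>Z\<close>.\<close>
      assume "norm x \<in> norm ` C"
      then obtain y where y: "y \<in> C" "norm x = norm y" by blast
      then have "Q y > a" "y \<notin> Z" using CT(3) by blast+
      then have "q (norm x) > a" using Z(2)[of y] y(2) by simp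
      then show "Q x > a" using Z(2)[of x] elim by simp
    qed
  qed
  then show ?thesis using S by blast
qed

lemma radial_profile_measurable_real:
  fixes Q :: "'a::euclidean_space \<Rightarrow> real"
  assumes Q: "Q \<in> borel_measurable borel" and q: "AE x in lborel. Q x = q (norm x)"
  shows "\<exists>q'\<in>borel_measurable borel. AE x in lborel. Q x = q' (norm x)"
proof -
  have "\<forall>a. \<exists>S\<in>sets borel. AE x in lborel. Q x > a \<longleftrightarrow> norm x \<in> S"
    using radial_superlevel_borel[OF assms] by blast
  then obtain S where S: "\<And>a. S a \<in> sets borel" "\<And>a. AE x in lborel. Q x > a \<longleftrightarrow> norm x \<in> S a" by metis
  \<comment> \<open>A number is the supremum of the rationals below it, so the profile is rebuilt
    from the radial superlevel sets. Extended reals allow the supremum to be infinite at exceptional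
    radii.\<close>
  define q' where "q' r = real_of_ereal (SUP a\<in>\<rat>. if r \<in> S a then ereal a else -\<infinity>)" for r
  have [measurable]: "S a \<in> sets borel" for a by (rule S)
  have "q' \<in> borel_measurable borel" unfolding q'_def
    by (intro borel_measurable_real_of_ereal borel_measurable_SUP countable_rat) measurable
  moreover have "AE x in lborel. \<forall>a\<in>\<rat>. Q x > a \<longleftrightarrow> norm x \<in> S a"
    by (subst AE_ball_countable) (auto intro: countable_rat S)
  then have "AE x in lborel. Q x = q' (norm x)"
  proof eventually_elim
    case (elim x)
    have "(SUP a\<in>\<rat>. if norm x \<in> S a then ereal a else -\<infinity>) = ereal (Q x)"
    proof (rule SUP_eqI)
      show "(if norm x \<in> S a then ereal a else -\<infinity>) \<le> ereal (Q x)" if "a \<in> \<rat>" for a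
        using elim that by (auto intro: less_imp_le)
      fix y assume y: "\<And>a. a \<in> \<rat> \<Longrightarrow> (if norm x \<in> S a then ereal a else -\<infinity>) \<le> y"
      show "ereal (Q x) \<le> y"
      proof (rule dense_le)
        fix z assume z: "z < ereal (Q x)"
        obtain z' where z': "z < ereal z'" "ereal z' < ereal (Q x)" using ereal_dense2[OF z] by blast
        obtain a where a: "a \<in> \<rat>" "z' < a" "a < Q x" using Rats_dense_in_real[of z' "Q x"] z' by auto
        then have "ereal a \<le> y" using y[of a] elim by auto
        then show "z \<le> y" using z'(1) a(2) by (meson less_ereal.simps(1) less_imp_le less_le_trans)
      qed
    qed
    then show ?case by (simp add: q'_def)
  qed
  ultimately show ?thesis by blast
qed

lemma radial_profile_measurable:
  fixes Q :: "'a::euclidean_space \<Rightarrow> complex"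
  assumes [measurable]: "Q \<in> borel_measurable borel" and q: "AE x in lborel. Q x = q (norm x)"
  shows "\<exists>q'\<in>borel_measurable borel. AE x in lborel. Q x = q' (norm x)"
proof -
  have "\<exists>q1\<in>borel_measurable borel. AE x in lborel. Re (Q x) = q1 (norm x)"
  proof (rule radial_profile_measurable_real)
    show "(\<lambda>x. Re (Q x)) \<in> borel_measurable borel" by measurable
    show "AE x in lborel. Re (Q x) = (\<lambda>r. Re (q r)) (norm x)" using q by eventually_elim simp
  qed
  moreover have "\<exists>q2\<in>borel_measurable borel. AE x in lborel. Im (Q x) = q2 (norm x)"
  proof (rule radial_profile_measurable_real)
    show "(\<lambda>x. Im (Q x)) \<in> borel_measurable borel" by measurable
    show "AE x in lborel. Im (Q x) = (\<lambda>r. Im (q r)) (norm x)" using q by eventually_elim simp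
  qed
  ultimately obtain q1 q2 where [measurable]: "q1 \<in> borel_measurable borel" "q2 \<in> borel_measurable borel"
    and e: "AE x in lborel. Re (Q x) = q1 (norm x)" "AE x in lborel. Im (Q x) = q2 (norm x)" by blast
  have "(\<lambda>r. Complex (q1 r) (q2 r)) \<in> borel_measurable borel"
    unfolding Complex_eq by measurable
  moreover have "AE x in lborel. Q x = Complex (q1 (norm x)) (q2 (norm x))"
    using e by eventually_elim (simp add: complex_eq_iff)
  ultimately show ?thesis by (intro bexI[of _ "\<lambda>r. Complex (q1 r) (q2 r)"]) auto
qed

text \<open>
  The weak gradient of a radial function is not known to be radial at first: it is replaced by its
  conditional expectation with respect to the norm.
\<close>

definition norm_algebra :: "'a::euclidean_space measure" where
  "norm_algebra = vimage_algebra UNIV norm borel"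

lemma sets_norm_algebra: "sets (norm_algebra :: 'a::euclidean_space measure) = {norm -` A | A. A \<in> sets borel}"
  unfolding norm_algebra_def by (subst sets_vimage_algebra2) auto

lemma norm_measurable_norm_algebra: "norm \<in> borel_measurable norm_algebra"
  unfolding norm_algebra_def by (rule measurable_vimage_algebra1) auto

text \<open>Conditional expectations with respect to \<open>norm_algebra\<close> require the
  restricted measure to be sigma-finite; the balls about 0 belong to the algebra and have finite
  measure.\<close>

lemma sigma_finite_subalgebra_norm: "sigma_finite_subalgebra (lborel :: 'a::euclidean_space measure) norm_algebra"
proof
  have [measurable]: "(norm :: 'a \<Rightarrow> real) \<in> borel_measurable borel" by measurable
  show sub: "subalgebra (lborel :: 'a measure) norm_algebra"
    unfolding subalgebra_def sets_norm_algebra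
  proof (intro conjI subsetI)
    show "space (norm_algebra :: 'a measure) = space lborel" by (simp add: norm_algebra_def)
    fix B :: "'a set" assume "B \<in> {norm -` A | A. A \<in> sets borel}"
    then obtain A where "B = norm -` A" "A \<in> sets borel" by blast
    then show "B \<in> sets lborel" using measurable_sets[of norm "borel :: 'a measure" borel A] by simp
  qed
  show "\<exists>A. countable A \<and> A \<subseteq> sets (restr_to_subalg lborel (norm_algebra :: 'a measure)) \<and>
     \<Union>A = space (restr_to_subalg lborel (norm_algebra :: 'a measure)) \<and> (\<forall>a\<in>A. emeasure (restr_to_subalg lborel (norm_algebra :: 'a measure)) a \<noteq> \<infinity>)"
  proof (intro exI[of _ "range (\<lambda>n::nat. cball 0 (real n))"] conjI ballI)
    have c: "cball (0::'a) (real n) \<in> sets norm_algebra" for n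
      unfolding sets_norm_algebra by (auto intro!: exI[of _ "{..real n}"] simp: dist_norm)
    then show "range (\<lambda>n. cball 0 (real n)) \<subseteq> sets (restr_to_subalg lborel (norm_algebra :: 'a measure))"
      by (auto simp: sets_restr_to_subalg[OF sub])
    show "\<Union> (range (\<lambda>n. cball 0 (real n))) = space (restr_to_subalg lborel (norm_algebra :: 'a measure))"
      by (auto simp: space_restr_to_subalg dist_norm intro: real_arch_simple)
    fix a :: "'a set" assume "a \<in> range (\<lambda>n. cball 0 (real n))"
    then show "emeasure (restr_to_subalg lborel norm_algebra) a \<noteq> \<infinity>"
      using c emeasure_restr_to_subalg[OF sub] emeasure_cball[of _ "0::'a"] by (auto simp: )
  qed simp
qed

text \<open>The conditional expectation is measurable with respect to the norm, hence constant on
  spheres, and \<open>p\<close> is read off along the ray through a unit vector \<open>e\<close>.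
  Integrals against radial weights \<open>\<eta>\<close> are preserved by averaging.\<close>

lemma radial_average_real:
  fixes g :: "'a::euclidean_space \<Rightarrow> real"
  assumes [measurable]: "g \<in> borel_measurable borel"
  shows "\<exists>p\<in>borel_measurable borel. \<forall>\<eta>\<in>borel_measurable borel. integrable lborel (\<lambda>x. \<eta> (norm x) * g x) \<longrightarrow>
     integrable (lborel :: 'a measure) (\<lambda>x. \<eta> (norm x) * p (norm x)) \<and>
     (LINT x|(lborel :: 'a measure). \<eta> (norm x) * p (norm x)) = (LINT x|lborel. \<eta> (norm x) * g x)"
proof -
  interpret sigma_finite_subalgebra "lborel :: 'a measure" norm_algebra by (rule sigma_finite_subalgebra_norm)
  define E where "E = real_cond_exp lborel (norm_algebra :: 'a measure) g"
  have E1: "E \<in> borel_measurable norm_algebra" unfolding E_def by (rule borel_measurable_cond_exp)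
  have E2: "E \<in> borel_measurable borel" unfolding E_def using borel_measurable_cond_exp2[of lborel norm_algebra g] by simp
  obtain e :: 'a where e: "norm e = 1" using nonempty_Basis norm_Basis by blast
  define p where "p r = E (r *\<^sub>R e)" for r
  have p: "p \<in> borel_measurable borel" unfolding p_def by (rule measurable_compose[OF _ E2]) measurable
  have Ep: "E x = p (norm x)" for x
  proof -
    have "E -` {E x} \<inter> space norm_algebra \<in> sets norm_algebra" by (rule measurable_sets[OF E1]) auto
    moreover have "space (norm_algebra :: 'a measure) = UNIV" by (simp add: norm_algebra_def)
    ultimately obtain A where A: "E -` {E x} = norm -` A" unfolding sets_norm_algebra by auto
    have "norm (norm x *\<^sub>R e) = norm x" using e by simp
    then have "norm x *\<^sub>R e \<in> norm -` A" using A by (metis vimage_eq vimage_singleton_eq)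
    then have "norm x *\<^sub>R e \<in> E -` {E x}" unfolding A .
    then show ?thesis by (simp add: p_def)
  qed
  show ?thesis
  proof (intro bexI[OF _ p] ballI impI)
    fix \<eta> :: "real \<Rightarrow> real" assume \<eta>: "\<eta> \<in> borel_measurable borel" and i: "integrable lborel (\<lambda>x. \<eta> (norm x) * g x)"
    have "(\<lambda>x::'a. \<eta> (norm x)) \<in> borel_measurable norm_algebra"
      by (rule measurable_compose[OF norm_measurable_norm_algebra \<eta>])
    from real_cond_exp_intg[OF i this] show "integrable lborel (\<lambda>x::'a. \<eta> (norm x) * p (norm x)) \<and>
     (LINT x|(lborel :: 'a measure). \<eta> (norm x) * p (norm x)) = (LINT x|lborel. \<eta> (norm x) * g x)"
      by (simp add: Ep[symmetric] E_def)
  qed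
qed

lemma radial_average:
  fixes g :: "'a::euclidean_space \<Rightarrow> complex"
  assumes [measurable]: "g \<in> borel_measurable borel"
  shows "\<exists>p\<in>borel_measurable borel. \<forall>\<eta>::real\<Rightarrow>real. \<eta>\<in>borel_measurable borel \<longrightarrow> integrable lborel (\<lambda>x. g x * of_real (\<eta> (norm x))) \<longrightarrow>
     integrable (lborel :: 'a measure) (\<lambda>x. p (norm x) * of_real (\<eta> (norm x))) \<and>
     (LINT x|(lborel :: 'a measure). p (norm x) * of_real (\<eta> (norm x))) = (LINT x|lborel. g x * of_real (\<eta> (norm x)))"
proof -
  obtain p1 where p1[measurable]: "p1 \<in> borel_measurable borel" and P1: "\<And>\<eta>. \<eta>\<in>borel_measurable borel \<Longrightarrow> integrable lborel (\<lambda>x. \<eta> (norm x) * Re (g x)) \<Longrightarrow>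
     integrable (lborel :: 'a measure) (\<lambda>x. \<eta> (norm x) * p1 (norm x)) \<and>
     (LINT x|(lborel :: 'a measure). \<eta> (norm x) * p1 (norm x)) = (LINT x|lborel. \<eta> (norm x) * Re (g x))"
    using radial_average_real[of "\<lambda>x. Re (g x)"] by auto
  obtain p2 where p2[measurable]: "p2 \<in> borel_measurable borel" and P2: "\<And>\<eta>. \<eta>\<in>borel_measurable borel \<Longrightarrow> integrable lborel (\<lambda>x. \<eta> (norm x) * Im (g x)) \<Longrightarrow>
     integrable (lborel :: 'a measure) (\<lambda>x. \<eta> (norm x) * p2 (norm x)) \<and>
     (LINT x|(lborel :: 'a measure). \<eta> (norm x) * p2 (norm x)) = (LINT x|lborel. \<eta> (norm x) * Im (g x))"
    using radial_average_real[of "\<lambda>x. Im (g x)"] by auto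
  define p where "p r = Complex (p1 r) (p2 r)" for r
  have p: "p \<in> borel_measurable borel" unfolding p_def Complex_eq by measurable
  show ?thesis
  proof (intro bexI[OF _ p] allI impI)
    fix \<eta> :: "real \<Rightarrow> real" assume \<eta>: "\<eta> \<in> borel_measurable borel" and i: "integrable lborel (\<lambda>x. g x * of_real (\<eta> (norm x)))"
    have r: "(\<lambda>x. \<eta> (norm x) * Re (g x)) = (\<lambda>x. Re (g x * of_real (\<eta> (norm x))))"
      "(\<lambda>x. \<eta> (norm x) * Im (g x)) = (\<lambda>x. Im (g x * of_real (\<eta> (norm x))))" by (auto simp: mult.commute)
    have i1: "integrable lborel (\<lambda>x. \<eta> (norm x) * Re (g x))" "integrable lborel (\<lambda>x. \<eta> (norm x) * Im (g x))"
      unfolding r using i by (rule integrable_Re, rule integrable_Im)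
    note Q1 = P1[OF \<eta> i1(1)] and Q2 = P2[OF \<eta> i1(2)]
    have pe: "p (norm x) * of_real (\<eta> (norm x)) = of_real (\<eta> (norm x) * p1 (norm x)) + \<i> * of_real (\<eta> (norm x) * p2 (norm x))" for x :: 'a
      by (simp add: complex_eq_iff p_def)
    have ge: "g x * of_real (\<eta> (norm x)) = of_real (\<eta> (norm x) * Re (g x)) + \<i> * of_real (\<eta> (norm x) * Im (g x))" for x
      by (simp add: complex_eq_iff)
    have I: "integrable (lborel :: 'a measure) (\<lambda>x. complex_of_real (\<eta> (norm x) * p1 (norm x)))"
      "integrable (lborel :: 'a measure) (\<lambda>x. \<i> * complex_of_real (\<eta> (norm x) * p2 (norm x)))"
      "integrable (lborel :: 'a measure) (\<lambda>x. complex_of_real (\<eta> (norm x) * Re (g x)))"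
      "integrable (lborel :: 'a measure) (\<lambda>x. \<i> * complex_of_real (\<eta> (norm x) * Im (g x)))"
      using Q1 Q2 i1 by (auto simp del: of_real_mult intro!: integrable_of_real integrable_mult_right)
    have "(LINT x|(lborel :: 'a measure). p (norm x) * of_real (\<eta> (norm x))) =
        of_real (LINT x|(lborel :: 'a measure). \<eta> (norm x) * p1 (norm x)) + \<i> * of_real (LINT x|(lborel :: 'a measure). \<eta> (norm x) * p2 (norm x))"
      unfolding pe by (subst Bochner_Integration.integral_add[OF I(1,2)]) (simp only: integral_mult_right_zero integral_complex_of_real)
    moreover have "(LINT x|(lborel :: 'a measure). g x * of_real (\<eta> (norm x))) =
        of_real (LINT x|(lborel :: 'a measure). \<eta> (norm x) * Re (g x)) + \<i> * of_real (LINT x|(lborel :: 'a measure). \<eta> (norm x) * Im (g x))"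
      unfolding ge by (subst Bochner_Integration.integral_add[OF I(3,4)]) (simp only: integral_mult_right_zero integral_complex_of_real)
    ultimately show "integrable (lborel :: 'a measure) (\<lambda>x. p (norm x) * of_real (\<eta> (norm x))) \<and>
     (LINT x|(lborel :: 'a measure). p (norm x) * of_real (\<eta> (norm x))) = (LINT x|lborel. g x * of_real (\<eta> (norm x)))"
      using Q1 Q2 Bochner_Integration.integrable_add[OF I(1,2)] by (simp add: pe)
  qed
qed

section \<open>Weak derivatives\<close>

text \<open>The increment from x0 to x0 + h is split by switching on one coordinate of h at a time;
  the mean value theorem and the continuity of the partials control each step.\<close>

lemma has_derivative_of_continuous_partials:
  fixes f :: "real^'d \<Rightarrow> real"
  assumes D: "\<And>j. continuous_on UNIV (D j)"
    and f: "\<And>j x. ((\<lambda>t. f (x + t *\<^sub>R axis j 1)) has_real_derivative D j x) (at 0)"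
  shows "(f has_derivative (\<lambda>h. (\<chi> j. D j x0) \<bullet> h)) (at x0)"
proof (rule has_derivativeI_sandwich[where H="\<lambda>y. norm (f y - f x0 - (\<chi> j. D j x0) \<bullet> (y - x0)) / norm (y - x0)" and e=1])
  \<comment> \<open>\<open>?part S h\<close> keeps the coordinates of \<open>h\<close> in
    \<open>S\<close>; the induction over \<open>S\<close> leads from 0 to \<open>h\<close>.\<close>
  let ?part = "\<lambda>S h::real^'d. (\<chi> j. if j \<in> S then h $ j else 0)"
  have line: "((\<lambda>t. f (y + t *\<^sub>R axis j 1)) has_real_derivative D j (y + t *\<^sub>R axis j 1)) (at t)" for y j t
  proof -
    have "((\<lambda>s. f ((y + t *\<^sub>R axis j 1) + s *\<^sub>R axis j 1)) has_real_derivative D j (y + t *\<^sub>R axis j 1)) (at 0)"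
      by (rule f)
    then have "((\<lambda>s. f (y + (s + t) *\<^sub>R axis j 1)) has_real_derivative D j (y + t *\<^sub>R axis j 1)) (at 0)"
      by (simp add: algebra_simps)
    then show ?thesis using DERIV_shift[of "\<lambda>t. f (y + t *\<^sub>R axis j 1)" "D j (y + t *\<^sub>R axis j 1)" 0 t] by simp
  qed
  have key: "\<exists>\<delta>>0. \<forall>h. norm h < \<delta> \<longrightarrow> \<bar>f (x0 + h) - f x0 - (\<chi> j. D j x0) \<bullet> h\<bar> \<le> real CARD('d) * e * norm h" if "e > 0" for e
  proof -
    have "\<forall>\<^sub>F y in nhds x0. \<forall>j. \<bar>D j y - D j x0\<bar> < e"
    proof (rule eventually_all_finite)
      fix j
      have "isCont (D j) x0" using D[of j] by (simp add: continuous_on_eq_continuous_at)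
      then have "(D j \<longlongrightarrow> D j x0) (nhds x0)" by (simp add: isCont_def tendsto_at_iff_tendsto_nhds)
      then show "\<forall>\<^sub>F y in nhds x0. \<bar>D j y - D j x0\<bar> < e"
        using that by (simp add: tendsto_iff dist_real_def)
    qed
    then obtain \<delta> where \<delta>: "\<delta> > 0" "\<And>y j. dist y x0 < \<delta> \<Longrightarrow> \<bar>D j y - D j x0\<bar> < e"
      unfolding eventually_nhds_metric by blast
    show ?thesis
    proof (intro exI[of _ \<delta>] conjI allI impI \<delta>(1))
      fix h :: "real^'d" assume h: "norm h < \<delta>"
      have "\<bar>f (x0 + ?part S h) - f x0 - (\<Sum>j\<in>S. D j x0 * h $ j)\<bar> \<le> real (card S) * e * norm h" if "finite S" for S
        using that
      proof (induction S rule: finite_induct)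
        case empty
        have "(\<chi> j. 0) = (0::real^'d)" by (simp add: vec_eq_iff)
        then show ?case by simp
      next
        case (insert k S)
        let ?y = "x0 + ?part S h"
        have pk: "x0 + ?part (insert k S) h = ?y + (h $ k) *\<^sub>R axis k 1"
          using insert(2) by (auto simp: vec_eq_iff axis_def)
        have bd: "\<bar>f (?y + t *\<^sub>R axis k 1) - f ?y - t * D k x0\<bar> \<le> e * \<bar>t\<bar>" if t: "\<bar>t\<bar> \<le> \<bar>h $ k\<bar>" for t
        proof -
          have "\<exists>z. \<bar>z\<bar> \<le> \<bar>t\<bar> \<and> f (?y + t *\<^sub>R axis k 1) - f ?y = t * D k (?y + z *\<^sub>R axis k 1)"
          proof (cases t "0::real" rule: linorder_cases)
            case greater
            have "\<exists>z. z > 0 \<and> z < t \<and> f (?y + t *\<^sub>R axis k 1) - f (?y + 0 *\<^sub>R axis k 1) = (t - 0) * D k (?y + z *\<^sub>R axis k 1)"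
              by (rule MVT2[OF greater]) (rule line)
            then show ?thesis by force
          next
            case less
            have "\<exists>z. z > t \<and> z < 0 \<and> f (?y + 0 *\<^sub>R axis k 1) - f (?y + t *\<^sub>R axis k 1) = (0 - t) * D k (?y + z *\<^sub>R axis k 1)"
              by (rule MVT2[OF less]) (rule line)
            then obtain z where "z > t" "z < 0" "f ?y - f (?y + t *\<^sub>R axis k 1) = (0 - t) * D k (?y + z *\<^sub>R axis k 1)" by auto
            then show ?thesis by (intro exI[of _ z]) auto
          next
            case equal then show ?thesis by (intro exI[of _ 0]) simp
          qed
          then obtain z where z: "\<bar>z\<bar> \<le> \<bar>t\<bar>" "f (?y + t *\<^sub>R axis k 1) - f ?y = t * D k (?y + z *\<^sub>R axis k 1)" by blast
          have "norm (?part S h + z *\<^sub>R axis k 1) \<le> norm h"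
            using insert(2) z(1) t by (intro norm_le_componentwise_cart) (auto simp: axis_def)
          then have "dist (?y + z *\<^sub>R axis k 1) x0 < \<delta>" using h by (simp add: dist_norm add.assoc)
          then have "\<bar>D k (?y + z *\<^sub>R axis k 1) - D k x0\<bar> \<le> e" using \<delta>(2) less_imp_le by blast
          then have "\<bar>t\<bar> * \<bar>D k (?y + z *\<^sub>R axis k 1) - D k x0\<bar> \<le> \<bar>t\<bar> * e" by (intro mult_left_mono) auto
          then show ?thesis unfolding z(2) by (simp add: abs_mult[symmetric] algebra_simps)
        qed
        have "\<bar>f (?y + (h $ k) *\<^sub>R axis k 1) - f ?y - (h $ k) * D k x0\<bar> \<le> e * norm h"
        proof -
          have "e * \<bar>h $ k\<bar> \<le> e * norm h"
            by (rule mult_left_mono[OF component_le_norm_cart]) (use \<open>e > 0\<close> in simp)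
          then show ?thesis using bd[of "h $ k"] by linarith
        qed
        moreover have "(\<Sum>j\<in>insert k S. D j x0 * h $ j) = D k x0 * h $ k + (\<Sum>j\<in>S. D j x0 * h $ j)"
          using insert by simp
        moreover have "real (card (insert k S)) * e * norm h = e * norm h + real (card S) * e * norm h"
          using insert by (simp add: algebra_simps)
        ultimately show ?case unfolding pk using insert.IH by (simp add: mult.commute)
      qed
      from this[of UNIV] show "\<bar>f (x0 + h) - f x0 - (\<chi> j. D j x0) \<bullet> h\<bar> \<le> real CARD('d) * e * norm h"
        by (simp add: inner_vec_def vec_lambda_eta)
    qed
  qed
  show "((\<lambda>y. norm (f y - f x0 - (\<chi> j. D j x0) \<bullet> (y - x0)) / norm (y - x0)) \<longlongrightarrow> 0) (at x0)"
  proof (rule tendstoI)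
    fix e :: real assume "e > 0"
    then obtain \<delta> where \<delta>: "\<delta> > 0" "\<And>h. norm h < \<delta> \<Longrightarrow> \<bar>f (x0 + h) - f x0 - (\<chi> j. D j x0) \<bullet> h\<bar> \<le> real CARD('d) * (e / (2 * real CARD('d))) * norm h"
      using key[of "e / (2 * real CARD('d))"] by auto
    show "\<forall>\<^sub>F y in at x0. dist (norm (f y - f x0 - (\<chi> j. D j x0) \<bullet> (y - x0)) / norm (y - x0)) 0 < e"
      unfolding eventually_at
    proof (intro exI[of _ \<delta>] conjI ballI impI \<delta>(1))
      fix y assume y: "y \<noteq> x0 \<and> dist y x0 < \<delta>"
      then have "\<bar>f y - f x0 - (\<chi> j. D j x0) \<bullet> (y - x0)\<bar> \<le> (e/2) * norm (y - x0)"
        using \<delta>(2)[of "y - x0"] by (simp add: dist_norm)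
      also have "\<dots> < e * norm (y - x0)" using y \<open>e > 0\<close> by simp
      finally show "dist (norm (f y - f x0 - (\<chi> j. D j x0) \<bullet> (y - x0)) / norm (y - x0)) 0 < e"
        using y by (simp add: divide_less_eq)
    qed
  qed
qed (auto simp: bounded_linear_inner_right)

text \<open>\<open>test_fun\<close> speaks of partials along the axes only; total differentiability
  is what makes the chain rule available for products with chirps and for dilations.\<close>

lemma test_fun_imp_bump:
  fixes \<phi> :: "real^'d \<Rightarrow> real"
  assumes "test_fun \<phi>"
  shows "\<exists>D. C1_bump UNIV \<phi> D"
proof -
  have "\<forall>j. \<exists>D. continuous_on UNIV D \<and> (\<forall>x. ((\<lambda>t. \<phi> (x + t *\<^sub>R axis j 1)) has_real_derivative D x) (at 0))"
    using assms by (simp add: test_fun_def)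
  then obtain D where D: "\<And>j. continuous_on UNIV (D j)"
    "\<And>j x. ((\<lambda>t. \<phi> (x + t *\<^sub>R axis j 1)) has_real_derivative D j x) (at 0)" by metis
  have "bounded {x. \<phi> x \<noteq> 0}" using assms by (simp add: test_fun_def)
  then obtain R where R: "\<And>x. \<phi> x \<noteq> 0 \<Longrightarrow> norm x \<le> R" by (auto simp: bounded_iff)
  have "C1_bump UNIV \<phi> (\<lambda>x. \<chi> j. D j x)"
    unfolding C1_bump_def
  proof (intro conjI exI[of _ "cball 0 R"] has_cont_gradientI)
    show "(\<phi> has_derivative (\<lambda>h. (\<chi> j. D j x) \<bullet> h)) (at x)" for x
      by (rule has_derivative_of_continuous_partials[OF D])
    show "continuous_on UNIV (\<lambda>x. \<chi> j. D j x)" by (intro continuous_intros D)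
  qed (use R in auto)
  then show ?thesis by blast
qed

lemma bump_partial:
  fixes \<phi> :: "real^'d \<Rightarrow> real"
  assumes "C1_bump U \<phi> D"
  shows "((\<lambda>t. \<phi> (x + t *\<^sub>R axis j 1)) has_real_derivative D x $ j) (at 0)"
proof -
  have "(\<phi> has_derivative (\<lambda>h. D (x + 0 *\<^sub>R axis j 1) \<bullet> h)) (at (x + 0 *\<^sub>R axis j 1))"
    using assms unfolding C1_bump_def has_cont_gradient_def by blast
  moreover have "((\<lambda>t. x + t *\<^sub>R axis j 1) has_derivative (\<lambda>s. s *\<^sub>R axis j 1)) (at 0)"
    by (auto intro!: derivative_eq_intros)
  ultimately have "((\<lambda>t. \<phi> (x + t *\<^sub>R axis j 1)) has_derivative (\<lambda>s. D (x + 0 *\<^sub>R axis j 1) \<bullet> (s *\<^sub>R axis j 1))) (at 0)"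
    by (rule has_derivative_compose[rotated])
  moreover have "(\<lambda>s. D (x + 0 *\<^sub>R axis j 1) \<bullet> (s *\<^sub>R axis j 1)) = (*) (D x $ j)"
    by (auto simp: inner_axis fun_eq_iff)
  ultimately show ?thesis by (simp add: has_field_derivative_def)
qed

lemma pd_eq_bump:
  fixes \<phi> :: "real^'d \<Rightarrow> real"
  assumes "C1_bump U \<phi> D"
  shows "pd \<phi> j x = D x $ j"
  unfolding pd_def by (rule DERIV_imp_deriv[OF bump_partial[OF assms]])

lemma bump_imp_test_fun:
  fixes \<phi> :: "real^'d \<Rightarrow> real"
  assumes "C1_bump U \<phi> D"
  shows "test_fun \<phi>"
  unfolding test_fun_def
proof (intro conjI allI)
  obtain K where K: "compact K" "\<And>x. x \<notin> K \<Longrightarrow> \<phi> x = 0" using assms unfolding C1_bump_def by blast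
  show "bounded {x. \<phi> x \<noteq> 0}" by (rule bounded_subset[OF compact_imp_bounded[OF K(1)]]) (use K in blast)
  fix j
  have "continuous_on UNIV D" using assms by (simp add: C1_bump_def has_cont_gradient_def)
  then show "\<exists>D. continuous_on UNIV D \<and> (\<forall>x. ((\<lambda>t. \<phi> (x + t *\<^sub>R axis j 1)) has_real_derivative D x) (at 0))"
    by (intro exI[of _ "\<lambda>x. D x $ j"] conjI allI bump_partial[OF assms] continuous_intros)
qed

lemma bump_support:
  assumes "C1_bump U \<phi> D"
  obtains K where "compact K" "K \<subseteq> U" "\<And>x. x \<notin> K \<Longrightarrow> \<phi> x = 0" "\<And>x. x \<notin> K \<Longrightarrow> D x = 0"
proof -
  obtain K where K: "compact K" "K \<subseteq> U" "\<And>x. x \<notin> K \<Longrightarrow> \<phi> x = 0" using assms unfolding C1_bump_def by blast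
  have "D x = 0" if "x \<notin> K" for x
  proof -
    have "open (- K)" using K(1) by (simp add: compact_imp_closed open_Compl)
    have "(\<phi> has_derivative (\<lambda>h. D x \<bullet> h)) (at x)" using assms unfolding C1_bump_def has_cont_gradient_def by blast
    moreover have "(\<phi> has_derivative (\<lambda>h. 0)) (at x)"
      by (rule has_derivative_transform_within_open[of "\<lambda>_. 0" _ _ _ "- K"]) (use \<open>open (- K)\<close> K(3) that in auto)
    ultimately have "(\<lambda>h. D x \<bullet> h) = (\<lambda>h. 0)" by (rule has_derivative_unique)
    then show ?thesis by (metis inner_eq_zero_iff)
  qed
  with K that show ?thesis by blast
qed

lemma bump_mult_scalar:
  assumes "C1_bump U \<phi> D" "has_cont_gradient g G"
  shows "C1_bump U (\<lambda>x. g x * \<phi> x) (\<lambda>x. g x *\<^sub>R D x + \<phi> x *\<^sub>R G x)"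
  using assms has_cont_gradient_mult[OF assms(2), of \<phi> D] unfolding C1_bump_def by force

text \<open>The factor \<open>g\<close> may be singular outside \<open>U\<close>: the product
  vanishes off the compact support \<open>K\<close>, and \<open>U\<close> together with the
  complement of \<open>K\<close> covers the space, so the local statements glue.\<close>

lemma bump_mult_open:
  fixes \<phi> :: "'a::euclidean_space \<Rightarrow> real"
  assumes \<phi>: "C1_bump U \<phi> D" and U: "open U" and g: "\<And>x. x \<in> U \<Longrightarrow> (g has_derivative (\<lambda>h. G x \<bullet> h)) (at x)"
    and G: "continuous_on U G"
  shows "C1_bump U (\<lambda>x. g x * \<phi> x) (\<lambda>x. g x *\<^sub>R D x + \<phi> x *\<^sub>R G x)"
proof -
  obtain K where K: "compact K" "K \<subseteq> U" "\<And>x. x \<notin> K \<Longrightarrow> \<phi> x = 0" "\<And>x. x \<notin> K \<Longrightarrow> D x = 0" using bump_support[OF \<phi>] by metis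
  have grad: "has_cont_gradient \<phi> D" using \<phi> by (simp add: C1_bump_def)
  have oK: "open (- K)" using K(1) by (simp add: compact_imp_closed open_Compl)
  have gc: "continuous_on U g" by (rule continuous_at_imp_continuous_on) (use g has_derivative_continuous in blast)
  show ?thesis unfolding C1_bump_def
  proof (intro conjI has_cont_gradientI exI[of _ K])
    fix x
    show "((\<lambda>x. g x * \<phi> x) has_derivative (\<lambda>h. (g x *\<^sub>R D x + \<phi> x *\<^sub>R G x) \<bullet> h)) (at x)"
    proof (cases "x \<in> U")
      case True
      from has_derivative_mult[OF g[OF True] has_cont_gradient_derivative[OF grad, of x UNIV]]
      show ?thesis by (simp add: algebra_simps inner_add_left)
    next
      case False
      then have x: "x \<in> - K" using K(2) by auto
      have "((\<lambda>x. g x * \<phi> x) has_derivative (\<lambda>h. 0)) (at x)"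
        by (rule has_derivative_transform_within_open[of "\<lambda>_. 0" _ _ _ "- K"]) (use oK x K(3) in auto)
      then show ?thesis using K(3)[of x] K(4)[of x] x by simp
    qed
    have "continuous_on (U \<union> - K) (\<lambda>x. g x *\<^sub>R D x + \<phi> x *\<^sub>R G x)"
    proof (rule continuous_on_open_Un[OF U oK])
      show "continuous_on U (\<lambda>x. g x *\<^sub>R D x + \<phi> x *\<^sub>R G x)"
        by (intro continuous_intros gc G has_cont_gradient_continuous[OF grad])
      have "g x *\<^sub>R D x + \<phi> x *\<^sub>R G x = 0" if "x \<in> - K" for x using K(3)[of x] K(4)[of x] that by simp
      then show "continuous_on (- K) (\<lambda>x. g x *\<^sub>R D x + \<phi> x *\<^sub>R G x)"
        by (subst continuous_on_cong[OF refl, of _ _ "\<lambda>_. 0"]) auto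
    qed
    moreover have "U \<union> - K = UNIV" using K(2) by auto
    ultimately show "continuous_on UNIV (\<lambda>x. g x *\<^sub>R D x + \<phi> x *\<^sub>R G x)" by simp
  qed (use K in auto)
qed

lemma bump_mult_real:
  assumes "C1_bump {0<..} \<xi> \<xi>'" and g: "\<And>r::real. r > 0 \<Longrightarrow> (g has_real_derivative g' r) (at r)"
    and g': "continuous_on {0<..} g'"
  shows "C1_bump {0<..} (\<lambda>r. g r * \<xi> r) (\<lambda>r. g' r * \<xi> r + g r * \<xi>' r)"
proof -
  have "(g has_derivative (\<lambda>h. g' r \<bullet> h)) (at r)" if "r \<in> {0<..}" for r
    using g[of r] that by (simp add: has_field_derivative_def inner_real_def)
  from bump_mult_open[OF assms(1) _ this g'] show ?thesis by (simp add: algebra_simps)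
qed

text \<open>The norm fails to be differentiable only at 0, and the composite vanishes in a whole
  ball around that point.\<close>

lemma bump_norm:
  assumes "C1_bump {0<..} \<eta> \<eta>'"
  shows "C1_bump (- {0}) (\<lambda>x::'a::euclidean_space. \<eta> (norm x)) (\<lambda>x. \<eta>' (norm x) *\<^sub>R sgn x)"
proof -
  obtain a b where ab: "0 < a" "a < b" "\<And>r. (\<eta> has_real_derivative \<eta>' r) (at r)" "continuous_on UNIV \<eta>'"
    "\<And>r. r \<notin> {a..b} \<Longrightarrow> \<eta> r = 0" "\<And>r. r \<notin> {a..b} \<Longrightarrow> \<eta>' r = 0"
    using C1_bump_real[OF assms(1)] by metis
  show ?thesis unfolding C1_bump_def
  proof (intro conjI has_cont_gradientI exI[of _ "cball 0 b - ball 0 a"])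
    fix x :: 'a
    show "((\<lambda>x. \<eta> (norm x)) has_derivative (\<lambda>h. (\<eta>' (norm x) *\<^sub>R sgn x) \<bullet> h)) (at x)"
    proof (cases "x = 0")
      case True
      have "((\<lambda>x. \<eta> (norm x)) has_derivative (\<lambda>h. 0)) (at x)"
        by (rule has_derivative_transform_within_open[of "\<lambda>_. 0" _ _ _ "ball 0 a"]) (use True ab(1) ab(5) in auto)
      then show ?thesis using True by simp
    next
      case False
      have "(\<eta> has_derivative (\<lambda>h. \<eta>' (norm x) * h)) (at (norm x))"
        using ab(3)[of "norm x"] by (simp add: has_field_derivative_def)
      moreover have "(norm has_derivative (\<lambda>h. h \<bullet> sgn x)) (at x)"
        using has_derivative_norm[OF False] by (simp add: inner_commute)
      ultimately have "((\<lambda>x. \<eta> (norm x)) has_derivative (\<lambda>h. \<eta>' (norm x) * (h \<bullet> sgn x))) (at x)"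
        by (rule has_derivative_compose[rotated])
      then show ?thesis by (simp add: inner_commute)
    qed
    have "continuous_on (ball 0 a \<union> - {0}) (\<lambda>x::'a. \<eta>' (norm x) *\<^sub>R sgn x)"
    proof (rule continuous_on_open_Un)
      have "\<eta>' (norm x) *\<^sub>R sgn x = 0" if "x \<in> ball 0 a" for x :: 'a using ab(6)[of "norm x"] that by simp
      then show "continuous_on (ball 0 a) (\<lambda>x::'a. \<eta>' (norm x) *\<^sub>R sgn x)"
        by (subst continuous_on_cong[OF refl, of _ _ "\<lambda>_. 0"]) auto
      show "continuous_on (- {0}) (\<lambda>x::'a. \<eta>' (norm x) *\<^sub>R sgn x)"
        by (intro continuous_intros continuous_on_compose2[OF ab(4)]) auto
    qed auto
    moreover have "ball 0 a \<union> - {0} = (UNIV :: 'a set)" using ab(1) by auto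
    ultimately show "continuous_on UNIV (\<lambda>x::'a. \<eta>' (norm x) *\<^sub>R sgn x)" by simp
    show "compact (cball 0 b - ball (0::'a) a)" by (intro compact_diff) auto
    show "\<forall>x. x \<notin> cball 0 b - ball (0::'a) a \<longrightarrow> \<eta> (norm x) = 0" using ab(5) by auto
  qed (use ab(1) in auto)
qed

section \<open>Pairings of square-integrable functions with bumps\<close>

lemma L2_mult_integrable:
  fixes u :: "real^'d \<Rightarrow> complex"
  assumes "L2 u" "L2 v"
  shows "integrable lborel (\<lambda>x. u x * v x)"
proof (rule Bochner_Integration.integrable_bound)
  show "integrable lborel (\<lambda>x. (cmod (u x))^2 + (cmod (v x))^2)"
    using assms by (auto simp: L2_def)
  show "(\<lambda>x. u x * v x) \<in> borel_measurable lborel" using assms unfolding L2_def by (intro borel_measurable_times) auto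
  show "AE x in lborel. norm (u x * v x) \<le> norm ((cmod (u x))\<^sup>2 + (cmod (v x))\<^sup>2)"
  proof (intro AE_I2)
    fix x
    have "0 \<le> cmod (u x) * cmod (v x)" by simp
    then show "norm (u x * v x) \<le> norm ((cmod (u x))\<^sup>2 + (cmod (v x))\<^sup>2)"
      using sum_squares_bound[of "cmod (u x)" "cmod (v x)"] unfolding norm_mult real_norm_def by linarith
  qed
qed

lemma L2_continuous_compact:
  fixes h :: "real^'d \<Rightarrow> real"
  assumes "continuous_on UNIV h" "compact K" "\<And>x. x \<notin> K \<Longrightarrow> h x = 0"
  shows "L2 (\<lambda>x. of_real (h x))"
  unfolding L2_def
proof
  have h[measurable]: "h \<in> borel_measurable borel" by (rule borel_measurable_continuous_onI[OF assms(1)])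
  show "(\<lambda>x. complex_of_real (h x)) \<in> borel_measurable lborel" by measurable
  have "integrable lborel (\<lambda>x. indicator K x *\<^sub>R (h x)^2)"
    by (rule borel_integrable_compact[OF assms(2)]) (intro continuous_intros continuous_on_subset[OF assms(1)], simp)
  moreover have "(\<lambda>x. indicator K x *\<^sub>R (h x)^2) = (\<lambda>x. (h x)^2)" using assms(3) by (intro ext) (auto simp: indicator_def)
  ultimately show "integrable lborel (\<lambda>x. (cmod (complex_of_real (h x)))^2)" by simp
qed

lemma wpd_props:
  assumes "H1 u"
  shows "L2 (wpd u j)" "has_weak_partial u j (wpd u j)"
proof -
  have "\<exists>g. L2 g \<and> has_weak_partial u j g" using assms by (simp add: H1_def)
  then have "L2 (wpd u j) \<and> has_weak_partial u j (wpd u j)" unfolding wpd_def by (rule someI_ex)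
  then show "L2 (wpd u j)" "has_weak_partial u j (wpd u j)" by auto
qed

lemma weak_partial_bump:
  fixes u :: "real^'d \<Rightarrow> complex"
  assumes "has_weak_partial u j g" "C1_bump U \<phi> D"
  shows "(LINT x|lborel. u x * of_real (D x $ j)) = - (LINT x|lborel. g x * of_real (\<phi> x))"
  using assms(1) bump_imp_test_fun[OF assms(2)] pd_eq_bump[OF assms(2)]
  unfolding has_weak_partial_def by auto

lemma L2_bump:
  fixes \<phi> :: "real^'d \<Rightarrow> real"
  assumes "C1_bump U \<phi> D"
  shows "L2 (\<lambda>x. of_real (\<phi> x))" "L2 (\<lambda>x. of_real (D x $ j))"
proof -
  obtain K where K: "compact K" "\<And>x. x \<notin> K \<Longrightarrow> \<phi> x = 0" "\<And>x. x \<notin> K \<Longrightarrow> D x = 0" using bump_support[OF assms] by metis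
  have g: "has_cont_gradient \<phi> D" using assms by (simp add: C1_bump_def)
  show "L2 (\<lambda>x. of_real (\<phi> x))"
    by (rule L2_continuous_compact[OF has_cont_gradient_continuous(2)[OF g] K(1,2)])
  show "L2 (\<lambda>x. of_real (D x $ j))"
    by (rule L2_continuous_compact[OF _ K(1)]) (auto simp: K(3) intro!: continuous_intros has_cont_gradient_continuous(1)[OF g])
qed

section \<open>Regularity of the radial profile\<close>

lemma L2_bounded_compact:
  fixes h :: "real^'d \<Rightarrow> real"
  assumes [measurable]: "h \<in> borel_measurable borel" and "\<And>x. \<bar>h x\<bar> \<le> M" "\<And>x. R < norm x \<Longrightarrow> h x = 0"
  shows "L2 (\<lambda>x. of_real (h x))"
  unfolding L2_def
proof
  show "integrable lborel (\<lambda>x. (cmod (complex_of_real (h x)))^2)"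
  proof (rule Bochner_Integration.integrable_bound)
    show "integrable lborel (\<lambda>x::real^'d. M^2 * indicator (cball 0 R) x)"
      by (intro integrable_mult_right integrable_real_indicator) (use emeasure_bounded_finite[OF bounded_cball] in \<open>auto simp: less_top\<close>)
    show "AE x in lborel. norm ((cmod (complex_of_real (h x)))^2) \<le> norm (M^2 * indicator (cball 0 R) x)"
    proof (intro AE_I2)
      fix x
      have "\<bar>h x\<bar>^2 \<le> M^2" by (rule power_mono[OF assms(2)]) simp
      then show "norm ((cmod (complex_of_real (h x)))^2) \<le> norm (M^2 * indicator (cball 0 R) x)"
        using assms(3)[of x] by (auto simp: indicator_def)
    qed
  qed measurable
qed measurable

text \<open>On the shell the radial weight is at least its value at the inner radius a > 0, so
  integrability in space controls integrability in r.\<close>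

lemma set_integrable_of_shell:
  fixes f :: "real \<Rightarrow> complex"
  assumes [measurable]: "f \<in> borel_measurable borel" and a: "0 < a"
    and i: "integrable (lborel :: 'a::euclidean_space measure) (\<lambda>x. f (norm x) * of_real (indicator {a..b} (norm x)))"
  shows "set_integrable lborel {a..b} f"
proof -
  let ?w = "radial_weight TYPE('a)"
  let ?k = "sphere_area TYPE('a) * a ^ (DIM('a) - 1)"
  have k: "?k > 0" using a sphere_area_pos[where 'a='a] by simp
  have "integrable lborel (\<lambda>r. ?w r *\<^sub>R (f r * of_real (indicator {a..b} r)))"
    using i by (subst (asm) integrable_norm_iff[of "\<lambda>r. f r * of_real (indicator {a..b} r)"]) auto
  then have "integrable lborel (\<lambda>r. (1 / ?k) *\<^sub>R (?w r *\<^sub>R (f r * of_real (indicator {a..b} r))))"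
    by (rule integrable_scaleR_right)
  then show ?thesis unfolding set_integrable_def
  proof (rule Bochner_Integration.integrable_bound)
    show "AE r in lborel. norm (indicator {a..b} r *\<^sub>R f r) \<le> norm ((1 / ?k) *\<^sub>R (?w r *\<^sub>R (f r * of_real (indicator {a..b} r))))"
    proof (intro AE_I2)
      fix r
      show "norm (indicator {a..b} r *\<^sub>R f r) \<le> norm ((1 / ?k) *\<^sub>R (?w r *\<^sub>R (f r * of_real (indicator {a..b} r))))"
      proof (cases "r \<in> {a..b}")
        case True
        then have r: "r \<ge> a" "r > 0" using a by auto
        have "?k \<le> ?w r" unfolding radial_weight_def using r sphere_area_pos[where 'a='a] a
          by (simp add: power_mono)
        then have "1 \<le> ?w r / ?k" using k by simp
        then have "norm (f r) * 1 \<le> norm (f r) * (?w r / ?k)" by (intro mult_left_mono) auto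
        then show ?thesis using True k radial_weight_nonneg[of "TYPE('a)" r] by (simp add: norm_mult field_simps)
      qed simp
    qed
  qed measurable
qed

lemma primitive_cong_AE:
  assumes "f \<in> borel_measurable borel" "g \<in> borel_measurable borel" "AE s in lborel. 0 < s \<longrightarrow> f s = g s" "0 < r"
  shows "primitive f r = primitive g r"
  unfolding primitive_def
proof (rule interval_integral_cong_AE)
  show "AE x\<in>einterval (min 1 (ereal r)) (max 1 (ereal r)) in lborel. f x = g x"
    using assms(3)
  proof eventually_elim
    case (elim x)
    show ?case
    proof
      assume "x \<in> einterval (min 1 (ereal r)) (max 1 (ereal r))"
      then have "min 1 (ereal r) < ereal x" by (simp add: einterval_def)
      moreover have "0 < min 1 (ereal r)" using assms(4) by (simp add: min_def)
      ultimately have "(0::ereal) < ereal x" by (rule less_trans[rotated])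
      then show "f x = g x" using elim by simp
    qed
  qed
qed (use assms in auto)

lemma primitive_derivative:
  assumes "continuous_on {0<..} g" "0 < r"
  shows "(primitive g has_vector_derivative g r) (at r)"
proof -
  let ?a = "min 1 r / 2" and ?b = "max 1 r + 1"
  have "((\<lambda>u. LBINT y=(1::real)..u. g y) has_vector_derivative g r) (at r within {?a..?b})"
    by (rule interval_integral_FTC2) (use assms in \<open>auto intro!: continuous_on_subset[OF assms(1)] simp: min_def\<close>)
  moreover have "at r within {?a..?b} = at r"
    using assms(2) by (intro at_within_interior) (auto simp: min_def)
  ultimately show ?thesis unfolding primitive_def[abs_def] by (simp add: one_ereal_def)
qed

definition profile_rhs :: "real \<Rightarrow> real \<Rightarrow> real \<Rightarrow> (real \<Rightarrow> complex) \<Rightarrow> real \<Rightarrow> complex" where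
  "profile_rhs d c \<omega> q r = of_real (\<omega> - c / r^2 - cmod (q r) powr (4 / d)) * q r"

text \<open>The weak gradient is tested with the vector field x \<zeta>(|x|). Its divergence is r
  \<zeta>' + d \<zeta>, which for \<zeta> = \<xi> / r^d equals r^(1-d) \<xi>' and cancels the weight
  r^(d-1) of polar coordinates. So the weak derivative of \<open>q0\<close> is \<open>p1\<close>
  divided by r, with \<open>p1\<close> the radial average of x . grad Q.\<close>

lemma radial_profile_weak:
  fixes Q :: "real^'d \<Rightarrow> complex"
  assumes H: "H1 Q" and rad: "radial Q"
  obtains q0 p1 where "q0 \<in> borel_measurable borel" "p1 \<in> borel_measurable borel"
    "AE x in lborel. Q x = q0 (norm x)"
    "\<And>a b. 0 < a \<Longrightarrow> set_integrable lborel {a..b} q0"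
    "\<And>a b. 0 < a \<Longrightarrow> set_integrable lborel {a..b} p1"
    "\<And>\<eta>::real\<Rightarrow>real. \<eta> \<in> borel_measurable borel \<Longrightarrow> integrable lborel (\<lambda>x. (\<Sum>j\<in>UNIV. wpd Q j x * of_real (x $ j)) * of_real (\<eta> (norm x))) \<Longrightarrow>
      (LINT x|lborel. (\<Sum>j\<in>UNIV. wpd Q j x * of_real (x $ j)) * of_real (\<eta> (norm x))) = (LINT r|lborel. radial_weight TYPE(real^'d) r *\<^sub>R (p1 r * of_real (\<eta> r)))"
    "\<And>\<xi> \<xi>'. C1_bump {0<..} \<xi> \<xi>' \<Longrightarrow> (LINT r|lborel. q0 r * of_real (\<xi>' r)) = - (LINT r|lborel. (p1 r / of_real r) * of_real (\<xi> r))"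
proof -
  let ?w = "radial_weight TYPE(real^'d)" and ?d = "CARD('d)" and ?\<kappa> = "sphere_area TYPE(real^'d)"
  have \<kappa>: "?\<kappa> > 0" by (rule sphere_area_pos)
  have L2Q: "L2 Q" using H by (simp add: H1_def)
  have [measurable]: "Q \<in> borel_measurable borel" using L2Q by (simp add: L2_def)
  have L2w: "L2 (wpd Q j)" for j by (rule wpd_props[OF H])
  then have [measurable]: "wpd Q j \<in> borel_measurable borel" for j by (simp add: L2_def)
  \<comment> \<open>\<open>P\<close> is r times the radial derivative. The factor r may destroy
    square integrability, so integrability is claimed only after multiplication by a bounded weight
    that vanishes for large r.\<close>
  define P where "P x = (\<Sum>j\<in>UNIV. wpd Q j x * of_real (x $ j))" for x
  have [measurable]: "P \<in> borel_measurable borel" unfolding P_def by measurable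
  obtain q0 where q0[measurable]: "q0 \<in> borel_measurable borel" and Qq0: "AE x in lborel. Q x = q0 (norm x)"
    using rad radial_profile_measurable[of Q] unfolding radial_def by auto
  obtain p1 where p1[measurable]: "p1 \<in> borel_measurable borel"
    and p1a: "\<And>\<eta>::real\<Rightarrow>real. \<eta>\<in>borel_measurable borel \<Longrightarrow> integrable lborel (\<lambda>x. P x * of_real (\<eta> (norm x))) \<Longrightarrow>
     integrable (lborel :: (real^'d) measure) (\<lambda>x. p1 (norm x) * of_real (\<eta> (norm x))) \<and>
     (LINT x|(lborel :: (real^'d) measure). p1 (norm x) * of_real (\<eta> (norm x))) = (LINT x|lborel. P x * of_real (\<eta> (norm x)))"
    using radial_average[of P] by auto
  have Pint: "integrable lborel (\<lambda>x. P x * of_real (\<eta> (norm x)))"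
    if [measurable]: "\<eta> \<in> borel_measurable borel" and M: "\<And>r. \<bar>\<eta> r\<bar> \<le> M" and b: "\<And>r. b < r \<Longrightarrow> \<eta> r = 0" for \<eta> :: "real \<Rightarrow> real" and M b
  proof -
    have "integrable lborel (\<lambda>x. wpd Q j x * of_real (x $ j * \<eta> (norm x)))" for j
    proof (rule L2_mult_integrable[OF L2w L2_bounded_compact[where R=b and M="\<bar>b\<bar> * M"]])
      show "(\<lambda>x::real^'d. x $ j * \<eta> (norm x)) \<in> borel_measurable borel" by measurable
      show "x $ j * \<eta> (norm x) = 0" if "b < norm x" for x :: "real^'d" using b[OF that] by simp
      show "\<bar>x $ j * \<eta> (norm x)\<bar> \<le> \<bar>b\<bar> * M" for x :: "real^'d"
      proof (cases "b < norm x")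
        case True
        have "0 \<le> M" using M[of 0] by simp
        then show ?thesis using b[OF True] by simp
      next
        case False
        then have "\<bar>x $ j\<bar> \<le> \<bar>b\<bar>" using component_le_norm_cart[of x j] by linarith
        then show ?thesis unfolding abs_mult by (intro mult_mono M) auto
      qed
    qed
    then have "integrable lborel (\<lambda>x. \<Sum>j\<in>UNIV. wpd Q j x * of_real (x $ j * \<eta> (norm x)))" by (intro Bochner_Integration.integrable_sum)
    then show ?thesis by (simp add: P_def sum_distrib_right mult.assoc)
  qed
  have pq: "(LINT x|lborel. P x * of_real (\<eta> (norm x))) = (LINT r|lborel. ?w r *\<^sub>R (p1 r * of_real (\<eta> r)))"
    if [measurable]: "\<eta> \<in> borel_measurable borel" and "integrable lborel (\<lambda>x. P x * of_real (\<eta> (norm x)))" for \<eta> :: "real \<Rightarrow> real"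
    using p1a[OF that] integral_norm_eq[of "\<lambda>r. p1 r * of_real (\<eta> r)", where 'a="real^'d"] by simp
  show ?thesis
  proof (rule that[of q0 p1, OF q0 p1 Qq0])
    show "set_integrable lborel {a..b} q0" if "0 < a" for a b
    proof (rule set_integrable_of_shell[OF q0 that, where 'a="real^'d"])
      have "integrable lborel (\<lambda>x. Q x * of_real (indicator {a..b} (norm x)))"
        by (rule L2_mult_integrable[OF L2Q L2_bounded_compact[where M=1 and R=b]]) (auto simp: indicator_def)
      moreover have "AE x in lborel. Q x * of_real (indicator {a..b} (norm x)) = q0 (norm x) * of_real (indicator {a..b} (norm x))"
        using Qq0 by eventually_elim simp
      ultimately show "integrable (lborel :: (real^'d) measure) (\<lambda>x. q0 (norm x) * of_real (indicator {a..b} (norm x)))"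
        by (subst (asm) integrable_cong_AE) auto
    qed
    show "set_integrable lborel {a..b} p1" if "0 < a" for a b
    proof (rule set_integrable_of_shell[OF p1 that, where 'a="real^'d"])
      have "integrable lborel (\<lambda>x. P x * of_real (indicator {a..b} (norm x)))"
        by (rule Pint[where M=1 and b=b]) (auto simp: indicator_def)
      from p1a[OF _ this] show "integrable (lborel :: (real^'d) measure) (\<lambda>x. p1 (norm x) * of_real (indicator {a..b} (norm x)))" by auto
    qed
    show "(LINT x|lborel. (\<Sum>j\<in>UNIV. wpd Q j x * of_real (x $ j)) * of_real (\<eta> (norm x))) = (LINT r|lborel. ?w r *\<^sub>R (p1 r * of_real (\<eta> r)))"
      if "\<eta> \<in> borel_measurable borel" "integrable lborel (\<lambda>x. (\<Sum>j\<in>UNIV. wpd Q j x * of_real (x $ j)) * of_real (\<eta> (norm x)))" for \<eta> :: "real\<Rightarrow>real"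
      using pq[OF that(1)] that(2) unfolding P_def by simp
  next
    fix \<xi> \<xi>' :: "real \<Rightarrow> real" assume \<xi>: "C1_bump {0<..} \<xi> \<xi>'"
    obtain a b where ab: "0 < a" "a < b" "\<And>r. (\<xi> has_real_derivative \<xi>' r) (at r)" "continuous_on UNIV \<xi>'"
      "\<And>r. r \<notin> {a..b} \<Longrightarrow> \<xi> r = 0" "\<And>r. r \<notin> {a..b} \<Longrightarrow> \<xi>' r = 0"
      using C1_bump_real[OF \<xi>] by metis
    define \<zeta> where "\<zeta> r = (1 / r ^ ?d) * \<xi> r" for r
    define \<zeta>' where "\<zeta>' r = (- (real ?d) / r ^ (Suc ?d)) * \<xi> r + (1 / r ^ ?d) * \<xi>' r" for r
    have \<zeta>: "C1_bump {0<..} \<zeta> \<zeta>'" unfolding \<zeta>_def[abs_def] \<zeta>'_def[abs_def]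
    proof (rule bump_mult_real[OF \<xi>])
      show "((\<lambda>r. 1 / r ^ ?d) has_real_derivative - (real ?d) / r ^ (Suc ?d)) (at r)" if "r > 0" for r
      proof -
        have "?d \<noteq> 0" by simp
        then obtain m where m: "?d = Suc m" using not0_implies_Suc by blast
        have "m = 0 \<or> r * r ^ (m - Suc 0) = r ^ m" by (cases m) auto
        then show ?thesis unfolding m using that
          by (auto intro!: derivative_eq_intros simp: field_simps)
      qed
    qed (auto intro!: continuous_intros)
    note bz = bump_norm[OF \<zeta>, where 'a="real^'d"]
    define \<phi> where "\<phi> j x = x $ j * \<zeta> (norm x)" for j and x :: "real^'d"
    define D where "D j x = x $ j *\<^sub>R (\<zeta>' (norm x) *\<^sub>R sgn x) + \<zeta> (norm x) *\<^sub>R axis j 1" for j and x :: "real^'d"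
    have \<phi>: "C1_bump (- {0}) (\<phi> j) (D j)" for j
      using bump_mult_scalar[OF bz has_cont_gradient_affine[of 0 "axis j 1"]]
      unfolding \<phi>_def[abs_def] D_def[abs_def] by (simp add: inner_axis)
    have w: "(LINT x|lborel. Q x * of_real (D j x $ j)) = - (LINT x|lborel. wpd Q j x * of_real (\<phi> j x))" for j
      by (rule weak_partial_bump[OF wpd_props(2)[OF H] \<phi>])
    have "(\<Sum>j\<in>UNIV. LINT x|lborel. Q x * of_real (D j x $ j)) = (LINT x|lborel. (\<Sum>j\<in>UNIV. Q x * of_real (D j x $ j)))"
      by (rule Bochner_Integration.integral_sum[symmetric]) (rule L2_mult_integrable[OF L2Q L2_bump(2)[OF \<phi>]])
    also have "\<dots> = (LINT x|(lborel :: (real^'d) measure). q0 (norm x) * of_real (norm x * \<zeta>' (norm x) + real ?d * \<zeta> (norm x)))"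
    proof (rule integral_cong_AE)
      have "(\<Sum>j\<in>UNIV. D j x $ j) = norm x * \<zeta>' (norm x) + real ?d * \<zeta> (norm x)" for x
      proof -
        have "x \<bullet> sgn x = norm x"
          by (cases "x = 0") (simp_all add: sgn_div_norm power2_norm_eq_inner[symmetric] power2_eq_square)
        then have "(\<Sum>j\<in>UNIV. x $ j * sgn x $ j) = norm x" by (simp add: inner_vec_def)
        moreover have "(\<Sum>j\<in>UNIV. D j x $ j) = \<zeta>' (norm x) * (\<Sum>j\<in>UNIV. x $ j * sgn x $ j) + (\<Sum>j\<in>(UNIV::'d set). \<zeta> (norm x))"
          by (simp add: D_def sum.distrib sum_distrib_left mult_ac del: sum_constant)
        ultimately show ?thesis by simp
      qed
      then show "AE x in lborel. (\<Sum>j\<in>UNIV. Q x * of_real (D j x $ j)) = q0 (norm x) * of_real (norm x * \<zeta>' (norm x) + real ?d * \<zeta> (norm x))"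
        using Qq0 by (auto simp flip: sum_distrib_left of_real_sum)
      have [measurable]: "(\<lambda>x. D j x $ j) \<in> borel_measurable borel" for j
        using L2_bump(2)[OF \<phi>, of j j] unfolding L2_def by (simp add: borel_measurable_complex_iff)
      show "(\<lambda>x. \<Sum>j\<in>UNIV. Q x * of_real (D j x $ j)) \<in> borel_measurable lborel" by measurable
      have [measurable]: "\<zeta> \<in> borel_measurable borel" "\<zeta>' \<in> borel_measurable borel"
        using \<zeta> has_cont_gradient_measurable unfolding C1_bump_def by blast+
      show "(\<lambda>x::real^'d. q0 (norm x) * of_real (norm x * \<zeta>' (norm x) + real ?d * \<zeta> (norm x))) \<in> borel_measurable lborel" by measurable
    qed
    also have "\<dots> = (LINT r|lborel. ?w r *\<^sub>R (q0 r * of_real (r * \<zeta>' r + real ?d * \<zeta> r)))"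
    proof -
      have [measurable]: "\<zeta> \<in> borel_measurable borel" "\<zeta>' \<in> borel_measurable borel"
        using \<zeta> has_cont_gradient_measurable unfolding C1_bump_def by blast+
      show ?thesis by (rule integral_norm_eq) measurable
    qed
    also have "\<dots> = (LINT r|lborel. of_real ?\<kappa> * (q0 r * of_real (\<xi>' r)))"
    proof (rule Bochner_Integration.integral_cong[OF refl])
      fix r :: real
      have "?w r * (r * \<zeta>' r + real ?d * \<zeta> r) = ?\<kappa> * \<xi>' r"
      proof (cases "r > 0")
        case True
        have "?d \<noteq> 0" by simp
        then obtain m where m: "?d = Suc m" using not0_implies_Suc by blast
        show ?thesis using True unfolding radial_weight_def \<zeta>'_def \<zeta>_def by (simp add: m field_simps)
      next
        case False
        then show ?thesis using ab(1) ab(6)[of r] by (simp add: radial_weight_def)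
      qed
      then have "complex_of_real (?w r) * of_real (r * \<zeta>' r + real ?d * \<zeta> r) = of_real ?\<kappa> * of_real (\<xi>' r)"
        by (simp only: of_real_mult[symmetric])
      then show "?w r *\<^sub>R (q0 r * of_real (r * \<zeta>' r + real ?d * \<zeta> r)) = of_real ?\<kappa> * (q0 r * of_real (\<xi>' r))"
        unfolding scaleR_conv_of_real by (metis mult.assoc mult.commute)
    qed
    also have "\<dots> = of_real ?\<kappa> * (LINT r|lborel. q0 r * of_real (\<xi>' r))" by (rule integral_mult_right_zero)
    finally have L: "(\<Sum>j\<in>UNIV. LINT x|lborel. Q x * of_real (D j x $ j)) = of_real ?\<kappa> * (LINT r|lborel. q0 r * of_real (\<xi>' r))" .
    have "(\<Sum>j\<in>UNIV. LINT x|lborel. wpd Q j x * of_real (\<phi> j x)) = (LINT x|lborel. (\<Sum>j\<in>UNIV. wpd Q j x * of_real (\<phi> j x)))"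
      by (rule Bochner_Integration.integral_sum[symmetric]) (rule L2_mult_integrable[OF L2w L2_bump(1)[OF \<phi>]])
    also have "\<dots> = (LINT x|lborel. P x * of_real (\<zeta> (norm x)))"
      by (simp add: P_def \<phi>_def sum_distrib_right mult.assoc)
    also have "\<dots> = (LINT r|lborel. ?w r *\<^sub>R (p1 r * of_real (\<zeta> r)))"
    proof (rule pq)
      show "\<zeta> \<in> borel_measurable borel" using \<zeta> has_cont_gradient_measurable unfolding C1_bump_def by blast
      have "integrable lborel (\<lambda>x. \<Sum>j\<in>UNIV. wpd Q j x * of_real (\<phi> j x))"
        by (rule Bochner_Integration.integrable_sum) (rule L2_mult_integrable[OF L2w L2_bump(1)[OF \<phi>]])
      then show "integrable lborel (\<lambda>x. P x * of_real (\<zeta> (norm x)))"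
        by (simp add: P_def \<phi>_def sum_distrib_right mult.assoc)
    qed
    also have "\<dots> = (LINT r|lborel. of_real ?\<kappa> * ((p1 r / of_real r) * of_real (\<xi> r)))"
    proof (rule Bochner_Integration.integral_cong[OF refl])
      fix r :: real
      have "?w r * \<zeta> r = ?\<kappa> * \<xi> r / r"
      proof (cases "r > 0")
        case True
        have "?d \<noteq> 0" by simp
        then obtain m where m: "?d = Suc m" using not0_implies_Suc by blast
        show ?thesis using True unfolding radial_weight_def \<zeta>_def by (simp add: m field_simps)
      next
        case False
        then show ?thesis using ab(1) ab(5)[of r] by (simp add: radial_weight_def)
      qed
      then have "complex_of_real (?w r) * of_real (\<zeta> r) = of_real ?\<kappa> * of_real (\<xi> r) / of_real r"
        by (simp only: of_real_mult[symmetric] of_real_divide[symmetric])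
      then have "p1 r * (complex_of_real (?w r) * of_real (\<zeta> r)) = p1 r * (of_real ?\<kappa> * of_real (\<xi> r) / of_real r)" by simp
      then show "?w r *\<^sub>R (p1 r * of_real (\<zeta> r)) = of_real ?\<kappa> * ((p1 r / of_real r) * of_real (\<xi> r))"
        unfolding scaleR_conv_of_real by (simp add: mult_ac)
    qed
    also have "\<dots> = of_real ?\<kappa> * (LINT r|lborel. (p1 r / of_real r) * of_real (\<xi> r))" by (rule integral_mult_right_zero)
    finally have "of_real ?\<kappa> * (LINT r|lborel. q0 r * of_real (\<xi>' r)) = - (of_real ?\<kappa> * (LINT r|lborel. (p1 r / of_real r) * of_real (\<xi> r)))"
      unfolding L[symmetric] w by (simp add: sum_negf)
    then have "of_real ?\<kappa> * (LINT r|lborel. q0 r * of_real (\<xi>' r)) = of_real ?\<kappa> * (- (LINT r|lborel. (p1 r / of_real r) * of_real (\<xi> r)))" by simp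
    then show "(LINT r|lborel. q0 r * of_real (\<xi>' r)) = - (LINT r|lborel. (p1 r / of_real r) * of_real (\<xi> r))"
      using \<kappa> by (subst (asm) mult_cancel_left) auto
  qed
qed

text \<open>The du Bois-Reymond lemma is applied first to \<open>q0\<close>, which yields a
  continuous \<open>q\<close>, and then to the flux r^(d-1) q', whose weak derivative is by now a
  continuous function of r. The second application upgrades both to classical derivatives.\<close>

theorem radial_profile_regular:
  fixes Q :: "real^'d \<Rightarrow> complex"
  assumes H: "H1 Q" and rad: "radial Q" and ge: "ground_eq c \<omega> Q"
  obtains q p where "q \<in> borel_measurable borel" "p \<in> borel_measurable borel" "continuous_on {0<..} p" "AE x in lborel. Q x = q (norm x)"
    "\<And>r. 0 < r \<Longrightarrow> (q has_vector_derivative p r) (at r)"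
    "\<And>r. 0 < r \<Longrightarrow> ((\<lambda>r. r ^ (CARD('d) - 1) *\<^sub>R p r) has_vector_derivative
        r ^ (CARD('d) - 1) *\<^sub>R profile_rhs (real CARD('d)) c \<omega> q r) (at r)"
proof -
  let ?w = "radial_weight TYPE(real^'d)" and ?d = "CARD('d)" and ?\<kappa> = "sphere_area TYPE(real^'d)"
  let ?n = "CARD('d) - 1"
  have \<kappa>: "?\<kappa> > 0" by (rule sphere_area_pos)
  have L2Q: "L2 Q" using H by (simp add: H1_def)
  have [measurable]: "Q \<in> borel_measurable borel" using L2Q by (simp add: L2_def)
  have L2w: "L2 (wpd Q j)" for j by (rule wpd_props[OF H])
  obtain q0 p1 where q0: "q0 \<in> borel_measurable borel" and p1[measurable]: "p1 \<in> borel_measurable borel"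
    and Qq0: "AE x in lborel. Q x = q0 (norm x)"
    and iq0: "\<And>a b. 0 < a \<Longrightarrow> set_integrable lborel {a..b} q0"
    and ip1: "\<And>a b. 0 < a \<Longrightarrow> set_integrable lborel {a..b} p1"
    and P: "\<And>\<eta>::real\<Rightarrow>real. \<eta> \<in> borel_measurable borel \<Longrightarrow> integrable lborel (\<lambda>x. (\<Sum>j\<in>UNIV. wpd Q j x * of_real (x $ j)) * of_real (\<eta> (norm x))) \<Longrightarrow>
      (LINT x|lborel. (\<Sum>j\<in>UNIV. wpd Q j x * of_real (x $ j)) * of_real (\<eta> (norm x))) = (LINT r|lborel. ?w r *\<^sub>R (p1 r * of_real (\<eta> r)))"
    and weak1: "\<And>\<xi> \<xi>'. C1_bump {0<..} \<xi> \<xi>' \<Longrightarrow> (LINT r|lborel. q0 r * of_real (\<xi>' r)) = - (LINT r|lborel. (p1 r / of_real r) * of_real (\<xi> r))"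
    using radial_profile_weak[OF H rad] by blast
  define p0 where "p0 r = p1 r / of_real r" for r
  have p0[measurable]: "p0 \<in> borel_measurable borel" unfolding p0_def by measurable
  have mult_loc: "set_integrable lborel {a..b} (\<lambda>r. of_real (g r) * f r)"
    if "0 < a" "\<And>a b. 0 < a \<Longrightarrow> set_integrable lborel {a..b} f" "continuous_on {0<..} g" for a b :: real and f :: "real \<Rightarrow> complex" and g :: "real \<Rightarrow> real"
  proof -
    have c: "continuous_on {a..b} g" using that(1) by (intro continuous_on_subset[OF that(3)]) auto
    then have "compact (g ` {a..b})" by (intro compact_continuous_image) auto
    then obtain M where M: "\<And>r. r \<in> {a..b} \<Longrightarrow> \<bar>g r\<bar> \<le> M"
      using compact_imp_bounded[THEN bounded_iff[THEN iffD1]] by fastforce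
    have gm: "(\<lambda>r. indicator {a..b} r *\<^sub>R g r) \<in> borel_measurable borel"
      by (rule borel_measurable_continuous_on_indicator[OF _ c]) simp
    have I: "integrable lborel (\<lambda>r. indicator {a..b} r *\<^sub>R f r)" using that(2)[OF that(1)] by (simp add: set_integrable_def)
    have e: "(\<lambda>r. indicator {a..b} r *\<^sub>R (of_real (g r) * f r)) = (\<lambda>r. of_real (indicator {a..b} r *\<^sub>R g r) * (indicator {a..b} r *\<^sub>R f r))"
      by (auto simp: indicator_def fun_eq_iff)
    show ?thesis unfolding set_integrable_def e
    proof (rule Bochner_Integration.integrable_bound)
      show "integrable lborel (\<lambda>r. M * norm (indicator {a..b} r *\<^sub>R f r))"
        by (rule integrable_mult_right[OF integrable_norm[OF I]])
      show "(\<lambda>r. of_real (indicator {a..b} r *\<^sub>R g r) * (indicator {a..b} r *\<^sub>R f r)) \<in> borel_measurable lborel"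
      proof -
        note [measurable] = gm
        have [measurable]: "(\<lambda>r. indicator {a..b} r *\<^sub>R f r) \<in> borel_measurable borel"
          using borel_measurable_integrable[OF I] by simp
        show ?thesis by measurable
      qed
      show "AE r in lborel. norm (of_real (indicator {a..b} r *\<^sub>R g r) * (indicator {a..b} r *\<^sub>R f r)) \<le> norm (M * norm (indicator {a..b} r *\<^sub>R f r))"
      proof (intro AE_I2)
        fix r show "norm (of_real (indicator {a..b} r *\<^sub>R g r) * (indicator {a..b} r *\<^sub>R f r)) \<le> norm (M * norm (indicator {a..b} r *\<^sub>R f r))"
          using M[of r] by (cases "r \<in> {a..b}") (auto simp: norm_mult intro!: mult_right_mono)
      qed
    qed
  qed
  have ip0: "set_integrable lborel {a..b} p0" if "0 < a" for a b
  proof -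
    have "set_integrable lborel {a..b} (\<lambda>r. of_real (1 / r) * p1 r)"
      by (rule mult_loc[OF that ip1]) (auto intro!: continuous_intros)
    then show ?thesis by (simp add: p0_def[abs_def])
  qed
  obtain k where k: "AE r in lborel. 0 < r \<longrightarrow> q0 r = k + primitive p0 r"
    using AE_eq_primitive[OF iq0 ip0] weak1 unfolding p0_def[symmetric] by blast
  \<comment> \<open>The value 0 for r <= 0 is a default that makes \<open>q\<close> Borel on the
    whole line; continuity is claimed only on the half line.\<close>
  define q where "q r = (if r \<in> {0<..} then k + primitive p0 r else 0)" for r
  have qc: "continuous_on {0<..} q"
    by (subst continuous_on_cong[OF refl, of _ _ "\<lambda>r. k + primitive p0 r"])
       (auto simp: q_def intro!: continuous_intros primitive_continuous[OF ip0])
  have qm[measurable]: "q \<in> borel_measurable borel" unfolding q_def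
    by (rule borel_measurable_continuous_on_if) (auto intro!: continuous_intros primitive_continuous[OF ip0])
  have Qq: "AE x in lborel. Q x = q (norm x)"
  proof -
    have "AE r in lborel. 0 < r \<longrightarrow> q0 r = q r" using k by eventually_elim (simp add: q_def)
    then have "AE x in (lborel :: (real^'d) measure). q0 (norm x) = q (norm x)" by (rule AE_normI)
    with Qq0 show ?thesis by eventually_elim simp
  qed
  define W where "W = profile_rhs (real ?d) c \<omega> q"
  have Wm[measurable]: "W \<in> borel_measurable borel" unfolding W_def profile_rhs_def by measurable
  have Wc: "continuous_on {0<..} W" unfolding W_def profile_rhs_def
    by (intro continuous_intros qc continuous_on_powr') auto
  define f where "f r = of_real (r ^ ?n) * p0 r" for r
  define g where "g r = of_real (r ^ ?n) * W r" for r
  have fi: "set_integrable lborel {a..b} f" if "0 < a" for a b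
    unfolding f_def by (rule mult_loc[OF that ip0]) (auto intro!: continuous_intros)
  have gc: "continuous_on {0<..} g" unfolding g_def by (intro continuous_intros Wc)
  have gi: "set_integrable lborel {a..b} g" if "0 < a" for a b
    using that by (intro borel_integrable_atLeastAtMost' continuous_on_subset[OF gc]) auto
  have [measurable]: "g \<in> borel_measurable borel" unfolding g_def by measurable
  \<comment> \<open>The equation is tested with \<eta>(|x|), which vanishes near the origin and so
    never meets the singularity of the potential.\<close>
  have weak2: "(LINT r|lborel. f r * of_real (\<eta>' r)) = - (LINT r|lborel. g r * of_real (\<eta> r))" if \<eta>: "C1_bump {0<..} \<eta> \<eta>'" for \<eta> \<eta>' :: "real \<Rightarrow> real"
  proof -
    obtain a b where ab: "0 < a" "a < b" "\<And>r. (\<eta> has_real_derivative \<eta>' r) (at r)" "continuous_on UNIV \<eta>'"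
      "\<And>r. r \<notin> {a..b} \<Longrightarrow> \<eta> r = 0" "\<And>r. r \<notin> {a..b} \<Longrightarrow> \<eta>' r = 0"
      using C1_bump_real[OF \<eta>] by metis
    have [measurable]: "\<eta> \<in> borel_measurable borel" "\<eta>' \<in> borel_measurable borel"
      using \<eta> has_cont_gradient_measurable unfolding C1_bump_def by blast+
    have \<eta>c: "continuous_on UNIV \<eta>" using \<eta> has_cont_gradient_continuous unfolding C1_bump_def by blast
    let ?\<phi> = "\<lambda>x::real^'d. \<eta> (norm x)"
    note b = bump_norm[OF \<eta>, where 'a="real^'d"]
    have tf: "test_fun ?\<phi>" by (rule bump_imp_test_fun[OF b])
    have pd: "pd ?\<phi> j x = \<eta>' (norm x) * sgn x $ j" for j x using pd_eq_bump[OF b] by simp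
    have wn: "?w r = ?\<kappa> * r ^ ?n" if "r > 0" for r using that by (simp add: radial_weight_def)
    have red: "(LINT x|(lborel :: (real^'d) measure). h (norm x) * of_real (\<eta> (norm x))) = of_real ?\<kappa> * (LINT r|lborel. of_real (r ^ ?n) * h r * of_real (\<eta> r))"
      if [measurable]: "h \<in> borel_measurable borel" for h :: "real \<Rightarrow> complex"
    proof -
      have "(LINT x|(lborel :: (real^'d) measure). h (norm x) * of_real (\<eta> (norm x))) = (LINT r|lborel. ?w r *\<^sub>R (h r * of_real (\<eta> r)))"
        by (rule integral_norm_eq) measurable
      also have "\<dots> = (LINT r|lborel. of_real ?\<kappa> * (of_real (r ^ ?n) * h r * of_real (\<eta> r)))"
      proof (rule Bochner_Integration.integral_cong[OF refl])
        fix r show "?w r *\<^sub>R (h r * of_real (\<eta> r)) = of_real ?\<kappa> * (of_real (r ^ ?n) * h r * of_real (\<eta> r))"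
          using wn[of r] ab(5)[of r] ab(1) by (cases "r > 0") (auto simp: scaleR_conv_of_real mult_ac)
      qed
      finally show ?thesis by simp
    qed
    \<comment> \<open>The gradient of \<eta>(|x|) is (\<eta>'/r) x, so only the combination x . grad
      Q occurs, paired with a radial weight.\<close>
    have S: "(\<Sum>j\<in>UNIV. wpd Q j x * of_real (pd ?\<phi> j x)) = (\<Sum>j\<in>UNIV. wpd Q j x * of_real (x $ j)) * of_real ((\<lambda>r. \<eta>' r / r) (norm x))" for x
    proof -
      have "wpd Q j x * of_real (pd ?\<phi> j x) = wpd Q j x * of_real (x $ j) * of_real ((\<lambda>r. \<eta>' r / r) (norm x))" for j
        by (simp add: pd sgn_div_norm divide_inverse mult_ac)
      then show ?thesis by (simp only: sum_distrib_right)
    qed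
    have "(\<Sum>j\<in>UNIV. LINT x|lborel. wpd Q j x * of_real (pd ?\<phi> j x)) = (LINT x|lborel. (\<Sum>j\<in>UNIV. wpd Q j x * of_real (pd ?\<phi> j x)))"
      using L2_mult_integrable[OF L2w L2_bump(2)[OF b]] by (intro Bochner_Integration.integral_sum[symmetric]) (simp add: pd)
    also have "\<dots> = (LINT x|lborel. (\<Sum>j\<in>UNIV. wpd Q j x * of_real (x $ j)) * of_real ((\<lambda>r. \<eta>' r / r) (norm x)))"
      by (simp only: S)
    also have "\<dots> = (LINT r|lborel. ?w r *\<^sub>R (p1 r * of_real ((\<lambda>r. \<eta>' r / r) r)))"
    proof (rule P)
      have "integrable lborel (\<lambda>x. \<Sum>j\<in>UNIV. wpd Q j x * of_real (pd ?\<phi> j x))"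
        using L2_mult_integrable[OF L2w L2_bump(2)[OF b]] by (intro Bochner_Integration.integrable_sum) (simp add: pd)
      then show "integrable lborel (\<lambda>x. (\<Sum>j\<in>UNIV. wpd Q j x * of_real (x $ j)) * of_real ((\<lambda>r. \<eta>' r / r) (norm x)))"
        by (simp only: S)
    qed measurable
    also have "\<dots> = (LINT r|lborel. of_real ?\<kappa> * (f r * of_real (\<eta>' r)))"
    proof (rule Bochner_Integration.integral_cong[OF refl])
      fix r show "?w r *\<^sub>R (p1 r * of_real ((\<lambda>r. \<eta>' r / r) r)) = of_real ?\<kappa> * (f r * of_real (\<eta>' r))"
        using wn[of r] ab(6)[of r] ab(1) by (cases "r > 0") (auto simp: scaleR_conv_of_real mult_ac f_def p0_def)
    qed
    finally have grad: "(\<Sum>j\<in>UNIV. LINT x|lborel. wpd Q j x * of_real (pd ?\<phi> j x)) = of_real ?\<kappa> * (LINT r|lborel. f r * of_real (\<eta>' r))"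
      by simp
    let ?h1 = "\<lambda>r. of_real (1 / r^2) * q r" and ?h3 = "\<lambda>r. nonlin TYPE('d) (q r)"
    have [measurable]: "?h3 \<in> borel_measurable borel" unfolding nonlin_def by measurable
    have e1: "(LINT x|lborel. of_real (1 / (norm x)^2) * Q x * of_real (?\<phi> x)) = (LINT x|(lborel :: (real^'d) measure). ?h1 (norm x) * of_real (\<eta> (norm x)))"
      using Qq by (intro integral_cong_AE) auto
    have e2: "(LINT x|lborel. Q x * of_real (?\<phi> x)) = (LINT x|(lborel :: (real^'d) measure). q (norm x) * of_real (\<eta> (norm x)))"
      using Qq by (intro integral_cong_AE) auto
    have e3: "(LINT x|lborel. nonlin TYPE('d) (Q x) * of_real (?\<phi> x)) = (LINT x|(lborel :: (real^'d) measure). ?h3 (norm x) * of_real (\<eta> (norm x)))"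
    proof (rule integral_cong_AE)
      show "(\<lambda>x. nonlin TYPE('d) (Q x) * of_real (?\<phi> x)) \<in> borel_measurable lborel" unfolding nonlin_def by measurable
      show "(\<lambda>x::real^'d. ?h3 (norm x) * of_real (\<eta> (norm x))) \<in> borel_measurable lborel" by measurable
      show "AE x in lborel. nonlin TYPE('d) (Q x) * of_real (?\<phi> x) = ?h3 (norm x) * of_real (\<eta> (norm x))"
        using Qq by eventually_elim simp
    qed
    have "op_pair c Q ?\<phi> + of_real \<omega> * (LINT x|lborel. Q x * of_real (?\<phi> x)) = (LINT x|lborel. nonlin TYPE('d) (Q x) * of_real (?\<phi> x))"
      using ge tf unfolding ground_eq_def by blast
    then have main: "of_real ?\<kappa> * (LINT r|lborel. f r * of_real (\<eta>' r)) - of_real c * (of_real ?\<kappa> * (LINT r|lborel. of_real (r ^ ?n) * ?h1 r * of_real (\<eta> r)))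
        + of_real \<omega> * (of_real ?\<kappa> * (LINT r|lborel. of_real (r ^ ?n) * q r * of_real (\<eta> r))) = of_real ?\<kappa> * (LINT r|lborel. of_real (r ^ ?n) * ?h3 r * of_real (\<eta> r))"
    proof -
      have "?h1 \<in> borel_measurable borel" by measurable
      note r1 = trans[OF e1 red[OF this]] and r2 = trans[OF e2 red[OF qm]]
      have "?h3 \<in> borel_measurable borel" by measurable
      note r3 = trans[OF e3 red[OF this]]
      assume "op_pair c Q ?\<phi> + of_real \<omega> * (LINT x|lborel. Q x * of_real (?\<phi> x)) = (LINT x|lborel. nonlin TYPE('d) (Q x) * of_real (?\<phi> x))"
      then show ?thesis unfolding op_pair_def grad r1 r2 r3 .
    qed
    have ci: "integrable lborel (\<lambda>r. of_real (r ^ ?n) * h r * of_real (\<eta> r))" if "continuous_on {0<..} h" for h :: "real \<Rightarrow> complex"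
    proof (rule integrable_loc_mult_bump[OF _ \<eta>c ab(5) ab(1)])
      show "set_integrable lborel {a..b} (\<lambda>r. of_real (r ^ ?n) * h r)" if "0 < a" for a b
      proof (rule borel_integrable_atLeastAtMost')
        have "continuous_on {0<..} (\<lambda>r. of_real (r ^ ?n) * h r)"
          by (intro continuous_intros \<open>continuous_on {0<..} h\<close>)
        then show "continuous_on {a..b} (\<lambda>r. of_real (r ^ ?n) * h r)"
          by (rule continuous_on_subset) (use that in auto)
      qed
    qed
    have c1: "continuous_on {0<..} ?h1" by (intro continuous_intros qc) auto
    have c3: "continuous_on {0<..} ?h3" unfolding nonlin_def by (intro continuous_intros qc continuous_on_powr') auto
    have "g r * of_real (\<eta> r) = of_real \<omega> * (of_real (r ^ ?n) * q r * of_real (\<eta> r)) - of_real c * (of_real (r ^ ?n) * ?h1 r * of_real (\<eta> r)) - of_real (r ^ ?n) * ?h3 r * of_real (\<eta> r)" for r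
      by (simp add: g_def W_def profile_rhs_def nonlin_def algebra_simps)
    then have "(LINT r|lborel. g r * of_real (\<eta> r)) = of_real \<omega> * (LINT r|lborel. of_real (r ^ ?n) * q r * of_real (\<eta> r))
        - of_real c * (LINT r|lborel. of_real (r ^ ?n) * ?h1 r * of_real (\<eta> r)) - (LINT r|lborel. of_real (r ^ ?n) * ?h3 r * of_real (\<eta> r))"
      using ci[OF c1] ci[OF c3] ci[OF qc]
      by (simp only: Bochner_Integration.integral_diff integrable_mult_right Bochner_Integration.integrable_diff integral_mult_right_zero)
    then have "of_real ?\<kappa> * (LINT r|lborel. f r * of_real (\<eta>' r)) = of_real ?\<kappa> * (- (LINT r|lborel. g r * of_real (\<eta> r)))"
    proof -
      have alg: "K * I0 = K * (- G)" if "G = w * I2 - c * I1 - I3" "K * I0 - c * (K * I1) + w * (K * I2) = K * I3"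
        for K I0 I1 I2 I3 w c G :: complex
        using that by algebra
      assume "(LINT r|lborel. g r * of_real (\<eta> r)) = of_real \<omega> * (LINT r|lborel. of_real (r ^ ?n) * q r * of_real (\<eta> r))
        - of_real c * (LINT r|lborel. of_real (r ^ ?n) * ?h1 r * of_real (\<eta> r)) - (LINT r|lborel. of_real (r ^ ?n) * ?h3 r * of_real (\<eta> r))"
      from alg[OF this main] show ?thesis .
    qed
    then show ?thesis using \<kappa> by (subst (asm) mult_cancel_left) auto
  qed
  obtain k2 where k2: "AE r in lborel. 0 < r \<longrightarrow> f r = k2 + primitive g r"
    using AE_eq_primitive[OF fi gi weak2] by blast
  define m where "m r = k2 + primitive g r" for r
  have mc: "continuous_on {0<..} m" unfolding m_def by (intro continuous_intros primitive_continuous[OF gi])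
  define p where "p r = (if r \<in> {0<..} then (1 / r ^ ?n) *\<^sub>R m r else 0)" for r
  have pc: "continuous_on {0<..} p"
    by (subst continuous_on_cong[OF refl, of _ _ "\<lambda>r. (1 / r ^ ?n) *\<^sub>R m r"])
       (auto simp: p_def intro!: continuous_intros mc)
  have pm: "p \<in> borel_measurable borel" unfolding p_def
    by (rule borel_measurable_continuous_on_if) (auto intro!: continuous_intros mc)
  \<comment> \<open>\<open>p0\<close> and the continuous \<open>p\<close> agree a.e. and therefore
    have the same primitive, which makes \<open>q\<close> continuously differentiable.\<close>
  have pp: "AE r in lborel. 0 < r \<longrightarrow> p0 r = p r"
    using k2 by eventually_elim (auto simp: p_def m_def f_def[abs_def] scaleR_conv_of_real field_simps)
  have qd: "(q has_vector_derivative p r) (at r)" if "0 < r" for r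
  proof -
    have "((\<lambda>r. k + primitive p r) has_vector_derivative p r) (at r)"
      using primitive_derivative[OF pc that] by (auto intro!: derivative_eq_intros)
    then show ?thesis
      by (rule has_vector_derivative_transform_within_open[of _ _ _ "{0<..}"])
         (use that primitive_cong_AE[OF p0 pm pp] in \<open>auto simp: q_def\<close>)
  qed
  have pd: "((\<lambda>r. r ^ ?n *\<^sub>R p r) has_vector_derivative r ^ ?n *\<^sub>R W r) (at r)" if "0 < r" for r
  proof -
    have "(m has_vector_derivative g r) (at r)"
      unfolding m_def using primitive_derivative[OF gc that] by (auto intro!: derivative_eq_intros)
    then have "((\<lambda>r. r ^ ?n *\<^sub>R p r) has_vector_derivative g r) (at r)"
      by (rule has_vector_derivative_transform_within_open[of _ _ _ "{0<..}"]) (use that in \<open>auto simp: p_def\<close>)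
    then show ?thesis by (simp add: g_def scaleR_conv_of_real)
  qed
  show ?thesis using that[OF qm pm pc Qq qd] pd unfolding W_def by blast
qed

section \<open>Decay and singularity of the profile\<close>

lemma integral_le_set_integral:
  fixes f :: "real \<Rightarrow> real"
  assumes f: "set_integrable lborel {0<..} f" and c: "continuous_on {0<..} f" and nn: "\<And>r. 0 < r \<Longrightarrow> 0 \<le> f r" and "0 < a"
  shows "integral {a..b} f \<le> (LINT r:{0<..}|lborel. f r)"
proof -
  have i: "set_integrable lborel {a..b} f" by (rule set_integrable_subset[OF f]) (use assms in auto)
  have "integral {a..b} f = (LINT r:{a..b}|lborel. f r)" using set_borel_integral_eq_integral(2)[OF i] by simp
  also have "\<dots> \<le> (LINT r:{0<..}|lborel. f r)"
    unfolding set_lebesgue_integral_def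
    by (rule integral_mono) (use i f nn \<open>0 < a\<close> in \<open>auto simp: set_integrable_def indicator_def\<close>)
  finally show ?thesis .
qed

text \<open>This is Cauchy-Schwarz for the integral of |p| over [s,1] with weight r^n, written
  pointwise through the arithmetic-geometric mean. The scale m = s^((n-1)/2) balances the energy,
  which contributes I/(2m), against the integral of r^-n, which is at most 1/m^2.\<close>

lemma profile_bound_origin:
  fixes q p :: "real \<Rightarrow> complex"
  assumes n: "2 \<le> n" and q: "\<And>r. 0 < r \<Longrightarrow> (q has_vector_derivative p r) (at r)"
    and pc: "continuous_on {0<..} p"
    and ip: "set_integrable lborel {0<..} (\<lambda>r. r ^ n * (cmod (p r))\<^sup>2)"
  shows "\<exists>C. \<forall>s\<in>{0<..1}. cmod (q s) \<le> C / sqrt (s ^ (n - 1))"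
proof -
  define I where "I = (LINT r:{0<..}|lborel. r ^ n * (cmod (p r))\<^sup>2)"
  have "cmod (q s) \<le> (cmod (q 1) + (I + 1) / 2) / sqrt (s ^ (n - 1))" if s: "s \<in> {0<..1}" for s
  proof -
    define m where "m = sqrt (s ^ (n - 1))"
    have s0: "0 < s" "s \<le> 1" using s by auto
    have m0: "m > 0" "m \<le> 1" "m * m = s ^ (n - 1)" using s0 by (auto simp: m_def power_le_one)
    have pcs: "continuous_on {s..1} p" using s0 by (intro continuous_on_subset[OF pc]) auto
    have FTC: "(p has_integral (q 1 - q s)) {s..1}"
    proof (rule fundamental_theorem_of_calculus[where f=q and f'=p, OF s0(2)])
      fix r assume "r \<in> {s..1}"
      then show "(q has_vector_derivative p r) (at r within {s..1})"
        using s0 by (auto intro: has_vector_derivative_at_within[OF q])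
    qed
    let ?F = "\<lambda>r. inverse (2 * m) * (r ^ n * (cmod (p r))\<^sup>2) + (m / 2) * (1 / r ^ n)"
    have c1: "continuous_on {s..1} (\<lambda>r. r ^ n * (cmod (p r))\<^sup>2)" by (intro continuous_intros pcs)
    have i1: "(\<lambda>r. r ^ n * (cmod (p r))\<^sup>2) integrable_on {s..1}" by (rule integrable_continuous_real[OF c1])
    have J: "((\<lambda>r. 1 / r ^ n) has_integral (- (inverse 1 ^ (n-1) / real (n-1)) - (- (inverse s ^ (n-1) / real (n-1))))) {s..1}"
    proof (rule fundamental_theorem_of_calculus[where f="\<lambda>r. - (inverse r ^ (n-1) / real (n-1))" and f'="\<lambda>r. 1 / r ^ n", OF s0(2)])
      fix r assume "r \<in> {s..1}"
      then have "r > 0" using s0 by auto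
      obtain k where k: "n = Suc (Suc k)" using n by (metis add_2_eq_Suc le_Suc_ex)
      have "((\<lambda>r. - (inverse r ^ (n-1) / real (n-1))) has_real_derivative (1 / r ^ n)) (at r)"
      proof -
        have "real (Suc k) \<noteq> 0" by simp
        have "((\<lambda>r. inverse r ^ Suc k) has_real_derivative real (Suc k) * (- (inverse r ^ Suc (Suc 0)) * inverse r ^ (Suc k - Suc 0))) (at r)"
          by (rule DERIV_power[OF DERIV_inverse]) (use \<open>r > 0\<close> in simp)
        from DERIV_minus[OF DERIV_cdivide[OF this, of "real (Suc k)"]]
        have "((\<lambda>r. - (inverse r ^ Suc k / real (Suc k))) has_real_derivative
            - (real (Suc k) * (- (inverse r ^ Suc (Suc 0)) * inverse r ^ (Suc k - Suc 0)) / real (Suc k))) (at r)" .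
        moreover have "- (real (Suc k) * (- (inverse r ^ Suc (Suc 0)) * inverse r ^ (Suc k - Suc 0)) / real (Suc k)) = 1 / r ^ n"
          unfolding k using \<open>real (Suc k) \<noteq> 0\<close> \<open>r > 0\<close> by (simp add: field_simps del: of_nat_Suc)
        ultimately show ?thesis unfolding k by (simp del: of_nat_Suc)
      qed
      then show "((\<lambda>r. - (inverse r ^ (n-1) / real (n-1))) has_vector_derivative (1 / r ^ n)) (at r within {s..1})"
        by (simp add: has_real_derivative_iff_has_vector_derivative has_vector_derivative_at_within)
    qed
    have Jle: "integral {s..1} (\<lambda>r. 1 / r ^ n) \<le> 1 / (m * m)"
    proof -
      have "real (n - 1) \<ge> 1" using n by simp
      then have "inverse s ^ (n-1) / real (n-1) \<le> inverse s ^ (n-1) / 1"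
        using s0 by (intro divide_left_mono) auto
      moreover have "inverse 1 ^ (n-1) / real (n-1) \<ge> 0" by simp
      moreover have "1 / (m * m) = inverse s ^ (n-1) / 1" unfolding m0(3) by (simp add: power_inverse divide_inverse)
      ultimately show ?thesis unfolding integral_unique[OF J] by linarith
    qed
    have iF: "?F integrable_on {s..1}"
      by (intro integrable_add integrable_on_mult_right i1 has_integral_integrable[OF J])
    have "norm (q 1 - q s) \<le> integral {s..1} ?F"
      unfolding integral_unique[OF FTC, symmetric]
    proof (rule integral_norm_bound_integral[OF has_integral_integrable[OF FTC] iF])
      fix r assume "r \<in> {s..1}"
      then have r: "r > 0" using s0 by auto
      \<comment> \<open>The integrand of the bound exceeds |p| by a nonnegative multiple of a
        square.\<close>
      have "0 \<le> (inverse m * (r^n * cmod (p r)) - 1)\<^sup>2 * (m / (2 * r ^ n))" using r m0 by simp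
      also have "\<dots> = ?F r - cmod (p r)" using r m0(1) by (simp add: field_simps power2_eq_square)
      finally show "norm (p r) \<le> ?F r" by simp
    qed
    also have "integral {s..1} ?F = inverse (2 * m) * integral {s..1} (\<lambda>r. r ^ n * (cmod (p r))\<^sup>2) + (m / 2) * integral {s..1} (\<lambda>r. 1 / r ^ n)"
      by (simp only: integral_add[OF integrable_on_mult_right[OF i1] integrable_on_mult_right[OF has_integral_integrable[OF J]]] integral_mult_right)
    also have "\<dots> \<le> inverse (2 * m) * I + (m / 2) * (1 / (m * m))"
    proof (intro add_mono mult_left_mono Jle)
      show "integral {s..1} (\<lambda>r. r ^ n * (cmod (p r))\<^sup>2) \<le> I" unfolding I_def
        by (rule integral_le_set_integral[OF ip]) (use s0 pc in \<open>auto intro!: continuous_intros\<close>)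
    qed (use m0 in auto)
    also have "\<dots> = ((I + 1) / 2) / m" using m0(1) by (simp add: field_simps)
    finally have "cmod (q 1 - q s) \<le> ((I + 1) / 2) / m" .
    \<comment> \<open>Since s <= 1 gives m <= 1, the constant |q(1)| is absorbed into the same
      power.\<close>
    moreover have "cmod (q 1) \<le> cmod (q 1) / m" using m0 by (simp add: pos_le_divide_eq mult_left_le)
    moreover have "cmod (q s) \<le> cmod (q 1) + cmod (q 1 - q s)" by (metis norm_minus_commute norm_triangle_sub)
    ultimately have "cmod (q s) \<le> cmod (q 1) / m + ((I + 1) / 2) / m" by linarith
    then show ?thesis unfolding m_def by (simp add: add_divide_distrib)
  qed
  then show ?thesis by blast
qed

section \<open>Decay of the profile at infinity\<close>

text \<open>Over [R,M] the integral of \<open>f\<close> is at most F(M) - F(R) <= U - F(R),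
  uniformly in M, and monotone convergence passes to the half line.\<close>

lemma set_integrable_Ici_of_primitive:
  fixes f :: "real \<Rightarrow> real"
  assumes c: "continuous_on {R..} f" and nn: "\<And>r. R \<le> r \<Longrightarrow> 0 \<le> f r"
    and F: "\<And>r. R \<le> r \<Longrightarrow> (F has_real_derivative F' r) (at r)" and le: "\<And>r. R \<le> r \<Longrightarrow> f r \<le> F' r"
    and U: "\<And>r. R \<le> r \<Longrightarrow> F r \<le> U"
  shows "set_integrable lborel {R..} f"
proof -
  have si: "set_integrable lborel {R..M} f" for M
    by (rule borel_integrable_atLeastAtMost') (rule continuous_on_subset[OF c], auto)
  have bd: "(LINT r:{R..M}|lborel. f r) \<le> U - F R" if "R \<le> M" for M
  proof -
    have "(F' has_integral (F M - F R)) {R..M}"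
    proof (rule fundamental_theorem_of_calculus[where f=F and f'=F', OF that])
      fix r assume "r \<in> {R..M}"
      then have "(F has_real_derivative F' r) (at r within {R..M})"
        by (auto intro: has_field_derivative_at_within[OF F])
      then show "(F has_vector_derivative F' r) (at r within {R..M})"
        by (simp add: has_real_derivative_iff_has_vector_derivative)
    qed
    moreover have "f integrable_on {R..M}" using set_borel_integral_eq_integral(1)[OF si] .
    ultimately have "integral {R..M} f \<le> F M - F R"
      using le by (intro has_integral_le[OF integrable_integral]) auto
    then show ?thesis using U[OF that] set_borel_integral_eq_integral(2)[OF si, of M] by simp
  qed
  have m: "(\<lambda>r. indicator {R..} r *\<^sub>R f r) \<in> borel_measurable borel"
    by (rule borel_measurable_continuous_on_indicator[OF _ c]) simp
  have "(\<integral>\<^sup>+r. ennreal (norm (indicator {R..} r *\<^sub>R f r)) \<partial>lborel) \<le> ennreal (U - F R)"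
  proof -
    let ?g = "\<lambda>(i::nat) r. ennreal (indicator {R..R + real i} r *\<^sub>R f r)"
    have eq: "ennreal (norm (indicator {R..} r *\<^sub>R f r)) = (SUP i. ?g i r)" for r
    proof (cases "R \<le> r")
      case True
      obtain k :: nat where k: "r - R \<le> real k" using real_arch_simple by blast
      have "(SUP i. ?g i r) = ennreal (f r)"
      proof (rule antisym)
        show "(SUP i. ?g i r) \<le> ennreal (f r)"
          by (rule SUP_least) (auto simp: indicator_def nn[OF True])
        have "ennreal (f r) = ?g k r" using k True by simp
        also have "\<dots> \<le> (SUP i. ?g i r)" by (rule SUP_upper) simp
        finally show "ennreal (f r) \<le> (SUP i. ?g i r)" .
      qed
      then show ?thesis using True nn[OF True] by simp
    next
      case False then show ?thesis by simp
    qed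
    have "(\<integral>\<^sup>+r. (SUP i. ?g i r) \<partial>lborel) = (SUP i. \<integral>\<^sup>+r. ?g i r \<partial>lborel)"
    proof (rule nn_integral_monotone_convergence_SUP)
      show "incseq ?g" using nn by (auto simp: incseq_def le_fun_def indicator_def intro!: ennreal_leI)
      show "?g i \<in> borel_measurable lborel" for i
        using borel_measurable_integrable[OF si[of "R + real i", unfolded set_integrable_def]] by measurable
    qed
    also have "\<dots> \<le> ennreal (U - F R)"
    proof (rule SUP_least)
      fix i :: nat
      have "(\<integral>\<^sup>+r. ?g i r \<partial>lborel) = ennreal (LINT r:{R..R + real i}|lborel. f r)"
        unfolding set_lebesgue_integral_def
        by (rule nn_integral_eq_integral) (use si nn in \<open>auto simp: set_integrable_def indicator_def\<close>)
      then show "(\<integral>\<^sup>+r. ?g i r \<partial>lborel) \<le> ennreal (U - F R)" using bd[of "R + real i"] by (simp add: ennreal_leI)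
    qed
    finally show ?thesis by (simp only: eq)
  qed
  then have "(\<integral>\<^sup>+r. ennreal (norm (indicator {R..} r *\<^sub>R f r)) \<partial>lborel) < \<infinity>"
    using ennreal_less_top le_less_trans by (metis infinity_ennreal_def)
  then show ?thesis unfolding set_integrable_def using m by (intro integrableI_bounded) auto
qed


text \<open>A unit window moving to infinity leaves every point behind, so the truncated integrand
  tends to 0 pointwise while |f| dominates it.\<close>

lemma tail_integral_tendsto_0:
  fixes f :: "real \<Rightarrow> real"
  assumes f: "set_integrable lborel {0<..} f"
  shows "((\<lambda>R. LINT r:{R..R+1}|lborel. f r) \<longlongrightarrow> 0) at_top"
proof -
  let ?f = "\<lambda>r. indicator {0<..} r *\<^sub>R f r"
  have i: "integrable lborel ?f" using f by (simp add: set_integrable_def)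
  have [measurable]: "?f \<in> borel_measurable borel" using borel_measurable_integrable[OF i] by simp
  have "((\<lambda>R. LINT r|lborel. indicator {R..R+1} r *\<^sub>R ?f r) \<longlongrightarrow> (LINT r|(lborel :: real measure). (0::real))) at_top"
  proof (rule tendsto_at_topI_sequentially)
    fix X :: "nat \<Rightarrow> real" assume X: "filterlim X at_top sequentially"
    show "(\<lambda>k. LINT r|lborel. indicator {X k..X k+1} r *\<^sub>R ?f r) \<longlonglongrightarrow> (LINT r|(lborel :: real measure). (0::real))"
    proof (rule integral_dominated_convergence[where w="\<lambda>r. norm (?f r)"])
      show "integrable lborel (\<lambda>r. norm (?f r))" by (rule integrable_norm[OF i])
      show "AE x in lborel. (\<lambda>k. indicator {X k..X k+1} x *\<^sub>R ?f x) \<longlonglongrightarrow> 0"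
      proof (intro AE_I2 tendsto_eventually)
        fix x :: real
        have "\<forall>\<^sub>F k in sequentially. X k > x" using X by (simp add: filterlim_at_top_dense)
        then show "\<forall>\<^sub>F k in sequentially. indicator {X k..X k+1} x *\<^sub>R ?f x = 0"
          by eventually_elim simp
      qed
      show "AE x in lborel. norm (indicator {X k..X k+1} x *\<^sub>R ?f x) \<le> norm (?f x)" for k
        by (intro AE_I2) (simp add: indicator_def)
    qed measurable
  qed
  moreover have "\<forall>\<^sub>F R in at_top. (LINT r|lborel. indicator {R..R+1} r *\<^sub>R ?f r) = (LINT r:{R..R+1}|lborel. f r)"
    using eventually_gt_at_top[of 0]
  proof eventually_elim
    case (elim R)
    have "indicator {R..R+1} r *\<^sub>R ?f r = indicator {R..R+1} r *\<^sub>R f r" for r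
      using elim by (auto simp: indicator_def)
    then show ?case unfolding set_lebesgue_integral_def by (simp only:)
  qed
  ultimately show ?thesis by (simp add: tendsto_cong)
qed

lemma has_real_derivative_cmod_square:
  assumes "(q has_vector_derivative q') (at r)"
  shows "((\<lambda>r. (cmod (q r))\<^sup>2) has_real_derivative 2 * Re (cnj (q r) * q')) (at r)"
proof -
  have "((\<lambda>r. Re (q r)) has_real_derivative Re q') (at r)" "((\<lambda>r. Im (q r)) has_real_derivative Im q') (at r)"
    using bounded_linear.has_vector_derivative[OF bounded_linear_Re assms] bounded_linear.has_vector_derivative[OF bounded_linear_Im assms]
    by (auto simp: has_real_derivative_iff_has_vector_derivative)
  note D = this
  have "((\<lambda>r. Re (q r) * Re (q r) + Im (q r) * Im (q r)) has_real_derivative 2 * Re (cnj (q r) * q')) (at r)"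
    using DERIV_add[OF DERIV_mult[OF D(1) D(1)] DERIV_mult[OF D(2) D(2)]] by (simp add: algebra_simps)
  moreover have "(cmod (q r))\<^sup>2 = Re (q r) * Re (q r) + Im (q r) * Im (q r)" for r
    unfolding cmod_power2 by (simp add: power2_eq_square)
  ultimately show ?thesis by (simp only:)
qed

text \<open>|q|^2 varies over [r, r+1] by at most the integral of |q|^2 + |p|^2. Averaging over the
  second endpoint bounds |q(r)|^2 by twice the energy on that interval, which is part of the tail of
  a convergent integral. For r >= 1 the weight r^n is at least 1 and may be inserted freely.\<close>

lemma profile_tendsto_0:
  fixes q p :: "real \<Rightarrow> complex"
  assumes q: "\<And>r. 0 < r \<Longrightarrow> (q has_vector_derivative p r) (at r)"
    and pc: "continuous_on {0<..} p"
    and ip: "set_integrable lborel {0<..} (\<lambda>r. r ^ n * (cmod (p r))\<^sup>2)"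
    and iq: "set_integrable lborel {0<..} (\<lambda>r. r ^ n * (cmod (q r))\<^sup>2)"
  shows "((\<lambda>r. (cmod (q r))\<^sup>2) \<longlongrightarrow> 0) at_top"
proof -
  have qc: "continuous_on {0<..} q"
    using q by (meson continuous_at_imp_continuous_on greaterThan_iff has_vector_derivative_continuous)
  let ?E = "\<lambda>r. r ^ n * (cmod (q r))\<^sup>2 + r ^ n * (cmod (p r))\<^sup>2"
  have iE: "set_integrable lborel {0<..} ?E" by (rule set_integral_add(1)[OF iq ip])
  have Ec: "continuous_on {0<..} ?E" by (intro continuous_intros qc pc)
  have bound: "(cmod (q r))\<^sup>2 \<le> 2 * (LINT s:{r..r+1}|lborel. ?E s)" if r: "1 \<le> r" for r
  proof -
    let ?T = "integral {r..r+1} ?E"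
    have sub: "{a..b} \<subseteq> {0<..}" if "r \<le> a" for a b using that r by auto
    have Ei: "?E integrable_on {a..b}" if "r \<le> a" for a b
      by (rule integrable_continuous_real[OF continuous_on_subset[OF Ec sub[OF that]]])
    have point: "(cmod (q r))\<^sup>2 \<le> (cmod (q s))\<^sup>2 + ?T" if s: "s \<in> {r..r+1}" for s
    proof -
      let ?D = "\<lambda>t. 2 * Re (cnj (q t) * p t)"
      have F: "(?D has_integral ((cmod (q s))\<^sup>2 - (cmod (q r))\<^sup>2)) {r..s}"
      proof (rule fundamental_theorem_of_calculus[where f="\<lambda>r. (cmod (q r))\<^sup>2" and f'="?D"])
        fix t assume "t \<in> {r..s}"
        then have "0 < t" using r by auto
        from has_real_derivative_cmod_square[OF q[OF this]]
        show "((\<lambda>r. (cmod (q r))\<^sup>2) has_vector_derivative ?D t) (at t within {r..s})"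
          by (simp add: has_real_derivative_iff_has_vector_derivative has_vector_derivative_at_within)
      qed (use s in auto)
      have "norm ((cmod (q s))\<^sup>2 - (cmod (q r))\<^sup>2) \<le> integral {r..s} ?E"
        unfolding integral_unique[OF F, symmetric]
      proof (rule integral_norm_bound_integral[OF has_integral_integrable[OF F] Ei[OF order.refl]])
        fix t assume "t \<in> {r..s}"
        then have "1 \<le> t" using r by auto
        then have t1: "1 \<le> t ^ n" by simp
        have "norm (?D t) \<le> 2 * (cmod (q t) * cmod (p t))"
          using abs_Re_le_cmod[of "cnj (q t) * p t"] by (simp add: norm_mult)
        also have "\<dots> \<le> (cmod (q t))\<^sup>2 + (cmod (p t))\<^sup>2"
          using sum_squares_bound[of "cmod (q t)" "cmod (p t)"] by simp
        also have "\<dots> \<le> ?E t"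
          using mult_right_mono[OF t1, of "(cmod (q t))\<^sup>2"] mult_right_mono[OF t1, of "(cmod (p t))\<^sup>2"] by simp
        finally show "norm (?D t) \<le> ?E t" .
      qed
      also have "\<dots> \<le> ?T" using s r by (intro integral_subset_le Ei) auto
      finally show ?thesis by simp
    qed
    have qi: "(\<lambda>s. (cmod (q s))\<^sup>2) integrable_on {r..r+1}"
      by (rule integrable_continuous_real, rule continuous_on_subset[OF _ sub[OF order.refl]]) (intro continuous_intros qc)
    have "integral {r..r+1} (\<lambda>s. (cmod (q r))\<^sup>2) \<le> integral {r..r+1} (\<lambda>s. (cmod (q s))\<^sup>2 + ?T)"
      by (rule integral_le) (use point qi in \<open>auto intro!: integrable_add\<close>)
    also have "\<dots> = integral {r..r+1} (\<lambda>s. (cmod (q s))\<^sup>2) + ?T"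
      by (subst integral_add) (use qi in auto)
    also have "integral {r..r+1} (\<lambda>s. (cmod (q s))\<^sup>2) \<le> ?T"
    proof (rule integral_le[OF qi Ei[OF order.refl]])
      fix t assume "t \<in> {r..r+1}"
      then have "1 \<le> t" using r by auto
      then have t1: "1 \<le> t ^ n" by simp
      show "(cmod (q t))\<^sup>2 \<le> ?E t"
        using mult_right_mono[OF t1, of "(cmod (q t))\<^sup>2"] t1 by (simp add: add_increasing2)
    qed
    finally have "(cmod (q r))\<^sup>2 \<le> 2 * ?T" by simp
    moreover have "set_integrable lborel {r..r+1} ?E" by (rule set_integrable_subset[OF iE]) (use r in auto)
    from set_borel_integral_eq_integral(2)[OF this] have "(LINT s:{r..r+1}|lborel. ?E s) = ?T" .
    ultimately show ?thesis by (simp only:)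
  qed
  have "((\<lambda>r. 2 * (LINT s:{r..r+1}|lborel. ?E s)) \<longlongrightarrow> 2 * 0) at_top"
    by (intro tendsto_mult tendsto_const tail_integral_tendsto_0 iE)
  then have lim: "((\<lambda>r. 2 * (LINT s:{r..r+1}|lborel. ?E s)) \<longlongrightarrow> 0) at_top" by simp
  show ?thesis
  proof (rule Lim_null_comparison[OF _ lim])
    show "\<forall>\<^sub>F r in at_top. norm ((cmod (q r))\<^sup>2) \<le> 2 * (LINT s:{r..r+1}|lborel. ?E s)"
      using eventually_ge_at_top[of 1] by eventually_elim (use bound in simp)
  qed
qed

lemma profile_decay:
  fixes q p :: "real \<Rightarrow> complex"
  assumes d: "0 < d" and \<omega>: "0 < \<omega>" and q: "\<And>r. 0 < r \<Longrightarrow> (q has_vector_derivative p r) (at r)"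
    and p: "\<And>r. 0 < r \<Longrightarrow> ((\<lambda>r. r ^ n *\<^sub>R p r) has_vector_derivative r ^ n *\<^sub>R profile_rhs d c \<omega> q r) (at r)"
    and pc: "continuous_on {0<..} p"
    and ip: "set_integrable lborel {0<..} (\<lambda>r. r ^ n * (cmod (p r))\<^sup>2)"
    and iq: "set_integrable lborel {0<..} (\<lambda>r. r ^ n * (cmod (q r))\<^sup>2)"
  shows "\<exists>R>0. set_integrable lborel {R..} (\<lambda>r. r\<^sup>2 * (r ^ n * (cmod (q r))\<^sup>2))"
proof -
  have qc: "continuous_on {0<..} q"
    using q by (meson continuous_at_imp_continuous_on greaterThan_iff has_vector_derivative_continuous)
  define A where "A r = r ^ n * (cmod (q r))\<^sup>2" for r
  define B where "B r = r ^ n * (cmod (p r))\<^sup>2" for r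
  define V where "V r = \<omega> - c / r^2 - cmod (q r) powr (4 / d)" for r
  define J where "J r = Re (cnj (q r) * (r ^ n *\<^sub>R p r))" for r
  \<comment> \<open>Chosen so that K (B + (\<omega>/2) A) dominates (A + B)/2: K \<omega>/2 equals
    \<omega>/2 + 1/2, and K >= 1.\<close>
  define K where "K = 1 + 1 / \<omega>"
  have K: "K > 0" using \<omega> by (simp add: K_def add_pos_pos)
  have V: "\<forall>\<^sub>F r in at_top. V r \<ge> \<omega> / 2"
  proof -
    \<comment> \<open>The decay is known for |q|^2, so |q|^(4/d) is written as its power
      2/d.\<close>
    have "((\<lambda>r. (cmod (q r))\<^sup>2 powr (2 / d)) \<longlongrightarrow> 0 powr (2/d)) at_top"
      using d by (intro tendsto_powr' profile_tendsto_0[OF q pc ip iq] tendsto_const) auto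
    moreover have "(cmod (q r))\<^sup>2 powr (2 / d) = cmod (q r) powr (4 / d)" for r
      by (simp add: powr_powr flip: powr_numeral) 
    ultimately have 1: "((\<lambda>r. cmod (q r) powr (4 / d)) \<longlongrightarrow> 0) at_top" by simp
    have 2: "((\<lambda>r::real. c / r^2) \<longlongrightarrow> 0) at_top"
      by (intro real_tendsto_divide_at_top[OF tendsto_const] filterlim_pow_at_top filterlim_ident) simp
    have "((\<lambda>r. V r) \<longlongrightarrow> \<omega> - 0 - 0) at_top" unfolding V_def by (intro tendsto_intros 1 2)
    then have "\<forall>\<^sub>F r in at_top. V r > \<omega> / 2" using \<omega> by (intro order_tendstoD) auto
    then show ?thesis by eventually_elim simp
  qed
  then obtain R0 where R0: "\<And>r. R0 \<le> r \<Longrightarrow> V r \<ge> \<omega> / 2" unfolding eventually_at_top_linorder by blast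
  \<comment> \<open>For r >= 4 K the bound |J| <= K J' gives 2 r J >= - r^2 J'/2, so half of r^2 J'
    survives in the derivative of r^2 J.\<close>
  define R where "R = max R0 (max 1 (4 * K))"
  have R: "R \<ge> 1" "R \<ge> 4 * K" "\<And>r. R \<le> r \<Longrightarrow> V r \<ge> \<omega> / 2" using R0 by (auto simp: R_def)
  define J' where "J' r = B r + V r * A r" for r
  have A0: "A r \<ge> 0" "B r \<ge> 0" if "r \<ge> R" for r using that R(1) by (auto simp: A_def B_def)
  have Jd: "(J has_real_derivative J' r) (at r)" if "r \<ge> R" for r
  proof -
    have r: "r > 0" using that R(1) by simp
    have cd: "((\<lambda>r. cnj (q r)) has_vector_derivative cnj (p r)) (at r)"
      by (rule bounded_linear.has_vector_derivative[OF bounded_linear_cnj q[OF r]])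
    from bounded_linear.has_vector_derivative[OF bounded_linear_Re has_vector_derivative_mult[OF cd p[OF r]]]
    have "(J has_vector_derivative Re (cnj (q r) * (r ^ n *\<^sub>R profile_rhs d c \<omega> q r) + cnj (p r) * (r ^ n *\<^sub>R p r))) (at r)"
      unfolding J_def .
    moreover have "Re (cnj (q r) * (r ^ n *\<^sub>R profile_rhs d c \<omega> q r) + cnj (p r) * (r ^ n *\<^sub>R p r)) = J' r"
    proof -
      have "cnj (q r) * (r ^ n *\<^sub>R profile_rhs d c \<omega> q r) = of_real (r ^ n * V r) * (q r * cnj (q r))"
        by (simp add: profile_rhs_def V_def scaleR_conv_of_real mult_ac)
      moreover have "cnj (p r) * (r ^ n *\<^sub>R p r) = of_real (r ^ n) * (p r * cnj (p r))"
        by (simp add: scaleR_conv_of_real mult_ac)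
      ultimately show ?thesis
        unfolding complex_norm_square[symmetric] by (simp add: J'_def A_def B_def del: of_real_power flip: of_real_mult of_real_power)
    qed
    ultimately show ?thesis by (simp add: has_real_derivative_iff_has_vector_derivative)
  qed
  have J'lo: "J' r \<ge> B r + \<omega> / 2 * A r" if "r \<ge> R" for r
    using mult_right_mono[OF R(3)[OF that] A0(1)[OF that]] by (simp add: J'_def)
  have J'0: "J' r \<ge> 0" if "r \<ge> R" for r
    using J'lo[OF that] A0[OF that] \<omega> mult_nonneg_nonneg[of "\<omega>/2" "A r"] by linarith
  have JAB: "\<bar>J r\<bar> \<le> (A r + B r) / 2" if "r \<ge> R" for r
  proof -
    have r: "r > 0" using that R(1) by simp
    have "\<bar>J r\<bar> \<le> r ^ n * (cmod (q r) * cmod (p r))"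
      unfolding J_def using r by (intro order.trans[OF abs_Re_le_cmod]) (simp add: norm_mult)
    also have "\<dots> \<le> r ^ n * (((cmod (q r))\<^sup>2 + (cmod (p r))\<^sup>2) / 2)"
      using sum_squares_bound[of "cmod (q r)" "cmod (p r)"] r by (intro mult_left_mono) auto
    finally show ?thesis by (simp add: A_def B_def algebra_simps)
  qed
  have JK: "\<bar>J r\<bar> \<le> K * J' r" if "r \<ge> R" for r
  proof -
    have "K * (B r + \<omega> / 2 * A r) = B r + B r / \<omega> + \<omega> / 2 * A r + A r / 2" using \<omega> by (simp add: K_def field_simps)
    moreover have "0 \<le> B r / \<omega>" "0 \<le> \<omega> / 2 * A r" using A0[OF that] \<omega> by auto
    moreover have "(a + b) / 2 \<le> b + x + y + a / 2" if "0 \<le> x" "0 \<le> y" "0 \<le> b" for a b x y :: real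
      using that by (simp add: field_simps)
    ultimately have "(A r + B r) / 2 \<le> K * (B r + \<omega> / 2 * A r)" using A0[OF that] by simp
    also have "\<dots> \<le> K * J' r" using J'lo[OF that] K by (intro mult_left_mono) auto
    finally show ?thesis using JAB[OF that] by linarith
  qed
  have Jmono: "J a \<le> J b" if "R \<le> a" "a \<le> b" for a b
  proof (rule DERIV_nonneg_imp_nondecreasing[OF that(2)])
    fix x assume "a \<le> x" "x \<le> b"
    then show "\<exists>y. (J has_real_derivative y) (at x) \<and> 0 \<le> y" using Jd[of x] J'0[of x] that by auto
  qed
  \<comment> \<open>A positive value of the increasing \<open>J\<close> would persist up to
    infinity, whereas |J| is bounded by the integrable A + B. This is where the finite H1 norm
    selects the decaying behaviour.\<close>
  have J0: "J r \<le> 0" if r: "r \<ge> R" for r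
  proof (rule ccontr)
    assume "\<not> J r \<le> 0"
    then have Jr: "J r > 0" by simp
    define I where "I = (LINT s:{0<..}|lborel. A s + B s)"
    have iAB: "set_integrable lborel {0<..} (\<lambda>s. A s + B s)" unfolding A_def B_def by (rule set_integral_add(1)[OF iq ip])
    have cAB: "continuous_on {0<..} (\<lambda>s. A s + B s)" unfolding A_def B_def by (intro continuous_intros qc pc)
    have r0: "r > 0" using r R(1) by simp
    have "M * J r \<le> I" if "M \<ge> 0" for M
    proof -
      have iH: "(\<lambda>s. A s + B s) integrable_on {r..r+M}"
        by (rule integrable_continuous_real[OF continuous_on_subset[OF cAB]]) (use r0 in auto)
      have "M * J r = integral {r..r+M} (\<lambda>s. J r)" using that by simp
      also have "\<dots> \<le> integral {r..r+M} (\<lambda>s. A s + B s)"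
      proof (rule integral_le[OF _ iH])
        fix s assume s: "s \<in> {r..r+M}"
        then have "J r \<le> J s" using Jmono[of r s] r by auto
        also have "\<dots> \<le> A s + B s" using JAB[of s] A0[of s] s r by auto
        finally show "J r \<le> A s + B s" .
      qed (rule integrable_const_ivl)
      also have "\<dots> \<le> I" unfolding I_def
        by (rule integral_le_set_integral[OF iAB cAB _ r0]) (simp add: A_def B_def)
      finally show ?thesis .
    qed
    moreover have "(\<bar>I\<bar> / J r + 1) * J r = \<bar>I\<bar> + J r" using Jr by (simp add: field_simps)
    moreover have "\<bar>I\<bar> / J r + 1 \<ge> 0" using Jr by simp
    ultimately have "\<bar>I\<bar> + J r \<le> I" by metis
    then show False using Jr by linarith
  qed
  \<comment> \<open>The factor \<omega>/4 comes from r^2 J'/2 >= (r^2/2)(\<omega>/2) A; the upper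
    bound U = 0 is the sign of \<open>J\<close>.\<close>
  have "set_integrable lborel {R..} (\<lambda>r. \<omega> / 4 * (r\<^sup>2 * A r))"
  proof (rule set_integrable_Ici_of_primitive[where F="\<lambda>r. r\<^sup>2 * J r" and F'="\<lambda>r. r\<^sup>2 * J' r + 2 * r * J r" and U=0])
    have "continuous_on {0<..} (\<lambda>r. \<omega> / 4 * (r\<^sup>2 * A r))" unfolding A_def by (intro continuous_intros qc)
    then show "continuous_on {R..} (\<lambda>r. \<omega> / 4 * (r\<^sup>2 * A r))" by (rule continuous_on_subset) (use R(1) in auto)
    fix r assume r: "R \<le> r"
    show "0 \<le> \<omega> / 4 * (r\<^sup>2 * A r)" using A0[OF r] \<omega> by simp
    show "((\<lambda>r. r\<^sup>2 * J r) has_real_derivative r\<^sup>2 * J' r + 2 * r * J r) (at r)"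
      by (auto intro!: derivative_eq_intros Jd[OF r] simp: algebra_simps)
    show "r\<^sup>2 * J r \<le> 0" using J0[OF r] by (simp add: mult_nonneg_nonpos)
    have r4: "r \<ge> 4 * K" "r > 0" using r R by auto
    have "2 * r * J r \<ge> - (2 * r * (K * J' r))"
    proof -
      have "- J r \<le> K * J' r" using JK[OF r] by linarith
      then have "2 * r * (- J r) \<le> 2 * r * (K * J' r)" using r4 by (intro mult_left_mono) auto
      then show ?thesis by linarith
    qed
    moreover have "2 * r * (K * J' r) \<le> r\<^sup>2 / 2 * J' r"
    proof -
      have "2 * r * K \<le> r * r / 2" using r4 by (simp add: mult_left_mono)
      then have "(2 * r * K) * J' r \<le> (r * r / 2) * J' r" by (intro mult_right_mono J'0[OF r])
      then show ?thesis by (simp add: power2_eq_square mult.assoc)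
    qed
    moreover have "r\<^sup>2 * J' r = 2 * (r\<^sup>2 / 2 * J' r)" by simp
    ultimately have "r\<^sup>2 / 2 * J' r \<le> r\<^sup>2 * J' r + 2 * r * J r" by linarith
    moreover have "\<omega> / 4 * (r\<^sup>2 * A r) \<le> r\<^sup>2 / 2 * J' r"
    proof -
      have "\<omega> / 2 * A r \<le> J' r" using J'lo[OF r] A0[OF r] by linarith
      then have "r\<^sup>2 / 2 * (\<omega> / 2 * A r) \<le> r\<^sup>2 / 2 * J' r" by (intro mult_left_mono) auto
      then show ?thesis by (simp add: algebra_simps)
    qed
    ultimately show "\<omega> / 4 * (r\<^sup>2 * A r) \<le> r\<^sup>2 * J' r + 2 * r * J r" by linarith
  qed
  then have "set_integrable lborel {R..} (\<lambda>r. (4 / \<omega>) * (\<omega> / 4 * (r\<^sup>2 * A r)))" by (rule set_integrable_mult_right[rotated]) 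
  then have "set_integrable lborel {R..} (\<lambda>r. r\<^sup>2 * A r)" using \<omega> by simp
  then show ?thesis unfolding A_def using R(1) by (intro exI[of _ R]) auto
qed

section \<open>The weak gradient of a radial function\<close>

text \<open>Difference quotients in direction \<open>j\<close> integrate to zero by translation invariance.\<close>

lemma integral_bump_partial_eq_0:
  fixes F :: "real^'d \<Rightarrow> real"
  assumes F: "C1_bump U F D"
  shows "(LINT x|lborel. D x $ j) = 0"
proof -
  obtain K where K: "compact K" "\<And>x. x \<notin> K \<Longrightarrow> F x = 0" "\<And>x. x \<notin> K \<Longrightarrow> D x = 0" using bump_support[OF F] by metis
  obtain R where R: "\<And>x. x \<in> K \<Longrightarrow> norm x \<le> R" using compact_imp_bounded[OF K(1)] by (auto simp: bounded_iff)
  have g: "has_cont_gradient F D" using F by (simp add: C1_bump_def)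
  note [measurable] = has_cont_gradient_measurable[OF g]
  have Fc: "continuous_on UNIV F" "continuous_on UNIV D" using has_cont_gradient_continuous[OF g] by auto
  have "compact ((\<lambda>x. D x $ j) ` K)" by (intro compact_continuous_image continuous_intros continuous_on_subset[OF Fc(2)] K(1)) auto
  then obtain M0 where M0: "\<And>x. x \<in> K \<Longrightarrow> \<bar>D x $ j\<bar> \<le> M0" using compact_imp_bounded by (force simp: bounded_iff)
  define M where "M = max M0 0"
  have M: "\<bar>D x $ j\<bar> \<le> M" for x using M0[of x] K(3)[of x] by (cases "x \<in> K") (auto simp: M_def)
  let ?e = "axis j 1 :: real^'d"
  have line: "((\<lambda>t. F (x + t *\<^sub>R ?e)) has_real_derivative D (x + t *\<^sub>R ?e) $ j) (at t)" for x t
  proof -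
    have "((\<lambda>s. F ((x + t *\<^sub>R ?e) + s *\<^sub>R ?e)) has_real_derivative D (x + t *\<^sub>R ?e) $ j) (at 0)" by (rule bump_partial[OF F])
    then have "((\<lambda>s. F (x + (s + t) *\<^sub>R ?e)) has_real_derivative D (x + t *\<^sub>R ?e) $ j) (at 0)" by (simp add: algebra_simps)
    then show ?thesis using DERIV_shift[of "\<lambda>t. F (x + t *\<^sub>R ?e)" "D (x + t *\<^sub>R ?e) $ j" 0 t] by simp
  qed
  have iF: "integrable lborel F"
  proof -
    have "integrable lborel (\<lambda>x. indicator K x *\<^sub>R F x)"
      by (rule borel_integrable_compact[OF K(1) continuous_on_subset[OF Fc(1)]]) simp
    moreover have "(\<lambda>x. indicator K x *\<^sub>R F x) = F" using K(2) by (intro ext) (auto simp: indicator_def)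
    ultimately show ?thesis by simp
  qed
  \<comment> \<open>Steps of length at most 1 keep the translated supports inside the ball of radius
    R + 1, which carries the dominating function.\<close>
  define t where "t n = 1 / real (Suc n)" for n
  have t: "0 < t n" "t n \<le> 1" for n by (auto simp: t_def)
  have t0: "t \<longlonglongrightarrow> 0" unfolding t_def using LIMSEQ_inverse_real_of_nat by (simp add: inverse_eq_divide)
  define G where "G n x = (F (x + t n *\<^sub>R ?e) - F x) / t n" for n x
  have tr: "integrable lborel (\<lambda>x. F (x + c))" "(LINT x|lborel. F (x + c)) = (LINT x|lborel. F x)" for c :: "real^'d"
  proof -
    have "integrable (distr lborel borel ((+) c)) F" using iF by (simp add: lborel_distr_plus)
    then show "integrable lborel (\<lambda>x. F (x + c))" by (subst (asm) integrable_distr_eq) (auto simp: add.commute)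
    have "(LINT x|distr lborel borel ((+) c). F x) = (LINT x|lborel. F (c + x))" by (rule integral_distr) auto
    then show "(LINT x|lborel. F (x + c)) = (LINT x|lborel. F x)" by (simp add: lborel_distr_plus add.commute)
  qed
  have G0: "(LINT x|lborel. G n x) = 0" for n
    unfolding G_def using tr iF by simp
  have "(\<lambda>n. LINT x|lborel. G n x) \<longlonglongrightarrow> (LINT x|lborel. D x $ j)"
  proof (rule integral_dominated_convergence[where w="\<lambda>x. M * indicator (cball 0 (R + 1)) x"])
    show "integrable lborel (\<lambda>x::real^'d. M * indicator (cball 0 (R + 1)) x)"
      by (intro integrable_mult_right integrable_real_indicator) (use emeasure_bounded_finite[OF bounded_cball] in \<open>auto simp: less_top\<close>)
    show "AE x in lborel. (\<lambda>n. G n x) \<longlonglongrightarrow> D x $ j"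
    proof (intro AE_I2)
      fix x
      have "((\<lambda>h. (F (x + (0 + h) *\<^sub>R ?e) - F (x + 0 *\<^sub>R ?e)) / h) \<longlongrightarrow> D x $ j) (at 0)"
        using bump_partial[OF F, of x j] unfolding DERIV_def .
      then have "((\<lambda>h. (F (x + h *\<^sub>R ?e) - F x) / h) \<longlongrightarrow> D x $ j) (at 0)" by simp
      then have "(\<lambda>n. (F (x + t n *\<^sub>R ?e) - F x) / t n) \<longlonglongrightarrow> D x $ j"
        by (rule filterlim_compose) (use t t0 in \<open>auto simp: filterlim_at less_imp_neq[THEN not_sym]\<close>)
      then show "(\<lambda>n. G n x) \<longlonglongrightarrow> D x $ j" by (simp add: G_def)
    qed
    show "AE x in lborel. norm (G n x) \<le> M * indicator (cball 0 (R + 1)) x" for n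
    proof (intro AE_I2)
      fix x
      show "norm (G n x) \<le> M * indicator (cball 0 (R + 1)) x"
      proof (cases "norm x \<le> R + 1")
        case True
        have "\<exists>z. z > 0 \<and> z < t n \<and> F (x + t n *\<^sub>R ?e) - F (x + 0 *\<^sub>R ?e) = (t n - 0) * D (x + z *\<^sub>R ?e) $ j"
          by (rule MVT2[OF t(1)]) (rule line)
        then obtain z where "F (x + t n *\<^sub>R ?e) - F x = t n * D (x + z *\<^sub>R ?e) $ j" by auto
        then have "G n x = D (x + z *\<^sub>R ?e) $ j" using t(1)[of n] by (simp add: G_def)
        then show ?thesis using M True by simp
      next
        case False
        have "norm (x + t n *\<^sub>R ?e) \<ge> norm x - norm (t n *\<^sub>R ?e)" by (rule norm_diff_ineq)
        moreover have "norm (t n *\<^sub>R ?e) \<le> 1" using t[of n] by simp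
        ultimately have "x + t n *\<^sub>R ?e \<notin> K" "x \<notin> K" using R[of x] R[of "x + t n *\<^sub>R ?e"] False by linarith+
        then show ?thesis using K(2) False by (simp add: G_def)
      qed
    qed
    show "(\<lambda>x. D x $ j) \<in> borel_measurable lborel" by (simp add: borel_measurable_continuous_onI continuous_on_component Fc)
    show "G n \<in> borel_measurable lborel" for n unfolding G_def by measurable
  qed
  then show ?thesis by (simp add: G0 LIMSEQ_const_iff)
qed

lemma has_derivative_radial:
  fixes x :: "'a::euclidean_space"
  assumes "x \<noteq> 0" "(f has_real_derivative f') (at (norm x))"
  shows "((\<lambda>x. f (norm x)) has_derivative (\<lambda>h. (f' *\<^sub>R sgn x) \<bullet> h)) (at x)"
proof -
  have "(f has_derivative (\<lambda>h. f' * h)) (at (norm x))" using assms(2) by (simp add: has_field_derivative_def)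
  moreover have "(norm has_derivative (\<lambda>h. h \<bullet> sgn x)) (at x)"
    using has_derivative_norm[OF assms(1)] by (simp add: inner_commute)
  ultimately have "((\<lambda>x. f (norm x)) has_derivative (\<lambda>h. f' * (h \<bullet> sgn x))) (at x)"
    by (rule has_derivative_compose[rotated])
  then show ?thesis by (simp add: inner_commute)
qed

text \<open>Away from the origin q(|x|) is classically differentiable; multiplied by a bump
  supported there, its real and imaginary parts are C1 bumps, whose partials integrate to 0. So the
  classical and the weak gradient agree off the origin, and the origin is a null set.\<close>

lemma wpd_radial:
  fixes Q :: "real^'d \<Rightarrow> complex"
  assumes H: "H1 Q" and Qq: "AE x in lborel. Q x = q (norm x)" and qm[measurable]: "q \<in> borel_measurable borel"
    and pm[measurable]: "p \<in> borel_measurable borel"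
    and q: "\<And>r. 0 < r \<Longrightarrow> (q has_vector_derivative p r) (at r)" and pc: "continuous_on {0<..} p"
  shows "AE x in lborel. wpd Q j x = p (norm x) * of_real (sgn x $ j)"
proof -
  have L2Q: "L2 Q" using H by (simp add: H1_def)
  have [measurable]: "Q \<in> borel_measurable borel" using L2Q by (simp add: L2_def)
  have L2w: "L2 (wpd Q j)" by (rule wpd_props[OF H])
  then have [measurable]: "wpd Q j \<in> borel_measurable borel" by (simp add: L2_def)
  let ?P = "\<lambda>x::real^'d. p (norm x) * of_real (sgn x $ j)"
  have Pc: "continuous_on (- {0}) ?P"
    by (intro continuous_intros continuous_on_compose2[OF pc]) auto
  have "AE x in lborel. x \<in> - {0} \<longrightarrow> wpd Q j x - ?P x = 0"
  proof (rule fundamental_lemma)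
    show "open (- {0::real^'d})" by (simp add: open_Compl)
    fix a b :: "real^'d" assume ab: "cbox a b \<subseteq> - {0}"
    have "L2 (\<lambda>x::real^'d. of_real (indicator (cbox a b) x))"
    proof -
      obtain R where R: "\<And>x. x \<in> cbox a b \<Longrightarrow> norm x \<le> R" using bounded_cbox[of a b] by (auto simp: bounded_iff)
      show ?thesis by (rule L2_bounded_compact[where M=1 and R=R]) (use R in \<open>auto simp: indicator_def split: if_splits dest: leD\<close>)
    qed
    from L2_mult_integrable[OF L2w this] have "set_integrable lborel (cbox a b) (wpd Q j)"
      by (simp add: set_integrable_def scaleR_conv_of_real mult.commute)
    moreover have "set_integrable lborel (cbox a b) ?P"
      unfolding set_integrable_def by (rule borel_integrable_compact[OF compact_cbox continuous_on_subset[OF Pc ab]])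
    ultimately show "set_integrable lborel (cbox a b) (\<lambda>x. wpd Q j x - ?P x)" by (rule set_integral_diff)
  next
    fix \<phi> :: "real^'d \<Rightarrow> real" and D assume \<phi>: "C1_bump (- {0}) \<phi> D"
    \<comment> \<open>The partial of f(|x|) \<phi>(x), expanded by the product rule; it is applied
      to the real and to the imaginary part of \<open>q\<close>.\<close>
    have part: "integrable lborel (\<lambda>x. f (norm x) * D x $ j + \<phi> x * (f' (norm x) * sgn x $ j)) \<and>
        (LINT x|lborel. f (norm x) * D x $ j + \<phi> x * (f' (norm x) * sgn x $ j)) = 0"
      if f: "\<And>r. 0 < r \<Longrightarrow> (f has_real_derivative f' r) (at r)" and f': "continuous_on {0<..} f'" for f f' :: "real \<Rightarrow> real"
    proof -
      have "C1_bump (- {0}) (\<lambda>x. f (norm x) * \<phi> x) (\<lambda>x. f (norm x) *\<^sub>R D x + \<phi> x *\<^sub>R (f' (norm x) *\<^sub>R sgn x))"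
      proof (rule bump_mult_open[OF \<phi>])
        show "((\<lambda>x. f (norm x)) has_derivative (\<lambda>h. (f' (norm x) *\<^sub>R sgn x) \<bullet> h)) (at x)" if "x \<in> - {0}" for x :: "real^'d"
          using that by (intro has_derivative_radial f) auto
        show "continuous_on (- {0}) (\<lambda>x::real^'d. f' (norm x) *\<^sub>R sgn x)"
          by (intro continuous_intros continuous_on_compose2[OF f']) auto
      qed (simp add: open_Compl)
      note B = this
      obtain K where K: "compact K" "\<And>x. x \<notin> K \<Longrightarrow> f (norm x) *\<^sub>R D x + \<phi> x *\<^sub>R (f' (norm x) *\<^sub>R sgn x) = 0"
        using bump_support[OF B] by metis
      let ?g = "\<lambda>x. (f (norm x) *\<^sub>R D x + \<phi> x *\<^sub>R (f' (norm x) *\<^sub>R sgn x)) $ j"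
      have "integrable lborel (\<lambda>x. indicator K x *\<^sub>R ?g x)"
      proof (rule borel_integrable_compact[OF K(1)])
        have "has_cont_gradient (\<lambda>x. f (norm x) * \<phi> x) (\<lambda>x. f (norm x) *\<^sub>R D x + \<phi> x *\<^sub>R (f' (norm x) *\<^sub>R sgn x))"
          using B by (simp add: C1_bump_def)
        from has_cont_gradient_continuous(1)[OF this, of K] show "continuous_on K ?g" by (intro continuous_on_component)
      qed
      moreover have "(\<lambda>x. indicator K x *\<^sub>R ?g x) = ?g" using K(2) by (intro ext) (auto simp: indicator_def simp del: vector_add_component vector_scaleR_component)
      ultimately have "integrable lborel ?g" by simp
      then show ?thesis using integral_bump_partial_eq_0[OF B, of j] by (simp add: mult.assoc)
    qed
    have dRe: "((\<lambda>r. Re (q r)) has_real_derivative Re (p r)) (at r)" and dIm: "((\<lambda>r. Im (q r)) has_real_derivative Im (p r)) (at r)" if "0 < r" for r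
      using bounded_linear.has_vector_derivative[OF bounded_linear_Re q[OF that]] bounded_linear.has_vector_derivative[OF bounded_linear_Im q[OF that]]
      by (auto simp: has_real_derivative_iff_has_vector_derivative)
    have cRe: "continuous_on {0<..} (\<lambda>r. Re (p r))" and cIm: "continuous_on {0<..} (\<lambda>r. Im (p r))"
      by (intro continuous_intros pc)+
    let ?h = "\<lambda>x. q (norm x) * of_real (D x $ j) + ?P x * of_real (\<phi> x)"
    have hR: "Re (?h x) = Re (q (norm x)) * D x $ j + \<phi> x * (Re (p (norm x)) * sgn x $ j)"
      "Im (?h x) = Im (q (norm x)) * D x $ j + \<phi> x * (Im (p (norm x)) * sgn x $ j)" for x by simp_all
    have hi: "integrable lborel ?h"
    proof -
      have "integrable lborel (\<lambda>x. complex_of_real (Re (?h x)) + \<i> * complex_of_real (Im (?h x)))"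
        unfolding hR
        by (intro Bochner_Integration.integrable_add integrable_of_real integrable_mult_right
              part[THEN conjunct1] dRe cRe dIm cIm)
      then show ?thesis by (simp only: complex_eq[symmetric])
    qed
    have h0: "(LINT x|lborel. ?h x) = 0"
      using part[of "\<lambda>r. Re (q r)" "\<lambda>r. Re (p r)", OF dRe cRe] part[of "\<lambda>r. Im (q r)" "\<lambda>r. Im (p r)", OF dIm cIm]
      unfolding complex_eq_iff integral_Re[OF hi, symmetric] integral_Im[OF hi, symmetric] hR by simp
    have iQD: "integrable lborel (\<lambda>x. Q x * of_real (D x $ j))" by (rule L2_mult_integrable[OF L2Q L2_bump(2)[OF \<phi>]])
    have [measurable]: "(\<lambda>x. D x $ j) \<in> borel_measurable borel"
      using L2_bump(2)[OF \<phi>, of j] unfolding L2_def by (simp add: borel_measurable_complex_iff)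
    have ae: "AE x in lborel. Q x * of_real (D x $ j) = q (norm x) * of_real (D x $ j)" using Qq by eventually_elim simp
    have iqD: "integrable lborel (\<lambda>x. q (norm x) * of_real (D x $ j))"
      using iQD ae by (subst (asm) integrable_cong_AE) auto
    have eqD: "(LINT x|lborel. Q x * of_real (D x $ j)) = (LINT x|lborel. q (norm x) * of_real (D x $ j))"
      using ae by (intro integral_cong_AE) auto
    have iP: "integrable lborel (\<lambda>x. ?P x * of_real (\<phi> x))"
      using Bochner_Integration.integrable_diff[OF hi iqD] by simp
    have "(LINT x|lborel. q (norm x) * of_real (D x $ j)) + (LINT x|lborel. ?P x * of_real (\<phi> x)) = 0"
      using h0 Bochner_Integration.integral_add[OF iqD iP] by simp
    moreover have "(LINT x|lborel. Q x * of_real (D x $ j)) = - (LINT x|lborel. wpd Q j x * of_real (\<phi> x))"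
      by (rule weak_partial_bump[OF wpd_props(2)[OF H] \<phi>])
    moreover have "(LINT x|lborel. (wpd Q j x - ?P x) * of_real (\<phi> x)) = (LINT x|lborel. wpd Q j x * of_real (\<phi> x)) - (LINT x|lborel. ?P x * of_real (\<phi> x))"
      using Bochner_Integration.integral_diff[OF L2_mult_integrable[OF L2w L2_bump(1)[OF \<phi>]] iP] by (simp add: left_diff_distrib)
    ultimately show "(LINT x|lborel. (wpd Q j x - ?P x) * of_real (\<phi> x)) = 0"
      using eqD by (simp add: add_eq_0_iff)
  qed
  moreover have "AE x in lborel. x \<noteq> (0::real^'d)" by (rule AE_lborel_singleton)
  ultimately show ?thesis by eventually_elim auto
qed

section \<open>Integrability of the potential term and the nonlinearity near the origin\<close>

lemma integrable_norm_iff_set: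
  fixes f :: "real \<Rightarrow> real"
  assumes [measurable]: "f \<in> borel_measurable borel"
  shows "integrable (lborel :: (real^'d) measure) (\<lambda>x. f (norm x)) \<longleftrightarrow> set_integrable lborel {0<..} (\<lambda>r. r ^ (CARD('d) - 1) * f r)"
proof -
  have k: "sphere_area TYPE(real^'d) \<noteq> 0" using sphere_area_pos[where 'a="real^'d"] by simp
  have "(\<lambda>r. radial_weight TYPE(real^'d) r *\<^sub>R f r) = (\<lambda>r. sphere_area TYPE(real^'d) * (indicator {0<..} r *\<^sub>R (r ^ (CARD('d) - 1) * f r)))"
    by (auto simp: radial_weight_def fun_eq_iff)
  then show ?thesis using integrable_norm_iff[OF assms, where 'a="real^'d"] k
    unfolding set_integrable_def by (simp only: integrable_mult_left_iff integrable_mult_right_iff) auto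
qed

lemma set_integrable_inverse_sqrt:
  assumes "0 \<le> b" shows "set_integrable lborel {0<..b} (\<lambda>r::real. r powr (-1/2))"
proof -
  have "(\<lambda>r::real. r powr (-1/2)) absolutely_integrable_on {0<..b}"
    by (rule nonnegative_absolutely_integrable_1[OF integrable_on_powr_from_0']) (use assms in auto)
  then show ?thesis unfolding set_integrable_def
    by (subst (asm) integrable_completion) auto
qed

text \<open>The power -1/2, integrable at 0, serves as the common majorant of both singular terms of
  the equation in radial form.\<close>

lemma integrable_radial_local:
  fixes f :: "real \<Rightarrow> real"
  assumes [measurable]: "f \<in> borel_measurable borel" and b: "0 \<le> b"
    and M: "\<And>r. r \<in> {0<..b} \<Longrightarrow> r ^ (CARD('d) - 1) * \<bar>f r\<bar> \<le> M * r powr (-1/2)"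
  shows "integrable (lborel :: (real^'d) measure) (\<lambda>x. indicator {..b} (norm x) * f (norm x))"
proof -
  have "set_integrable lborel {0<..} (\<lambda>r. r ^ (CARD('d) - 1) * (indicator {..b} r * f r))"
    unfolding set_integrable_def
  proof (rule Bochner_Integration.integrable_bound)
    show "integrable lborel (\<lambda>r. M * (indicator {0<..b} r *\<^sub>R r powr (-1/2)))"
      using set_integrable_inverse_sqrt[OF b] unfolding set_integrable_def by (rule integrable_mult_right)
    show "AE r in lborel. norm (indicator {0<..} r *\<^sub>R (r ^ (CARD('d) - 1) * (indicator {..b} r * f r))) \<le> norm (M * (indicator {0<..b} r *\<^sub>R r powr (-1/2)))"
    proof (intro AE_I2)
      fix r :: real
      show "norm (indicator {0<..} r *\<^sub>R (r ^ (CARD('d) - 1) * (indicator {..b} r * f r))) \<le> norm (M * (indicator {0<..b} r *\<^sub>R r powr (-1/2)))"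
      proof (cases "r \<in> {0<..b}")
        case True
        then have "norm (indicator {0<..} r *\<^sub>R (r ^ (CARD('d) - 1) * (indicator {..b} r * f r))) = r ^ (CARD('d) - 1) * \<bar>f r\<bar>"
          by (simp add: abs_mult)
        also have "\<dots> \<le> M * r powr (-1/2)" by (rule M[OF True])
        also have "\<dots> \<le> norm (M * (indicator {0<..b} r *\<^sub>R r powr (-1/2)))" using True by simp
        finally show ?thesis .
      next
        case False then show ?thesis by (auto simp: indicator_def)
      qed
    qed
  qed measurable
  then show ?thesis by (subst integrable_norm_iff_set[of "\<lambda>r. indicator {..b} r * f r"]) auto
qed

text \<open>Only the behaviour at 0 matters: on [1,b] a continuous function multiplied by the square
  root of r is bounded by compactness.\<close>

lemma extend_inverse_sqrt_bound:
  fixes g :: "real \<Rightarrow> real"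
  assumes g: "continuous_on {0<..} g" and M0: "\<And>r. r \<in> {0<..1} \<Longrightarrow> g r \<le> M0 * r powr (-1/2)"
  shows "\<exists>M. \<forall>r\<in>{0<..b}. g r \<le> M * r powr (-1/2)"
proof -
  have "continuous_on {1..max 1 b} (\<lambda>r. g r * r powr (1/2))"
    by (intro continuous_intros continuous_on_subset[OF g]) auto
  then have "compact ((\<lambda>r. g r * r powr (1/2)) ` {1..max 1 b})" by (intro compact_continuous_image) auto
  then obtain M1 where M1: "\<And>r. r \<in> {1..max 1 b} \<Longrightarrow> \<bar>g r * r powr (1/2)\<bar> \<le> M1"
    using compact_imp_bounded by (force simp: bounded_iff)
  have "g r \<le> max M0 M1 * r powr (-1/2)" if r: "r \<in> {0<..b}" for r
  proof (cases "r \<le> 1")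
    case True
    then have "g r \<le> M0 * r powr (-1/2)" using M0 r by auto
    also have "\<dots> \<le> max M0 M1 * r powr (-1/2)" by (intro mult_right_mono) auto
    finally show ?thesis .
  next
    case False
    then have "g r * r powr (1/2) \<le> M1" using M1[of r] r by auto
    then have "g r * r powr (1/2) * r powr (-1/2) \<le> M1 * r powr (-1/2)" by (intro mult_right_mono) auto
    then have "g r \<le> M1 * r powr (-1/2)" using r by (simp add: mult.assoc flip: powr_add)
    also have "\<dots> \<le> max M0 M1 * r powr (-1/2)" by (intro mult_right_mono) auto
    finally show ?thesis .
  qed
  then show ?thesis by blast
qed

text \<open>Insert |q| <= C r^(-(n-1)/2). The potential term becomes r^((n-3)/2), whose exponent is
  at least -1/2 exactly when n >= 2, that is, in dimension at least 3; the nonlinear term keeps a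
  nonnegative exponent.\<close>

lemma profile_singular_bounds:
  fixes q :: "real \<Rightarrow> complex"
  assumes n: "2 \<le> n" and qc: "continuous_on {0<..} q" and C: "\<And>s. s \<in> {0<..1} \<Longrightarrow> cmod (q s) \<le> C / sqrt (s ^ (n - 1))"
  shows "\<exists>M. \<forall>r\<in>{0<..b}. r ^ n * \<bar>cmod (q r) / r\<^sup>2\<bar> \<le> M * r powr (-1/2)"
    and "\<exists>M. \<forall>r\<in>{0<..b}. r ^ n * \<bar>cmod (q r) powr (4 / real (n + 1)) * cmod (q r)\<bar> \<le> M * r powr (-1/2)"
proof -
  have "cmod (q 1) \<le> C" using C[of 1] by simp
  then have C0: "C \<ge> 0" using norm_ge_zero[of "q 1"] by linarith
  have Cp: "cmod (q r) \<le> C * r powr (- (real (n-1) / 2))" if "r \<in> {0<..1}" for r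
  proof -
    have "sqrt (r ^ (n - 1)) = r powr (real (n-1) / 2)"
      using that by (simp add: powr_half_sqrt[symmetric] powr_realpow[symmetric] powr_powr)
    moreover have "C / r powr (real (n-1) / 2) = C * r powr (- (real (n-1) / 2))"
      by (simp only: powr_minus_divide times_divide_eq_right mult_1_right)
    ultimately show ?thesis using C[OF that] by simp
  qed
  show "\<exists>M. \<forall>r\<in>{0<..b}. r ^ n * \<bar>cmod (q r) / r\<^sup>2\<bar> \<le> M * r powr (-1/2)"
  proof (rule extend_inverse_sqrt_bound)
    show "continuous_on {0<..} (\<lambda>r. r ^ n * \<bar>cmod (q r) / r\<^sup>2\<bar>)" by (intro continuous_intros qc) auto
    fix r :: real assume r: "r \<in> {0<..1}"
    have "r ^ n * \<bar>cmod (q r) / r\<^sup>2\<bar> = (r powr real n * r powr (-2)) * cmod (q r)"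
    proof -
      have "r powr (-2) = 1 / r\<^sup>2" using r by (simp add: powr_minus_divide)
      then show ?thesis using r by (simp add: powr_realpow)
    qed
    also have "\<dots> \<le> (r powr real n * r powr (-2)) * (C * r powr (- (real (n-1) / 2)))"
      by (intro mult_left_mono Cp r) auto
    also have "\<dots> = C * r powr (real n - 2 - real (n-1) / 2)" 
    proof -
      have "r powr real n * r powr (-2) * r powr (- (real (n-1) / 2)) = r powr (real n - 2 - real (n-1) / 2)"
        by (simp only: powr_add[symmetric]) simp
      then show ?thesis by (metis mult.assoc mult.left_commute)
    qed
    also have "\<dots> \<le> C * r powr (-1/2)"
    proof (intro mult_left_mono powr_mono' C0)
      have "real n \<ge> 2" using n by simp
      then show "-1/2 \<le> real n - 2 - real (n-1) / 2" using n by (simp add: of_nat_diff field_simps)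
    qed (use r in auto)
    finally show "r ^ n * \<bar>cmod (q r) / r\<^sup>2\<bar> \<le> C * r powr (-1/2)" .
  qed
  define e where "e = 1 + 4 / real (n + 1)"
  have e: "e > 0" by (simp add: e_def add_pos_nonneg)
  have qe: "cmod (q r) powr (4 / real (n + 1)) * cmod (q r) = cmod (q r) powr e" for r
    by (cases "q r = 0") (auto simp: e_def powr_add)
  show "\<exists>M. \<forall>r\<in>{0<..b}. r ^ n * \<bar>cmod (q r) powr (4 / real (n + 1)) * cmod (q r)\<bar> \<le> M * r powr (-1/2)"
  proof (rule extend_inverse_sqrt_bound)
    show "continuous_on {0<..} (\<lambda>r. r ^ n * \<bar>cmod (q r) powr (4 / real (n + 1)) * cmod (q r)\<bar>)"
      by (intro continuous_intros qc continuous_on_powr') auto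
    fix r :: real assume r: "r \<in> {0<..1}"
    have "r ^ n * \<bar>cmod (q r) powr (4 / real (n + 1)) * cmod (q r)\<bar> = r powr real n * cmod (q r) powr e"
      unfolding qe using r by (simp add: powr_realpow)
    also have "\<dots> \<le> r powr real n * (C * r powr (- (real (n-1) / 2))) powr e"
      using e by (intro mult_left_mono powr_mono2 Cp r) auto
    also have "\<dots> = C powr e * r powr (real n - (real (n-1) / 2) * e)"
    proof -
      have "(C * r powr (- (real (n-1) / 2))) powr e = C powr e * r powr (- (real (n-1) / 2) * e)"
        using C0 by (simp add: powr_mult powr_powr)
      moreover have "r powr real n * r powr (- (real (n-1) / 2) * e) = r powr (real n - (real (n-1) / 2) * e)"
        by (simp only: powr_add[symmetric]) simp
      ultimately show ?thesis by (metis mult.left_commute)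
    qed
    also have "\<dots> \<le> C powr e * r powr (-1/2)"
    proof (intro mult_left_mono powr_mono')
      have "real n \<ge> 2" using n by simp
      have "(real n - 1) / 2 * (1 + 4 / (real n + 1)) \<le> real n"
      proof -
        \<comment> \<open>The right side exceeds the left side by (n - 1)^2 + 4.\<close>
        have "(real n - 1) * (real n + 5) \<le> 2 * real n * (real n + 1)"
          using sum_squares_ge_zero[of "real n - 1" 0] by (simp add: algebra_simps)
        then show ?thesis using \<open>real n \<ge> 2\<close> by (simp add: field_simps)
      qed
      moreover have "(real (n-1) / 2) * e = (real n - 1) / 2 * (1 + 4 / (real n + 1))" using n by (simp add: e_def of_nat_diff add.commute)
      moreover have "-1/2 \<le> y - x" if "x \<le> y" for x y :: real using that by simp
      ultimately show "-1/2 \<le> real n - (real (n-1) / 2) * e" by metis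
    qed (use r in auto)
    finally show "r ^ n * \<bar>cmod (q r) powr (4 / real (n + 1)) * cmod (q r)\<bar> \<le> C powr e * r powr (-1/2)" .
  qed
qed

section \<open>From the radial profile to a regular standing wave\<close>

text \<open>The interface to the pseudo-conformal argument, in which radiality no longer appears.
  \<open>loc1\<close> and \<open>loc2\<close> make the singular integrals additive when a complex
  test function is split; continuity off the origin gives pointwise convergence of dilations;
  \<open>nontriv\<close> makes the gradient norm blow up.\<close>

locale standing_wave =
  fixes c \<omega> :: real and f :: "real^'d \<Rightarrow> complex" and g :: "'d \<Rightarrow> real^'d \<Rightarrow> complex"
  assumes L2f: "L2 f" and L2g: "L2 (g j)" and L2xf: "L2 (\<lambda>x. of_real (norm x) * f x)"
    and weak: "has_weak_partial f j (g j)"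
    and eq: "test_fun \<phi> \<Longrightarrow> (\<Sum>j\<in>UNIV. (LINT x|lborel. g j x * of_real (pd \<phi> j x)))
        - of_real c * (LINT x|lborel. of_real (1 / (norm x)^2) * f x * of_real (\<phi> x))
        + of_real \<omega> * (LINT x|lborel. f x * of_real (\<phi> x)) = (LINT x|lborel. nonlin TYPE('d) (f x) * of_real (\<phi> x))"
    and loc1: "integrable lborel (\<lambda>x. indicator (cball 0 R) x *\<^sub>R (of_real (1 / (norm x)^2) * f x))"
    and loc2: "integrable lborel (\<lambda>x. indicator (cball 0 R) x *\<^sub>R nonlin TYPE('d) (f x))"
    and fc: "continuous_on (- {0}) f" and gc: "continuous_on (- {0}) (g j)"
    and nontriv: "\<exists>j. \<not> (AE x in lborel. g j x = 0)"

theorem radial_standing_wave: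
  fixes Q :: "real^'d \<Rightarrow> complex"
  assumes d: "CARD('d) \<ge> 3" and \<omega>: "\<omega> > 0" and H: "H1 Q" and rad: "radial Q" and ge: "ground_eq c \<omega> Q"
    and nz: "\<not> (AE x in lborel. Q x = 0)"
  shows "\<exists>f g. standing_wave c \<omega> f g \<and> (AE x in lborel. Q x = f x) \<and> (\<forall>j. AE x in lborel. wpd Q j x = g j x)"
proof -
  obtain q p where qm[measurable]: "q \<in> borel_measurable borel" and pm[measurable]: "p \<in> borel_measurable borel"
    and pc: "continuous_on {0<..} p" and Qq: "AE x in lborel. Q x = q (norm x)"
    and qd: "\<And>r. 0 < r \<Longrightarrow> (q has_vector_derivative p r) (at r)"
    and pd: "\<And>r. 0 < r \<Longrightarrow> ((\<lambda>r. r ^ (CARD('d) - 1) *\<^sub>R p r) has_vector_derivative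
        r ^ (CARD('d) - 1) *\<^sub>R profile_rhs (real CARD('d)) c \<omega> q r) (at r)"
    using radial_profile_regular[OF H rad ge] by blast
  define n where "n = CARD('d) - 1"
  have n: "2 \<le> n" "CARD('d) = n + 1" using d by (auto simp: n_def)
  have qc: "continuous_on {0<..} q"
    using qd by (meson continuous_at_imp_continuous_on greaterThan_iff has_vector_derivative_continuous)
  define f where "f x = q (norm x)" for x :: "real^'d"
  define g where "g j x = p (norm x) * of_real (sgn x $ j)" for j and x :: "real^'d"
  have [measurable]: "(\<lambda>x::real^'d. sgn x $ j) \<in> borel_measurable borel" for j by (simp add: sgn_div_norm)
  have [measurable]: "f \<in> borel_measurable borel" "g j \<in> borel_measurable borel" for j unfolding f_def g_def by measurable
  have L2Q: "L2 Q" using H by (simp add: H1_def)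
  have [measurable]: "Q \<in> borel_measurable borel" "wpd Q j \<in> borel_measurable borel" for j
    using L2Q wpd_props(1)[OF H, of j] by (auto simp: L2_def)
  have Qf: "AE x in lborel. Q x = f x" using Qq by (simp add: f_def)
  have wg: "AE x in lborel. wpd Q j x = g j x" for j unfolding g_def by (rule wpd_radial[OF H Qq qm pm qd pc])
  have L2f: "L2 f"
  proof -
    have "integrable lborel (\<lambda>x. (cmod (Q x))\<^sup>2)" using L2Q by (simp add: L2_def)
    moreover have "AE x in lborel. (cmod (Q x))\<^sup>2 = (cmod (f x))\<^sup>2" using Qf by eventually_elim simp
    ultimately show ?thesis unfolding L2_def by (subst (asm) integrable_cong_AE) auto
  qed
  have L2g: "L2 (g j)" for j
  proof -
    have "integrable lborel (\<lambda>x. (cmod (wpd Q j x))\<^sup>2)" using wpd_props(1)[OF H, of j] by (simp add: L2_def)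
    moreover have "AE x in lborel. (cmod (wpd Q j x))\<^sup>2 = (cmod (g j x))\<^sup>2" using wg[of j] by eventually_elim simp
    ultimately show ?thesis unfolding L2_def by (subst (asm) integrable_cong_AE) auto
  qed
  have iq: "set_integrable lborel {0<..} (\<lambda>r. r ^ n * (cmod (q r))\<^sup>2)"
    using L2f integrable_norm_iff_set[of "\<lambda>r. (cmod (q r))\<^sup>2", where 'd='d] by (simp add: L2_def f_def n_def)
  have ip: "set_integrable lborel {0<..} (\<lambda>r. r ^ n * (cmod (p r))\<^sup>2)"
  proof -
    have "integrable lborel (\<lambda>x. \<Sum>j\<in>UNIV. (cmod (g j x))\<^sup>2)"
      using L2g by (intro Bochner_Integration.integrable_sum) (auto simp: L2_def)
    \<comment> \<open>Off the origin \<open>sgn x\<close> is a unit vector, so the squared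
      components of the gradient sum to |p|^2.\<close>
    moreover have "AE x in lborel. (\<Sum>j\<in>UNIV. (cmod (g j x))\<^sup>2) = (cmod (p (norm x)))\<^sup>2"
      using AE_lborel_singleton[of "0::real^'d"]
    proof eventually_elim
      case (elim x)
      have "(\<Sum>j\<in>UNIV. (sgn x $ j)\<^sup>2) = (norm (sgn x))\<^sup>2"
        unfolding power2_norm_eq_inner inner_vec_def by (simp add: power2_eq_square)
      also have "\<dots> = 1" using elim by (simp add: norm_sgn)
      finally show ?case by (simp add: g_def norm_mult power_mult_distrib sum_distrib_left[symmetric])
    qed
    ultimately have "integrable (lborel :: (real^'d) measure) (\<lambda>x. (cmod (p (norm x)))\<^sup>2)"
      by (subst (asm) integrable_cong_AE) auto
    then show ?thesis
      using integrable_norm_iff_set[of "\<lambda>r. (cmod (p r))\<^sup>2", where 'd='d] by (simp add: n_def)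
  qed
  have L2xf: "L2 (\<lambda>x. of_real (norm x) * f x)"
  proof -
    \<comment> \<open>Below R the factor r^2 is at most R^2 and the L2 norm suffices; above R the
      decay estimate applies.\<close>
    obtain R where R: "R > 0" "set_integrable lborel {R..} (\<lambda>r. r\<^sup>2 * (r ^ n * (cmod (q r))\<^sup>2))"
      using profile_decay[of "real CARD('d)" \<omega> q p n c] \<omega> qd pd pc ip iq unfolding n_def by auto
    have "set_integrable lborel {0<..} (\<lambda>r. r ^ n * (r\<^sup>2 * (cmod (q r))\<^sup>2))"
      unfolding set_integrable_def
    proof (rule Bochner_Integration.integrable_bound)
      show "integrable lborel (\<lambda>r. R\<^sup>2 * (indicator {0<..} r *\<^sub>R (r ^ n * (cmod (q r))\<^sup>2)) + indicator {R..} r *\<^sub>R (r\<^sup>2 * (r ^ n * (cmod (q r))\<^sup>2)))"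
        using iq R(2) unfolding set_integrable_def by (intro Bochner_Integration.integrable_add integrable_mult_right)
      show "AE r in lborel. norm (indicator {0<..} r *\<^sub>R (r ^ n * (r\<^sup>2 * (cmod (q r))\<^sup>2))) \<le>
          norm (R\<^sup>2 * (indicator {0<..} r *\<^sub>R (r ^ n * (cmod (q r))\<^sup>2)) + indicator {R..} r *\<^sub>R (r\<^sup>2 * (r ^ n * (cmod (q r))\<^sup>2)))"
      proof (intro AE_I2)
        fix r :: real
        consider "r \<le> 0" | "0 < r" "r < R" | "R \<le> r" "0 < r" by linarith
        then show "norm (indicator {0<..} r *\<^sub>R (r ^ n * (r\<^sup>2 * (cmod (q r))\<^sup>2))) \<le>
          norm (R\<^sup>2 * (indicator {0<..} r *\<^sub>R (r ^ n * (cmod (q r))\<^sup>2)) + indicator {R..} r *\<^sub>R (r\<^sup>2 * (r ^ n * (cmod (q r))\<^sup>2)))"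
        proof cases
          case 1 then show ?thesis by simp
        next
          case 2
          then have "r\<^sup>2 \<le> R\<^sup>2" by (intro power_mono) auto
          then have "r\<^sup>2 * (r ^ n * (cmod (q r))\<^sup>2) \<le> R\<^sup>2 * (r ^ n * (cmod (q r))\<^sup>2)" using 2 by (intro mult_right_mono) auto
          then show ?thesis using 2 by (simp add: abs_mult mult_ac)
        next
          case 3
          have "0 \<le> R\<^sup>2 * (r ^ n * (cmod (q r))\<^sup>2)" "0 \<le> r\<^sup>2 * (r ^ n * (cmod (q r))\<^sup>2)" using 3 by auto
          then show ?thesis using 3 by (simp add: abs_mult mult_ac)
        qed
      qed
    qed measurable
    then show ?thesis
      using integrable_norm_iff_set[of "\<lambda>r. r\<^sup>2 * (cmod (q r))\<^sup>2", where 'd='d]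
      by (simp add: L2_def f_def n_def norm_mult power_mult_distrib)
  qed
  \<comment> \<open>The energy limits the growth of the profile at the origin, which makes both
    singular terms locally integrable in space.\<close>
  obtain C where C: "\<And>s. s \<in> {0<..1} \<Longrightarrow> cmod (q s) \<le> C / sqrt (s ^ (n - 1))"
    using profile_bound_origin[OF n(1) qd pc ip] by blast
  have loc: "integrable lborel (\<lambda>x::real^'d. indicator (cball 0 R) x *\<^sub>R h x)"
    if [measurable]: "h \<in> borel_measurable borel" "k \<in> borel_measurable borel" and hk: "\<And>x. cmod (h x) = \<bar>k (norm x)\<bar>"
      and M: "\<forall>r\<in>{0<..max R 0}. r ^ n * \<bar>k r\<bar> \<le> M * r powr (-1/2)" for h :: "real^'d \<Rightarrow> complex" and k R M
  proof -
    have "integrable (lborel :: (real^'d) measure) (\<lambda>x. indicator {..max R 0} (norm x) * k (norm x))"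
      by (rule integrable_radial_local[of k "max R 0" M]) (use M in \<open>auto simp: n_def\<close>)
    then show ?thesis
    proof (rule Bochner_Integration.integrable_bound)
      show "AE x in lborel. norm (indicator (cball 0 R) x *\<^sub>R h x) \<le> norm (indicator {..max R 0} (norm x) * k (norm x))"
        by (intro AE_I2) (auto simp: indicator_def hk)
      show "(\<lambda>x. indicator (cball 0 R) x *\<^sub>R h x) \<in> borel_measurable lborel"
        using that(1) by (intro borel_measurable_scaleR borel_measurable_indicator) auto
    qed
  qed
  have loc1: "integrable lborel (\<lambda>x. indicator (cball 0 R) x *\<^sub>R (of_real (1 / (norm x)^2) * f x))" for R
  proof -
    obtain M where M: "\<forall>r\<in>{0<..max R 0}. r ^ n * \<bar>cmod (q r) / r\<^sup>2\<bar> \<le> M * r powr (-1/2)"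
      using profile_singular_bounds(1)[OF n(1) qc C] by blast
    show ?thesis by (rule loc[OF _ _ _ M]) (auto simp: f_def norm_mult norm_divide norm_power)
  qed
  have nlm: "(\<lambda>x. nonlin TYPE('d) (f x)) \<in> borel_measurable borel" unfolding nonlin_def by measurable
  have loc2: "integrable lborel (\<lambda>x. indicator (cball 0 R) x *\<^sub>R nonlin TYPE('d) (f x))" for R
  proof -
    obtain M where M: "\<forall>r\<in>{0<..max R 0}. r ^ n * \<bar>cmod (q r) powr (4 / real (n + 1)) * cmod (q r)\<bar> \<le> M * r powr (-1/2)"
      using profile_singular_bounds(2)[OF n(1) qc C] by blast
    show ?thesis by (rule loc[OF nlm _ _ M]) (auto simp: f_def norm_mult nonlin_def n(2))
  qed
  have "standing_wave c \<omega> f g"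
  proof
    show "L2 f" "L2 (g j)" "L2 (\<lambda>x. of_real (norm x) * f x)" for j by fact+
    have cong: "(LINT x|lborel. u x * of_real (\<phi> x)) = (LINT x|lborel. v x * of_real (\<phi> x))"
      if "AE x in lborel. u x = v x" "u \<in> borel_measurable borel" "v \<in> borel_measurable borel" "\<phi> \<in> borel_measurable borel"
      for u v :: "real^'d \<Rightarrow> complex" and \<phi> :: "real^'d \<Rightarrow> real"
    proof (rule integral_cong_AE)
      note [measurable] = that(2-4)
      show "(\<lambda>x. u x * of_real (\<phi> x)) \<in> borel_measurable lborel" "(\<lambda>x. v x * of_real (\<phi> x)) \<in> borel_measurable lborel" by measurable
      show "AE x in lborel. u x * of_real (\<phi> x) = v x * of_real (\<phi> x)" using that(1) by eventually_elim simp
    qed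
    have meas: "\<phi> \<in> borel_measurable borel" "(\<lambda>x. pd \<phi> j x) \<in> borel_measurable borel" if "test_fun \<phi>" for \<phi> :: "real^'d \<Rightarrow> real" and j
    proof -
      obtain D where D: "C1_bump UNIV \<phi> D" using test_fun_imp_bump[OF \<open>test_fun \<phi>\<close>] by blast
      then have "has_cont_gradient \<phi> D" by (simp add: C1_bump_def)
      note c = has_cont_gradient_measurable(1)[OF this] has_cont_gradient_continuous(1)[OF this]
      show "\<phi> \<in> borel_measurable borel" by fact
      show "(\<lambda>x. pd \<phi> j x) \<in> borel_measurable borel" unfolding pd_eq_bump[OF D]
        by (intro borel_measurable_continuous_onI continuous_on_component c)
    qed
    show "has_weak_partial f j (g j)" for j
      unfolding has_weak_partial_def
    proof (intro allI impI)
      fix \<phi> :: "real^'d \<Rightarrow> real" assume t: "test_fun \<phi>"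
      have "(LINT x|lborel. Q x * of_real (pd \<phi> j x)) = - (LINT x|lborel. wpd Q j x * of_real (\<phi> x))"
        using wpd_props(2)[OF H, of j] t unfolding has_weak_partial_def by blast
      then show "(LINT x|lborel. f x * of_real (pd \<phi> j x)) = - (LINT x|lborel. g j x * of_real (\<phi> x))"
        using cong[OF Qf _ _ meas(2)[OF t]] cong[OF wg _ _ meas(1)[OF t]] by simp
    qed
    show "(\<Sum>j\<in>UNIV. (LINT x|lborel. g j x * of_real (pd \<phi> j x)))
        - of_real c * (LINT x|lborel. of_real (1 / (norm x)^2) * f x * of_real (\<phi> x))
        + of_real \<omega> * (LINT x|lborel. f x * of_real (\<phi> x)) = (LINT x|lborel. nonlin TYPE('d) (f x) * of_real (\<phi> x))"
      if t: "test_fun \<phi>" for \<phi>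
    proof -
      have "op_pair c Q \<phi> + of_real \<omega> * (LINT x|lborel. Q x * of_real (\<phi> x)) = (LINT x|lborel. nonlin TYPE('d) (Q x) * of_real (\<phi> x))"
        using ge t unfolding ground_eq_def by blast
      moreover have "(LINT x|lborel. wpd Q j x * of_real (pd \<phi> j x)) = (LINT x|lborel. g j x * of_real (pd \<phi> j x))" for j
        by (rule cong[OF wg _ _ meas(2)[OF t]]) auto
      moreover have "(LINT x|lborel. Q x * of_real (\<phi> x)) = (LINT x|lborel. f x * of_real (\<phi> x))"
        by (rule cong[OF Qf _ _ meas(1)[OF t]]) auto
      moreover have "(LINT x|lborel. of_real (1 / (norm x)^2) * Q x * of_real (\<phi> x)) = (LINT x|lborel. of_real (1 / (norm x)^2) * f x * of_real (\<phi> x))"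
        by (rule cong[OF _ _ _ meas(1)[OF t]]) (use Qf in \<open>auto elim: eventually_mono\<close>)
      moreover have "(LINT x|lborel. nonlin TYPE('d) (Q x) * of_real (\<phi> x)) = (LINT x|lborel. nonlin TYPE('d) (f x) * of_real (\<phi> x))"
      proof (rule cong[OF _ _ nlm meas(1)[OF t]])
        show "AE x in lborel. nonlin TYPE('d) (Q x) = nonlin TYPE('d) (f x)" using Qf by eventually_elim simp
        show "(\<lambda>x. nonlin TYPE('d) (Q x)) \<in> borel_measurable borel" unfolding nonlin_def by measurable
      qed
      ultimately show ?thesis unfolding op_pair_def by (simp only:)
    qed
    show "continuous_on (- {0}) f" unfolding f_def by (intro continuous_on_compose2[OF qc] continuous_intros) auto
    show "continuous_on (- {0}) (g j)" for j unfolding g_def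
      by (intro continuous_intros continuous_on_compose2[OF pc]) auto
    \<comment> \<open>With vanishing gradient the profile would be constant on the half line; a
      nonzero constant is not square integrable, and the constant 0 is excluded by
      \<open>nz\<close>.\<close>
    show "\<exists>j. \<not> (AE x in lborel. g j x = 0)"
    proof (rule ccontr)
      assume "\<not> (\<exists>j. \<not> (AE x in lborel. g j x = 0))"
      then have g0: "AE x in lborel. \<forall>j. g j x = 0" by (simp add: AE_all_countable)
      have "AE x in (lborel :: (real^'d) measure). p (norm x) = 0"
        using g0 AE_lborel_singleton[of "0::real^'d"]
      proof eventually_elim
        case (elim x)
        obtain j where "x $ j \<noteq> 0" using elim(2) by (metis vec_eq_iff zero_index)
        then have "sgn x $ j \<noteq> 0" using elim(2) by (simp add: sgn_div_norm)
        then show ?case using elim(1) by (auto simp: g_def)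
      qed
      then have p0: "AE r in lborel. 0 < r \<longrightarrow> p r = 0" by (subst (asm) AE_norm_iff) auto
      have qconst: "q a = q b" if ab: "0 < a" "a \<le> b" for a b
      proof -
        have "(p has_integral (q b - q a)) {a..b}"
        proof (rule fundamental_theorem_of_calculus[where f=q and f'=p, OF ab(2)])
          fix r assume "r \<in> {a..b}"
          then show "(q has_vector_derivative p r) (at r within {a..b})"
            using ab by (auto intro: has_vector_derivative_at_within[OF qd])
        qed
        moreover have "set_integrable lborel {a..b} p"
          by (rule borel_integrable_atLeastAtMost') (rule continuous_on_subset[OF pc], use ab in auto)
        ultimately have "q b - q a = (LINT r:{a..b}|lborel. p r)"
          using set_borel_integral_eq_integral(2) integral_unique by metis
        also have "\<dots> = (LINT r|(lborel :: real measure). 0)" unfolding set_lebesgue_integral_def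
          by (rule integral_cong_AE) (use p0 ab in \<open>auto elim!: eventually_mono simp: indicator_def\<close>)
        finally show ?thesis by simp
      qed
      have q1: "q r = q 1" if "0 < r" for r using qconst[of r 1] qconst[of 1 r] that by (cases "r \<le> 1") auto
      have q10: "q 1 = 0"
      proof (rule ccontr)
        assume q1n: "q 1 \<noteq> 0"
        have "integrable (lborel :: (real^'d) measure) (\<lambda>x. (cmod (q 1))\<^sup>2)"
        proof -
          have "AE x in (lborel :: (real^'d) measure). (cmod (f x))\<^sup>2 = (cmod (q 1))\<^sup>2"
            using AE_lborel_singleton[of "0::real^'d"]
          proof eventually_elim
            case (elim x) then show ?case using q1[of "norm x"] by (simp add: f_def)
          qed
          moreover have "integrable lborel (\<lambda>x. (cmod (f x))\<^sup>2)" using L2f by (simp add: L2_def)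
          ultimately show ?thesis by (subst (asm) integrable_cong_AE) auto
        qed
        then have "(\<integral>\<^sup>+x. ennreal ((cmod (q 1))\<^sup>2) \<partial>(lborel :: (real^'d) measure)) < \<infinity>"
          by (simp add: integrable_iff_bounded)
        then show False using q1n by (simp add: ennreal_mult_top)
      qed
      have "AE x in lborel. Q x = 0"
        using Qq AE_lborel_singleton[of "0::real^'d"]
      proof eventually_elim
        case (elim x) then show ?case using q1[of "norm x"] q10 by simp
      qed
      with nz show False by simp
    qed
  qed (use loc1 loc2 in auto)
  then show ?thesis using Qf wg by blast
qed

section \<open>Convergence and differentiation of integrals\<close>

lemma lborel_scale:
  fixes F :: "'a::euclidean_space \<Rightarrow> 'b::{banach, second_countable_topology}"
  assumes [measurable]: "F \<in> borel_measurable borel" and m: "0 < m"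
  shows "integrable lborel (\<lambda>x. F (m *\<^sub>R x)) \<longleftrightarrow> integrable lborel F"
    and "(LINT x|lborel. F x) = (m ^ DIM('a)) *\<^sub>R (LINT x|lborel. F (m *\<^sub>R x))"
proof -
  have l: "lborel = density (distr lborel borel (\<lambda>x::'a. m *\<^sub>R x)) (\<lambda>_. ennreal (m ^ DIM('a)))"
    using lborel_affine[of m "0::'a"] m by simp
  have "integrable (density (distr lborel borel (\<lambda>x::'a. m *\<^sub>R x)) (\<lambda>_. ennreal (m ^ DIM('a)))) F \<longleftrightarrow> integrable lborel (\<lambda>x. F (m *\<^sub>R x))"
  proof -
    have "integrable (density (distr lborel borel (\<lambda>x::'a. m *\<^sub>R x)) (\<lambda>_. ennreal (m ^ DIM('a)))) F \<longleftrightarrow> integrable lborel (\<lambda>x. (m ^ DIM('a)) *\<^sub>R F (m *\<^sub>R x))"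
      using m by (subst integrable_density) (auto simp: integrable_distr_eq)
    moreover have "integrable lborel (\<lambda>x. F (m *\<^sub>R x))" if "integrable lborel (\<lambda>x. (m ^ DIM('a)) *\<^sub>R F (m *\<^sub>R x))"
      using integrable_scaleR_right[OF that, of "1 / m ^ DIM('a)"] m by simp
    ultimately show ?thesis by auto
  qed
  then show "integrable lborel (\<lambda>x. F (m *\<^sub>R x)) \<longleftrightarrow> integrable lborel F" using l by simp
  have "(LINT x|density (distr lborel borel (\<lambda>x::'a. m *\<^sub>R x)) (\<lambda>_. ennreal (m ^ DIM('a))). F x) = (m ^ DIM('a)) *\<^sub>R (LINT x|lborel. F (m *\<^sub>R x))"
    using m by (subst integral_density) (auto simp: integral_distr)
  then show "(LINT x|lborel. F x) = (m ^ DIM('a)) *\<^sub>R (LINT x|lborel. F (m *\<^sub>R x))" using l by simp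
qed

lemma weak_partial_unique:
  fixes u :: "real^'d \<Rightarrow> complex"
  assumes g: "L2 g1" "L2 g2" and w: "has_weak_partial u j g1" "has_weak_partial u j g2"
  shows "AE x in lborel. g1 x = g2 x"
proof -
  have "AE x in lborel. x \<in> UNIV \<longrightarrow> g1 x - g2 x = 0"
  proof (rule fundamental_lemma)
    fix a b :: "real^'d"
    have "L2 (\<lambda>x::real^'d. of_real (indicator (cbox a b) x))"
    proof -
      obtain R where R: "\<And>x. x \<in> cbox a b \<Longrightarrow> norm x \<le> R" using bounded_cbox[of a b] by (auto simp: bounded_iff)
      show ?thesis by (rule L2_bounded_compact[where M=1 and R=R]) (use R in \<open>auto simp: indicator_def split: if_splits dest: leD\<close>)
    qed
    from L2_mult_integrable[OF g(1) this] L2_mult_integrable[OF g(2) this]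
    have "set_integrable lborel (cbox a b) g1" "set_integrable lborel (cbox a b) g2"
      by (simp_all add: set_integrable_def scaleR_conv_of_real mult.commute)
    then show "set_integrable lborel (cbox a b) (\<lambda>x. g1 x - g2 x)" by (rule set_integral_diff)
  next
    fix \<phi> D assume \<phi>: "C1_bump (UNIV :: (real^'d) set) \<phi> D"
    show "(LINT x|lborel. (g1 x - g2 x) * of_real (\<phi> x)) = 0"
      using weak_partial_bump[OF w(1) \<phi>] weak_partial_bump[OF w(2) \<phi>]
        Bochner_Integration.integral_diff[OF L2_mult_integrable[OF g(1) L2_bump(1)[OF \<phi>]] L2_mult_integrable[OF g(2) L2_bump(1)[OF \<phi>]]]
      by (simp add: left_diff_distrib)
  qed simp
  then show ?thesis by eventually_elim simp
qed

text \<open>\<open>wpd\<close> is an arbitrary choice among the weak partials, known only up to null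
  sets; explicit gradients enter through uniqueness.\<close>

lemma H1_wpd_rep:
  fixes u :: "real^'d \<Rightarrow> complex"
  assumes "L2 u" "\<And>j. L2 (g j)" "\<And>j. has_weak_partial u j (g j)"
  shows "H1 u" "AE x in lborel. wpd u j x = g j x"
proof -
  show H: "H1 u" unfolding H1_def using assms by blast
  show "AE x in lborel. wpd u j x = g j x"
    by (rule weak_partial_unique[OF wpd_props(1)[OF H] assms(2) wpd_props(2)[OF H] assms(3)])
qed

text \<open>The second function may be exchanged for an a.e. equal representative \<open>w\<close>,
  as \<open>Q\<close> agrees only almost everywhere with the function that is continuous off the
  origin.\<close>

lemma H1_dist_rep:
  fixes u v :: "real^'d \<Rightarrow> complex"
  assumes m: "u \<in> borel_measurable borel" "v \<in> borel_measurable borel" "w \<in> borel_measurable borel" and "AE x in lborel. v x = w x"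
    and u: "\<And>j. AE x in lborel. wpd u j x = g j x" and v: "\<And>j. AE x in lborel. wpd v j x = k j x"
    and L: "\<And>j. L2 (wpd u j)" "\<And>j. L2 (wpd v j)" "\<And>j. L2 (g j)" "\<And>j. L2 (k j)"
  shows "H1_dist u v = sqrt ((LINT x|lborel. (cmod (u x - w x))^2) + (\<Sum>j\<in>UNIV. (LINT x|lborel. (cmod (g j x - k j x))^2)))"
proof -
  note [measurable] = m
  have [measurable]: "wpd u j \<in> borel_measurable borel" "wpd v j \<in> borel_measurable borel" "g j \<in> borel_measurable borel" "k j \<in> borel_measurable borel" for j
    using L[of j] by (auto simp: L2_def)
  have "(LINT x|lborel. (cmod (u x - v x))^2) = (LINT x|lborel. (cmod (u x - w x))^2)"
    using assms(4) by (intro integral_cong_AE) auto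
  moreover have "(LINT x|lborel. (cmod (wpd u j x - wpd v j x))^2) = (LINT x|lborel. (cmod (g j x - k j x))^2)" for j
  proof (rule integral_cong_AE)
    show "AE x in lborel. (cmod (wpd u j x - wpd v j x))^2 = (cmod (g j x - k j x))^2"
      using u[of j] v[of j] by eventually_elim simp
  qed auto
  ultimately show ?thesis unfolding H1_dist_def by simp
qed

text \<open>Scheffe's lemma turns convergence of the norms into L1 convergence of |F_n|^2 to |G|^2.
  With N the modulus of their difference, |F_n - G|^2 <= 4 |G|^2 + 2 N, so the positive part of |F_n
  - G|^2 - 2 N is dominated and its integral tends to 0.\<close>

lemma L2_convergence:
  fixes F :: "nat \<Rightarrow> real^'d \<Rightarrow> complex"
  assumes F: "\<And>n. L2 (F n)" and G: "L2 G" and ae: "AE x in lborel. (\<lambda>n. F n x) \<longlonglongrightarrow> G x"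
    and nrm: "(\<lambda>n. LINT x|lborel. (cmod (F n x))\<^sup>2) \<longlonglongrightarrow> (LINT x|lborel. (cmod (G x))\<^sup>2)"
  shows "(\<lambda>n. LINT x|lborel. (cmod (F n x - G x))\<^sup>2) \<longlonglongrightarrow> 0"
proof -
  have [measurable]: "F n \<in> borel_measurable borel" "G \<in> borel_measurable borel" for n
    using F[of n] G by (auto simp: L2_def)
  have iF: "integrable lborel (\<lambda>x. (cmod (F n x))\<^sup>2)" for n using F[of n] by (simp add: L2_def)
  have iG: "integrable lborel (\<lambda>x. (cmod (G x))\<^sup>2)" using G by (simp add: L2_def)
  have sq: "(cmod (a - b))\<^sup>2 \<le> 2 * (cmod a)\<^sup>2 + 2 * (cmod b)\<^sup>2" for a b :: complex
  proof -
    have "(cmod (a - b))\<^sup>2 \<le> (cmod a + cmod b)\<^sup>2" by (intro power_mono norm_triangle_ineq4) auto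
    also have "\<dots> \<le> 2 * (cmod a)\<^sup>2 + 2 * (cmod b)\<^sup>2"
      using sum_squares_bound[of "cmod a" "cmod b"] by (simp add: power2_sum)
    finally show ?thesis .
  qed
  define D where "D n x = (cmod (F n x - G x))\<^sup>2" for n x
  have iD: "integrable lborel (D n)" for n
  proof (rule Bochner_Integration.integrable_bound)
    show "integrable lborel (\<lambda>x. 2 * (cmod (F n x))\<^sup>2 + 2 * (cmod (G x))\<^sup>2)" using iF iG by auto
    show "AE x in lborel. norm (D n x) \<le> norm (2 * (cmod (F n x))\<^sup>2 + 2 * (cmod (G x))\<^sup>2)"
      using sq by (intro AE_I2) (simp add: D_def)
    show "D n \<in> borel_measurable lborel" unfolding D_def by measurable
  qed
  have S: "(\<lambda>n. \<integral>\<^sup>+x. norm ((cmod (F n x))\<^sup>2 - (cmod (G x))\<^sup>2) \<partial>lborel) \<longlonglongrightarrow> 0"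
  proof (rule Scheffe_lemma1)
    show "AE x in lborel. (\<lambda>n. (cmod (F n x))\<^sup>2) \<longlonglongrightarrow> (cmod (G x))\<^sup>2"
      using ae by eventually_elim (intro tendsto_intros)
    have e: "(\<integral>\<^sup>+x. norm ((cmod (F n x))\<^sup>2) \<partial>lborel) = ennreal (LINT x|lborel. (cmod (F n x))\<^sup>2)" for n
      using nn_integral_eq_integral[OF iF[of n]] by simp
    have "(\<lambda>n. ennreal (LINT x|lborel. (cmod (F n x))\<^sup>2)) \<longlonglongrightarrow> ennreal (LINT x|lborel. (cmod (G x))\<^sup>2)"
      by (rule tendsto_ennrealI[OF nrm])
    then have "limsup (\<lambda>n. ennreal (LINT x|lborel. (cmod (F n x))\<^sup>2)) = ennreal (LINT x|lborel. (cmod (G x))\<^sup>2)"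
      by (intro lim_imp_Limsup) auto
    then show "limsup (\<lambda>n. \<integral>\<^sup>+x. norm ((cmod (F n x))\<^sup>2) \<partial>lborel) \<le> (\<integral>\<^sup>+x. norm ((cmod (G x))\<^sup>2) \<partial>lborel)"
      unfolding e using nn_integral_eq_integral[OF iG] by simp
  qed (use iF iG in auto)
  define N where "N n x = \<bar>(cmod (F n x))\<^sup>2 - (cmod (G x))\<^sup>2\<bar>" for n x
  have iN: "integrable lborel (N n)" for n unfolding N_def using iF iG by (intro integrable_abs Bochner_Integration.integrable_diff)
  have N0: "(\<lambda>n. LINT x|lborel. N n x) \<longlonglongrightarrow> 0"
  proof -
    have "(\<integral>\<^sup>+x. norm ((cmod (F n x))\<^sup>2 - (cmod (G x))\<^sup>2) \<partial>lborel) = ennreal (LINT x|lborel. N n x)" for n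
      using nn_integral_eq_integral[OF iN[of n]] by (simp add: N_def[abs_def])
    then have "(\<lambda>n. ennreal (LINT x|lborel. N n x)) \<longlonglongrightarrow> ennreal 0" using S by simp
    then show ?thesis by (subst (asm) tendsto_ennreal_iff) (auto intro!: always_eventually simp: N_def[abs_def])
  qed
  have P0: "(\<lambda>n. LINT x|lborel. max 0 (D n x - 2 * N n x)) \<longlonglongrightarrow> (LINT x|(lborel :: (real^'d) measure). 0)"
  proof (rule integral_dominated_convergence[where w="\<lambda>x. 4 * (cmod (G x))\<^sup>2"])
    show "AE x in lborel. (\<lambda>n. max 0 (D n x - 2 * N n x)) \<longlonglongrightarrow> 0"
      using ae
    proof eventually_elim
      case (elim x)
      have "(\<lambda>n. max 0 ((cmod (F n x - G x))\<^sup>2 - 2 * \<bar>(cmod (F n x))\<^sup>2 - (cmod (G x))\<^sup>2\<bar>)) \<longlonglongrightarrow> max 0 ((cmod (G x - G x))\<^sup>2 - 2 * \<bar>(cmod (G x))\<^sup>2 - (cmod (G x))\<^sup>2\<bar>)"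
        by (intro tendsto_intros elim)
      then show ?case by (simp add: D_def N_def)
    qed
    show "AE x in lborel. norm (max 0 (D n x - 2 * N n x)) \<le> 4 * (cmod (G x))\<^sup>2" for n
    proof (intro AE_I2)
      fix x
      have "D n x \<le> 2 * (cmod (F n x))\<^sup>2 + 2 * (cmod (G x))\<^sup>2" using sq by (simp add: D_def)
      moreover have "(cmod (F n x))\<^sup>2 \<le> (cmod (G x))\<^sup>2 + N n x" by (simp add: N_def)
      moreover have "0 \<le> (cmod (G x))\<^sup>2" by simp
      ultimately show "norm (max 0 (D n x - 2 * N n x)) \<le> 4 * (cmod (G x))\<^sup>2" by (auto simp: max_def)
    qed
    show "integrable lborel (\<lambda>x. 4 * (cmod (G x))\<^sup>2)" using iG by auto
  qed (auto simp: D_def N_def)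
  have iP: "integrable lborel (\<lambda>x. max 0 (D n x - 2 * N n x))" for n
    using iD[of n] iN[of n] by (intro Bochner_Integration.integrable_max) auto
  have bound: "(LINT x|lborel. D n x) \<le> (LINT x|lborel. max 0 (D n x - 2 * N n x)) + 2 * (LINT x|lborel. N n x)" for n
  proof -
    have "(LINT x|lborel. D n x) \<le> (LINT x|lborel. max 0 (D n x - 2 * N n x) + 2 * N n x)"
      using iD iP iN by (intro integral_mono) auto
    then show ?thesis using iP[of n] iN[of n] by simp
  qed
  have "(\<lambda>n. LINT x|lborel. D n x) \<longlonglongrightarrow> 0"
  proof (rule tendsto_sandwich[where f="\<lambda>_. 0"])
    show "(\<lambda>n. (LINT x|lborel. max 0 (D n x - 2 * N n x)) + 2 * (LINT x|lborel. N n x)) \<longlonglongrightarrow> 0"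
      using tendsto_add[OF P0 tendsto_mult[OF tendsto_const[of 2] N0]] by simp
    show "\<forall>\<^sub>F n in sequentially. 0 \<le> (LINT x|lborel. D n x)" by (intro always_eventually allI integral_nonneg_AE) (simp add: D_def)
  qed (use bound in auto)
  then show ?thesis by (simp add: D_def)
qed

section \<open>Differentiation under the integral sign\<close>

text \<open>The sequential form is the one to which dominated convergence applies.\<close>

lemma has_vector_derivative_sequentially:
  fixes Z :: "real \<Rightarrow> 'a::real_normed_vector"
  assumes "\<And>X. (\<And>n. X n \<noteq> t) \<Longrightarrow> X \<longlonglongrightarrow> t \<Longrightarrow> (\<lambda>n. (Z (X n) - Z t) /\<^sub>R (X n - t)) \<longlonglongrightarrow> D"
  shows "(Z has_vector_derivative D) (at t)"
proof -
  have "((\<lambda>s. (Z s - Z t) /\<^sub>R (s - t)) \<longlongrightarrow> D) (at t)"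
    unfolding tendsto_at_iff_sequentially using assms by (auto simp: o_def)
  then have "((\<lambda>s. norm ((Z s - Z t) /\<^sub>R (s - t) - D)) \<longlongrightarrow> 0) (at t)"
    by (simp add: tendsto_norm_zero_iff LIM_zero_iff)
  moreover have "\<forall>\<^sub>F s in at t. norm ((Z s - Z t) /\<^sub>R (s - t) - D) = norm (Z s - Z t - (s - t) *\<^sub>R D) / norm (s - t)"
    unfolding eventually_at_filter
  proof (intro always_eventually allI impI)
    fix s assume "s \<noteq> t"
    then have "(Z s - Z t) /\<^sub>R (s - t) - D = (Z s - Z t - (s - t) *\<^sub>R D) /\<^sub>R (s - t)" by (simp add: scaleR_diff_right)
    then show "norm ((Z s - Z t) /\<^sub>R (s - t) - D) = norm (Z s - Z t - (s - t) *\<^sub>R D) / norm (s - t)"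
      by (simp add: divide_inverse mult.commute)
  qed
  ultimately have "((\<lambda>s. norm (Z s - Z t - (s - t) *\<^sub>R D) / norm (s - t)) \<longlongrightarrow> 0) (at t)" by (simp add: tendsto_cong)
  then show ?thesis unfolding has_vector_derivative_def has_derivative_iff_norm
    by (simp add: bounded_linear_scaleR_left)
qed

text \<open>The mean value inequality on the ball around \<open>t\<close> dominates the difference
  quotients by \<open>w\<close>.\<close>

lemma has_vector_derivative_LINT:
  fixes k k' :: "real \<Rightarrow> 'a::euclidean_space \<Rightarrow> complex"
  assumes e: "0 < e" and k: "\<And>s y. s \<in> ball t e \<Longrightarrow> ((\<lambda>s. k s y) has_vector_derivative k' s y) (at s)"
    and i: "\<And>s. s \<in> ball t e \<Longrightarrow> integrable lborel (k s)" and k'm: "k' t \<in> borel_measurable borel"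
    and w: "integrable lborel w" "\<And>s y. s \<in> ball t e \<Longrightarrow> cmod (k' s y) \<le> w y"
  shows "((\<lambda>s. LINT y|lborel. k s y) has_vector_derivative (LINT y|lborel. k' t y)) (at t)"
proof (rule has_vector_derivative_sequentially)
  fix X :: "nat \<Rightarrow> real" assume X: "\<And>n. X n \<noteq> t" "X \<longlonglongrightarrow> t"
  \<comment> \<open>Only a tail of the sequence is known to lie in the ball, so the index is shifted
    by N.\<close>
  have "\<forall>\<^sub>F n in sequentially. X n \<in> ball t e" using X(2) e by (simp add: tendsto_iff dist_commute)
  then obtain N where N: "\<And>n. n \<ge> N \<Longrightarrow> X n \<in> ball t e" unfolding eventually_sequentially by blast
  have tb: "t \<in> ball t e" using e by simp
  have [measurable]: "k t \<in> borel_measurable borel" "k (X (n + N)) \<in> borel_measurable borel" for n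
    using borel_measurable_integrable[OF i[OF tb]] borel_measurable_integrable[OF i[OF N[of "n+N"]]] by auto
  let ?q = "\<lambda>n y. (k (X (n + N)) y - k t y) /\<^sub>R (X (n + N) - t)"
  have "(\<lambda>n. LINT y|lborel. ?q n y) \<longlonglongrightarrow> (LINT y|lborel. k' t y)"
  proof (rule integral_dominated_convergence[where w=w])
    show "AE y in lborel. (\<lambda>n. ?q n y) \<longlonglongrightarrow> k' t y"
    proof (intro AE_I2)
      fix y
      have "((\<lambda>s. norm (k s y - k t y - (s - t) *\<^sub>R k' t y) / norm (s - t)) \<longlongrightarrow> 0) (at t)"
        using k[OF tb, of y] unfolding has_vector_derivative_def has_derivative_iff_norm by simp
      then have "(\<lambda>n. norm (k (X (n+N)) y - k t y - (X (n+N) - t) *\<^sub>R k' t y) / norm (X (n+N) - t)) \<longlonglongrightarrow> 0"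
        by (rule filterlim_compose) (use X LIMSEQ_ignore_initial_segment[OF X(2), of N] in \<open>auto simp: filterlim_at\<close>)
      moreover have "norm (k (X (n+N)) y - k t y - (X (n+N) - t) *\<^sub>R k' t y) / norm (X (n+N) - t) = norm (?q n y - k' t y)" for n
      proof -
        have "?q n y - k' t y = (k (X (n+N)) y - k t y - (X (n+N) - t) *\<^sub>R k' t y) /\<^sub>R (X (n+N) - t)"
          using X(1)[of "n+N"] by (simp add: scaleR_diff_right)
        then show ?thesis by (simp add: divide_inverse mult.commute)
      qed
      ultimately show "(\<lambda>n. ?q n y) \<longlonglongrightarrow> k' t y" by (simp add: tendsto_norm_zero_iff LIM_zero_iff)
    qed
    show "AE y in lborel. norm (?q n y) \<le> w y" for n
    proof (intro AE_I2)
      fix y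
      have "norm (k (X (n+N)) y - k t y) \<le> w y * norm (X (n+N) - t)"
      proof (rule differentiable_bound[where S="ball t e" and f="\<lambda>s. k s y" and f'="\<lambda>s h. h *\<^sub>R k' s y"])
        fix s assume s: "s \<in> ball t e"
        show "((\<lambda>s. k s y) has_derivative (\<lambda>h. h *\<^sub>R k' s y)) (at s within ball t e)"
          using k[OF s, of y] unfolding has_vector_derivative_def by (rule has_derivative_at_withinI)
        show "onorm (\<lambda>h. h *\<^sub>R k' s y) \<le> w y"
          using w(2)[OF s, of y] by (intro onorm_bound) (auto simp: mult.commute intro: mult_left_mono order.trans[OF norm_ge_zero])
      qed (use N tb in auto)
      then have "inverse \<bar>X (n+N) - t\<bar> * norm (k (X (n+N)) y - k t y) \<le> inverse \<bar>X (n+N) - t\<bar> * (w y * \<bar>X (n+N) - t\<bar>)"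
        by (intro mult_left_mono) auto
      also have "\<dots> = w y" using X(1)[of "n+N"] by simp
      finally show "norm (?q n y) \<le> w y" by simp
    qed
  qed (use w(1) k'm in auto)
  moreover have "(LINT y|lborel. ?q n y) = ((LINT y|lborel. k (X (n+N)) y) - (LINT y|lborel. k t y)) /\<^sub>R (X (n+N) - t)" for n
    using i[OF N[of "n+N"]] i[OF tb] by simp
  ultimately have "(\<lambda>n. ((LINT y|lborel. k (X (n+N)) y) - (LINT y|lborel. k t y)) /\<^sub>R (X (n+N) - t)) \<longlonglongrightarrow> (LINT y|lborel. k' t y)"
    by (simp only:)
  then show "(\<lambda>n. ((LINT y|lborel. k (X n) y) - (LINT y|lborel. k t y)) /\<^sub>R (X n - t)) \<longlonglongrightarrow> (LINT y|lborel. k' t y)"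
    by (rule LIMSEQ_offset)
qed

section \<open>The pseudo-conformal transformation\<close>

lemma L2_add: "L2 u \<Longrightarrow> L2 v \<Longrightarrow> L2 (\<lambda>x. u x + v x)"
  for u v :: "real^'d \<Rightarrow> complex"
proof -
  assume u: "L2 u" and v: "L2 v"
  have [measurable]: "u \<in> borel_measurable borel" "v \<in> borel_measurable borel" using u v by (auto simp: L2_def)
  show "L2 (\<lambda>x. u x + v x)" unfolding L2_def
  proof
    show "integrable lborel (\<lambda>x. (cmod (u x + v x))\<^sup>2)"
    proof (rule Bochner_Integration.integrable_bound)
      show "integrable lborel (\<lambda>x. 2 * (cmod (u x))\<^sup>2 + 2 * (cmod (v x))\<^sup>2)" using u v by (auto simp: L2_def)
      show "AE x in lborel. norm ((cmod (u x + v x))\<^sup>2) \<le> norm (2 * (cmod (u x))\<^sup>2 + 2 * (cmod (v x))\<^sup>2)"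
      proof (intro AE_I2)
        fix x
        have "(cmod (u x + v x))\<^sup>2 \<le> (cmod (u x) + cmod (v x))\<^sup>2" by (intro power_mono norm_triangle_ineq) auto
        also have "\<dots> \<le> 2 * (cmod (u x))\<^sup>2 + 2 * (cmod (v x))\<^sup>2"
          using sum_squares_bound[of "cmod (u x)" "cmod (v x)"] by (simp add: power2_sum)
        finally show "norm ((cmod (u x + v x))\<^sup>2) \<le> norm (2 * (cmod (u x))\<^sup>2 + 2 * (cmod (v x))\<^sup>2)" by simp
      qed
    qed measurable
  qed measurable
qed

lemma L2_cmult: "L2 u \<Longrightarrow> L2 (\<lambda>x. z * u x)"
  for u :: "real^'d \<Rightarrow> complex"
  by (auto simp: L2_def norm_mult power_mult_distrib)

lemma has_vector_derivative_cis:
  assumes "(g has_real_derivative g') (at t)"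
  shows "((\<lambda>t. cis (g t)) has_vector_derivative (of_real g' * \<i> * cis (g t))) (at t)"
proof -
  have "((\<lambda>t. cos (g t)) has_vector_derivative (- sin (g t) * g')) (at t)" "((\<lambda>t. sin (g t)) has_vector_derivative (cos (g t) * g')) (at t)"
    using assms by (auto intro!: derivative_eq_intros simp: has_real_derivative_iff_has_vector_derivative[symmetric])
  then have D: "((\<lambda>t. complex_of_real (cos (g t))) has_vector_derivative of_real (- sin (g t) * g')) (at t)"
      "((\<lambda>t. complex_of_real (sin (g t))) has_vector_derivative of_real (cos (g t) * g')) (at t)"
    by (auto simp only: intro: bounded_linear.has_vector_derivative[OF bounded_linear_of_real])
  have "((\<lambda>t. of_real (cos (g t)) + \<i> * of_real (sin (g t))) has_vector_derivative
      (of_real (- sin (g t) * g') + \<i> * of_real (cos (g t) * g'))) (at t)"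
    by (intro has_vector_derivative_add D(1) bounded_linear.has_vector_derivative[OF bounded_linear_mult_right D(2)])
  moreover have "(\<lambda>t. of_real (cos (g t)) + \<i> * of_real (sin (g t))) = (\<lambda>t. cis (g t))"
    by (auto simp: complex_eq_iff)
  moreover have "of_real (- sin (g t) * g') + \<i> * of_real (cos (g t) * g') = of_real g' * \<i> * cis (g t)"
    by (simp add: complex_eq_iff)
  ultimately show ?thesis by simp
qed

section \<open>Complex-valued test functions\<close>

text \<open>The test functions of the weak formulation are real, whereas the chirp is complex-valued.\<close>

definition complex_bump :: "(real^'d \<Rightarrow> complex) \<Rightarrow> ('d \<Rightarrow> real^'d \<Rightarrow> complex) \<Rightarrow> bool" where
  "complex_bump \<Phi> \<Psi> \<longleftrightarrow> (\<exists>\<phi>1 D1 \<phi>2 D2. C1_bump UNIV \<phi>1 D1 \<and> C1_bump UNIV \<phi>2 D2 \<and>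
     (\<forall>y. \<Phi> y = of_real (\<phi>1 y) + \<i> * of_real (\<phi>2 y)) \<and> (\<forall>j y. \<Psi> j y = of_real (D1 y $ j) + \<i> * of_real (D2 y $ j)))"

lemma integral_mult_complex_split:
  fixes h :: "real^'d \<Rightarrow> complex"
  assumes "integrable lborel (\<lambda>y. h y * of_real (a y))" "integrable lborel (\<lambda>y. h y * of_real (b y))"
  shows "(LINT y|lborel. h y * (of_real (a y) + \<i> * of_real (b y))) = (LINT y|lborel. h y * of_real (a y)) + \<i> * (LINT y|lborel. h y * of_real (b y))"
proof -
  have "h y * (of_real (a y) + \<i> * of_real (b y)) = h y * of_real (a y) + \<i> * (h y * of_real (b y))" for y
    by (simp add: algebra_simps)
  then show ?thesis using assms by (simp only: Bochner_Integration.integral_add integrable_mult_right integral_mult_right_zero)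
qed

lemma complex_bump_L2:
  fixes \<Phi> :: "real^'d \<Rightarrow> complex"
  assumes "complex_bump \<Phi> \<Psi>" shows "L2 \<Phi>" "L2 (\<Psi> j)"
proof -
  obtain \<phi>1 D1 \<phi>2 D2 where b: "C1_bump UNIV \<phi>1 D1" "C1_bump UNIV \<phi>2 D2"
     and e: "\<And>y. \<Phi> y = of_real (\<phi>1 y) + \<i> * of_real (\<phi>2 y)" "\<And>j y. \<Psi> j y = of_real (D1 y $ j) + \<i> * of_real (D2 y $ j)"
    using assms unfolding complex_bump_def by blast
  have "L2 (\<lambda>y. of_real (\<phi>1 y) + \<i> * of_real (\<phi>2 y))" "L2 (\<lambda>y. of_real (D1 y $ j) + \<i> * of_real (D2 y $ j))"
    by (intro L2_add L2_cmult L2_bump[OF b(1)] L2_bump[OF b(2)])+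
  moreover have "\<Phi> = (\<lambda>y. of_real (\<phi>1 y) + \<i> * of_real (\<phi>2 y))" "\<Psi> j = (\<lambda>y. of_real (D1 y $ j) + \<i> * of_real (D2 y $ j))"
    by (rule ext, rule e)+
  ultimately show "L2 \<Phi>" "L2 (\<Psi> j)" by (simp_all only:)
qed

text \<open>The products y_j \<Phi> arise when the chirp is differentiated, and pairing them with
  the gradient of \<open>f\<close> gives the identity that closes the computation of the time
  derivative.\<close>

lemma complex_bump_coordinate:
  fixes \<Phi> :: "real^'d \<Rightarrow> complex"
  assumes "complex_bump \<Phi> \<Psi>"
  shows "complex_bump (\<lambda>y. of_real (y $ j) * \<Phi> y) (\<lambda>k y. of_real (y $ j) * \<Psi> k y + (if k = j then \<Phi> y else 0))"
proof -
  obtain \<phi>1 D1 \<phi>2 D2 where b: "C1_bump UNIV \<phi>1 D1" "C1_bump UNIV \<phi>2 D2"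
     and e: "\<And>y. \<Phi> y = of_real (\<phi>1 y) + \<i> * of_real (\<phi>2 y)" "\<And>j y. \<Psi> j y = of_real (D1 y $ j) + \<i> * of_real (D2 y $ j)"
    using assms unfolding complex_bump_def by blast
  have "C1_bump UNIV (\<lambda>y. y $ j * \<phi> y) (\<lambda>y. y $ j *\<^sub>R D y + \<phi> y *\<^sub>R axis j 1)" if "C1_bump UNIV \<phi> D" for \<phi> and D :: "real^'d \<Rightarrow> real^'d"
    using bump_mult_scalar[OF that has_cont_gradient_affine[of 0 "axis j 1"]] by (simp add: inner_axis)
  from this[OF b(1)] this[OF b(2)] show ?thesis unfolding complex_bump_def
    by (intro exI conjI) (assumption, assumption, auto simp: e algebra_simps axis_def)
qed

lemma complex_bump_weak:
  fixes u g :: "real^'d \<Rightarrow> complex"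
  assumes w: "has_weak_partial u j g" and L: "L2 u" "L2 g" and B: "complex_bump \<Phi> \<Psi>"
  shows "(LINT y|lborel. u y * \<Psi> j y) = - (LINT y|lborel. g y * \<Phi> y)"
proof -
  obtain \<phi>1 D1 \<phi>2 D2 where b: "C1_bump UNIV \<phi>1 D1" "C1_bump UNIV \<phi>2 D2"
     and e: "\<And>y. \<Phi> y = of_real (\<phi>1 y) + \<i> * of_real (\<phi>2 y)" "\<And>j y. \<Psi> j y = of_real (D1 y $ j) + \<i> * of_real (D2 y $ j)"
    using B unfolding complex_bump_def by blast
  show ?thesis unfolding e
      integral_mult_complex_split[OF L2_mult_integrable[OF L(1) L2_bump(2)[OF b(1)]] L2_mult_integrable[OF L(1) L2_bump(2)[OF b(2)]]]
      integral_mult_complex_split[OF L2_mult_integrable[OF L(2) L2_bump(1)[OF b(1)]] L2_mult_integrable[OF L(2) L2_bump(1)[OF b(2)]]]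
      weak_partial_bump[OF w b(1)] weak_partial_bump[OF w b(2)] by simp
qed

lemma local_mult_bump:
  fixes h :: "real^'d \<Rightarrow> complex"
  assumes h: "\<And>R. integrable lborel (\<lambda>x. indicator (cball 0 R) x *\<^sub>R h x)" and b: "C1_bump UNIV \<phi> D"
  shows "integrable lborel (\<lambda>x. h x * of_real (\<phi> x))"
proof -
  obtain K where K: "compact K" "\<And>x. x \<notin> K \<Longrightarrow> \<phi> x = 0" using bump_support[OF b] by metis
  obtain R where R: "\<And>x. x \<in> K \<Longrightarrow> norm x \<le> R" using compact_imp_bounded[OF K(1)] by (auto simp: bounded_iff)
  have g: "has_cont_gradient \<phi> D" using b by (simp add: C1_bump_def)
  have "compact (\<phi> ` K)" by (intro compact_continuous_image has_cont_gradient_continuous[OF g] K(1))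
  then obtain M where M: "\<And>x. x \<in> K \<Longrightarrow> \<bar>\<phi> x\<bar> \<le> M" using compact_imp_bounded by (force simp: bounded_iff)
  have M': "\<bar>\<phi> x\<bar> \<le> \<bar>M\<bar>" for x using M[of x] K(2)[of x] by (cases "x \<in> K") auto
  have e: "h x * of_real (\<phi> x) = (indicator (cball 0 R) x *\<^sub>R h x) * of_real (\<phi> x)" for x
    using K(2)[of x] R[of x] by (auto simp: indicator_def)
  have [measurable]: "(\<lambda>x. indicator (cball 0 R) x *\<^sub>R h x) \<in> borel_measurable borel"
    using borel_measurable_integrable[OF h[of R]] by simp
  note [measurable] = has_cont_gradient_measurable(1)[OF g]
  show ?thesis unfolding e
  proof (rule Bochner_Integration.integrable_bound)
    show "integrable lborel (\<lambda>x. \<bar>M\<bar> * norm (indicator (cball 0 R) x *\<^sub>R h x))"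
      by (intro integrable_mult_right integrable_norm h)
    show "AE x in lborel. norm ((indicator (cball 0 R) x *\<^sub>R h x) * of_real (\<phi> x)) \<le> norm (\<bar>M\<bar> * norm (indicator (cball 0 R) x *\<^sub>R h x))"
    proof (intro AE_I2)
      fix x
      have "norm (indicator (cball 0 R) x *\<^sub>R h x) * \<bar>\<phi> x\<bar> \<le> norm (indicator (cball 0 R) x *\<^sub>R h x) * \<bar>M\<bar>"
        by (intro mult_left_mono M') auto
      then show "norm ((indicator (cball 0 R) x *\<^sub>R h x) * of_real (\<phi> x)) \<le> norm (\<bar>M\<bar> * norm (indicator (cball 0 R) x *\<^sub>R h x))"
        by (simp add: norm_mult mult.commute mult.left_commute)
    qed
  qed measurable
qed

text \<open>Real and imaginary parts of the test function satisfy the equation separately.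
  Recombining them needs additivity of every integral, which for the potential and the nonlinearity
  rests on \<open>loc1\<close> and \<open>loc2\<close>.\<close>

lemma (in standing_wave) complex_bump_eq:
  assumes B: "complex_bump \<Phi> \<Psi>"
  shows "(\<Sum>j\<in>UNIV. (LINT x|lborel. g j x * \<Psi> j x)) - of_real c * (LINT x|lborel. of_real (1 / (norm x)^2) * f x * \<Phi> x)
        + of_real \<omega> * (LINT x|lborel. f x * \<Phi> x) = (LINT x|lborel. nonlin TYPE('d) (f x) * \<Phi> x)"
proof -
  obtain \<phi>1 D1 \<phi>2 D2 where b: "C1_bump UNIV \<phi>1 D1" "C1_bump UNIV \<phi>2 D2"
     and e: "\<And>y. \<Phi> y = of_real (\<phi>1 y) + \<i> * of_real (\<phi>2 y)" "\<And>j y. \<Psi> j y = of_real (D1 y $ j) + \<i> * of_real (D2 y $ j)"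
    using B unfolding complex_bump_def by blast
  note t1 = eq[OF bump_imp_test_fun[OF b(1)], unfolded pd_eq_bump[OF b(1)]]
  note t2 = eq[OF bump_imp_test_fun[OF b(2)], unfolded pd_eq_bump[OF b(2)]]
  note s1 = integral_mult_complex_split[OF L2_mult_integrable[OF L2g L2_bump(2)[OF b(1)]] L2_mult_integrable[OF L2g L2_bump(2)[OF b(2)]]]
  note s2 = integral_mult_complex_split[OF local_mult_bump[OF loc1 b(1)] local_mult_bump[OF loc1 b(2)]]
  note s3 = integral_mult_complex_split[OF L2_mult_integrable[OF L2f L2_bump(1)[OF b(1)]] L2_mult_integrable[OF L2f L2_bump(1)[OF b(2)]]]
  note s4 = integral_mult_complex_split[OF local_mult_bump[OF loc2 b(1)] local_mult_bump[OF loc2 b(2)]]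
  have alg: "S1 + \<i> * S2 - c' * (H1 + \<i> * H2) + w * (Z1 + \<i> * Z2) = N1 + \<i> * N2"
    if "S1 - c' * H1 + w * Z1 = N1" "S2 - c' * H2 + w * Z2 = N2" for S1 S2 c' H1 H2 w Z1 Z2 N1 N2 :: complex
    unfolding that[symmetric] by (simp add: algebra_simps)
  show ?thesis unfolding e s1 s2 s3 s4 sum.distrib sum_distrib_left[symmetric] by (rule alg[OF t1 t2])
qed

lemma has_cont_gradient_scale:
  fixes \<phi> :: "'a::euclidean_space \<Rightarrow> real"
  assumes "has_cont_gradient \<phi> D"
  shows "has_cont_gradient (\<lambda>y. \<phi> (m *\<^sub>R y)) (\<lambda>y. m *\<^sub>R D (m *\<^sub>R y))"
proof (rule has_cont_gradientI)
  fix x :: 'a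
  have "((\<lambda>y. m *\<^sub>R y) has_derivative (\<lambda>h. m *\<^sub>R h)) (at x)" by (auto intro!: derivative_eq_intros)
  from has_derivative_compose[OF this has_cont_gradient_derivative[OF assms, of "m *\<^sub>R x" UNIV]]
  show "((\<lambda>y. \<phi> (m *\<^sub>R y)) has_derivative (\<lambda>h. (m *\<^sub>R D (m *\<^sub>R x)) \<bullet> h)) (at x)" by simp
  show "continuous_on UNIV (\<lambda>y. m *\<^sub>R D (m *\<^sub>R y))"
    by (intro continuous_intros continuous_on_compose2[OF has_cont_gradient_continuous(1)[OF assms]]) auto
qed

lemma has_cont_gradient_square: "has_cont_gradient (\<lambda>y. k * (y \<bullet> y)) (\<lambda>y. (2 * k) *\<^sub>R y)"
  by (rule has_cont_gradientI) (auto intro!: derivative_eq_intros continuous_intros simp: inner_commute algebra_simps)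

lemma bump_scale:
  assumes "C1_bump UNIV \<phi> D" "0 < m"
  shows "C1_bump UNIV (\<lambda>y. \<phi> (m *\<^sub>R y)) (\<lambda>y. m *\<^sub>R D (m *\<^sub>R y))"
  unfolding C1_bump_def
proof (intro conjI)
  show "has_cont_gradient (\<lambda>y. \<phi> (m *\<^sub>R y)) (\<lambda>y. m *\<^sub>R D (m *\<^sub>R y))"
    using assms(1) by (intro has_cont_gradient_scale) (simp add: C1_bump_def)
  obtain K where K: "compact K" "\<And>x. x \<notin> K \<Longrightarrow> \<phi> x = 0" using assms(1) unfolding C1_bump_def by blast
  show "\<exists>K. compact K \<and> K \<subseteq> UNIV \<and> (\<forall>x. x \<notin> K \<longrightarrow> \<phi> (m *\<^sub>R x) = 0)"
  proof (intro exI[of _ "(\<lambda>x. (1/m) *\<^sub>R x) ` K"] conjI allI impI K(2))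
    show "compact ((\<lambda>x. (1/m) *\<^sub>R x) ` K)" by (rule compact_scaling[OF K(1)])
    fix x assume x: "x \<notin> (\<lambda>x. (1/m) *\<^sub>R x) ` K"
    show "m *\<^sub>R x \<notin> K"
    proof
      assume "m *\<^sub>R x \<in> K"
      then have "(1/m) *\<^sub>R (m *\<^sub>R x) \<in> (\<lambda>x. (1/m) *\<^sub>R x) ` K" by (rule imageI)
      then show False using x assms(2) by simp
    qed
  qed simp
qed

section \<open>The transformed wave, its gradient and its behaviour in H1\<close>

text \<open>In the variable y = x/m the phase - a |x|^2 / (4 m) reads - a m |y|^2 / 4; the scale
  \<open>m\<close> stands for 1 - a t.\<close>

definition chirp :: "real \<Rightarrow> real \<Rightarrow> real^'d \<Rightarrow> complex" where
  "chirp a m y = cis (- (a * m / 4) * (y \<bullet> y))"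

lemma complex_bump_chirp:
  fixes \<phi> :: "real^'d \<Rightarrow> real"
  assumes b: "C1_bump UNIV \<phi> D" and m: "0 < m"
  shows "complex_bump (\<lambda>y. chirp a m y * of_real (\<phi> (m *\<^sub>R y)))
    (\<lambda>j y. of_real m * (chirp a m y * of_real (D (m *\<^sub>R y) $ j)) - \<i> * of_real (a * m / 2) * of_real (y $ j) * (chirp a m y * of_real (\<phi> (m *\<^sub>R y))))"
proof -
  let ?th = "\<lambda>y::real^'d. - (a * m / 4) * (y \<bullet> y)"
  have "(cos has_real_derivative (- sin y)) (at y)" "(sin has_real_derivative cos y) (at y)" for y :: real
    by (auto intro!: derivative_eq_intros)
  note tr = this
  have cc: "continuous_on UNIV (\<lambda>y::real. - sin y)" "continuous_on UNIV (cos :: real \<Rightarrow> real)" by (intro continuous_intros)+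
  note B1 = bump_mult_scalar[OF bump_scale[OF b m] has_cont_gradient_compose[OF has_cont_gradient_square[of "- (a * m / 4)"] tr(1) cc(1)]]
  note B2 = bump_mult_scalar[OF bump_scale[OF b m] has_cont_gradient_compose[OF has_cont_gradient_square[of "- (a * m / 4)"] tr(2) cc(2)]]
  show ?thesis unfolding complex_bump_def
    by (intro exI conjI, rule B1, rule B2) (auto simp: chirp_def complex_eq_iff algebra_simps)
qed

text \<open>The argument \<open>h\<close> is kept general, since the weak gradient, the potential
  term and the nonlinearity of the transformed wave are images of other functions under the same
  map. For a t < 1 it preserves the L2 norm.\<close>

definition pconf :: "real \<Rightarrow> real \<Rightarrow> real \<Rightarrow> (real^'d \<Rightarrow> complex) \<Rightarrow> real^'d \<Rightarrow> complex" where
  "pconf a \<omega> t h x = of_real ((1 - a * t) powr (- real CARD('d) / 2)) *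
     cis (\<omega> * t / (1 - a * t) - a / (4 * (1 - a * t)) * (x \<bullet> x)) * h (x /\<^sub>R (1 - a * t))"

lemma pconf_measurable [measurable]:
  assumes [measurable]: "h \<in> borel_measurable borel" shows "pconf a \<omega> t h \<in> borel_measurable borel"
proof -
  have "(\<lambda>x::real^'d. cis (\<omega> * t / (1 - a * t) - a / (4 * (1 - a * t)) * (x \<bullet> x))) \<in> borel_measurable borel"
    by (intro borel_measurable_continuous_onI continuous_intros)
  note [measurable] = this
  show ?thesis unfolding pconf_def by measurable
qed

lemma pconf_cmod_square:
  fixes h :: "real^'d \<Rightarrow> complex"
  assumes "a * t < 1"
  shows "(cmod (pconf a \<omega> t h x))\<^sup>2 = inverse ((1 - a * t) ^ CARD('d)) * (cmod (h (x /\<^sub>R (1 - a * t))))\<^sup>2"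
proof -
  let ?m = "1 - a * t"
  have m: "?m > 0" using assms by simp
  have "(?m powr (- real CARD('d) / 2))\<^sup>2 = ?m powr (- real CARD('d))"
    by (simp add: power2_eq_square flip: powr_add)
  also have "\<dots> = inverse (?m ^ CARD('d))" using m by (simp add: powr_minus powr_realpow)
  finally show ?thesis by (simp add: pconf_def norm_mult power_mult_distrib)
qed

lemma pconf_L2:
  fixes h :: "real^'d \<Rightarrow> complex"
  assumes "L2 h" and at: "a * t < 1"
  shows "L2 (pconf a \<omega> t h)" "(LINT x|lborel. (cmod (pconf a \<omega> t h x))\<^sup>2) = (LINT x|lborel. (cmod (h x))\<^sup>2)"
proof -
  let ?m = "1 - a * t"
  have m: "?m > 0" "inverse ?m > 0" using at by auto
  have [measurable]: "h \<in> borel_measurable borel" using assms by (simp add: L2_def)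
  have hm: "(\<lambda>x. (cmod (h x))\<^sup>2) \<in> borel_measurable borel" by measurable
  have "integrable lborel (\<lambda>x. (cmod (h x))\<^sup>2)" using assms by (simp add: L2_def)
  then have "integrable lborel (\<lambda>x. (cmod (h (x /\<^sub>R ?m)))\<^sup>2)"
    using lborel_scale(1)[OF hm m(2)] by simp
  then show "L2 (pconf a \<omega> t h)" unfolding L2_def pconf_cmod_square[OF at] by simp
  show "(LINT x|lborel. (cmod (pconf a \<omega> t h x))\<^sup>2) = (LINT x|lborel. (cmod (h x))\<^sup>2)"
    unfolding pconf_cmod_square[OF at] using lborel_scale(2)[OF hm m(2)] by (simp add: power_inverse)
qed

text \<open>Substituting x = m y moves the chirp and the dilation onto the test function, so that
  \<open>h\<close> itself is paired without rescaling. The Jacobian m^d and the amplitude m^(-d/2)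
  combine to m^(d/2).\<close>

lemma pconf_pairing:
  fixes h :: "real^'d \<Rightarrow> complex" and \<psi> :: "real^'d \<Rightarrow> real"
  assumes [measurable]: "h \<in> borel_measurable borel" "\<psi> \<in> borel_measurable borel" and at: "a * t < 1"
  shows "(LINT x|lborel. pconf a \<omega> t h x * of_real (\<psi> x)) =
    of_real ((1 - a * t) powr (real CARD('d) / 2)) * cis (\<omega> * t / (1 - a * t)) *
    (LINT y|lborel. h y * (chirp a (1 - a * t) y * of_real (\<psi> ((1 - a * t) *\<^sub>R y))))"
proof -
  let ?m = "1 - a * t"
  have m: "?m > 0" using at by simp
  have pm: "?m ^ CARD('d) * ?m powr (- real CARD('d) / 2) = ?m powr (real CARD('d) / 2)"
    using m by (simp add: powr_add[symmetric] flip: powr_realpow)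
  have "(LINT x|lborel. pconf a \<omega> t h x * of_real (\<psi> x)) = (?m ^ CARD('d)) *\<^sub>R (LINT y|lborel. pconf a \<omega> t h (?m *\<^sub>R y) * of_real (\<psi> (?m *\<^sub>R y)))"
    using lborel_scale(2)[of "\<lambda>x. pconf a \<omega> t h x * of_real (\<psi> x)", OF _ m] by simp
  also have "(\<lambda>y. pconf a \<omega> t h (?m *\<^sub>R y) * of_real (\<psi> (?m *\<^sub>R y))) =
     (\<lambda>y. of_real (?m powr (- real CARD('d) / 2)) * cis (\<omega> * t / ?m) * (h y * (chirp a ?m y * of_real (\<psi> (?m *\<^sub>R y)))))"
  proof
    fix y :: "real^'d"
    have "cis (\<omega> * t / ?m - a / (4 * ?m) * ((?m *\<^sub>R y) \<bullet> (?m *\<^sub>R y))) = cis (\<omega> * t / ?m) * chirp a ?m y"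
    proof -
      have "w / M - a / (4 * M) * ((M *\<^sub>R y) \<bullet> (M *\<^sub>R y)) = w / M + - (a * M / 4) * (y \<bullet> y)" if "M > 0" for M w
        using that by (simp add: field_simps)
      from this[OF m, of "\<omega> * t"] show ?thesis unfolding chirp_def cis_mult by (simp only:)
    qed
    then show "pconf a \<omega> t h (?m *\<^sub>R y) * of_real (\<psi> (?m *\<^sub>R y)) = of_real (?m powr (- real CARD('d) / 2)) * cis (\<omega> * t / ?m) * (h y * (chirp a ?m y * of_real (\<psi> (?m *\<^sub>R y))))"
      using m by (simp add: pconf_def mult_ac)
  qed
  also have "(LINT y|lborel. of_real (?m powr (- real CARD('d) / 2)) * cis (\<omega> * t / ?m) * (h y * (chirp a ?m y * of_real (\<psi> (?m *\<^sub>R y))))) =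
      of_real (?m powr (- real CARD('d) / 2)) * cis (\<omega> * t / ?m) * (LINT y|lborel. h y * (chirp a ?m y * of_real (\<psi> (?m *\<^sub>R y))))"
    by (rule integral_mult_right_zero)
  also have "?m ^ CARD('d) *\<^sub>R (of_real (?m powr (- real CARD('d) / 2)) * cis (\<omega> * t / ?m) * (LINT y|lborel. h y * (chirp a ?m y * of_real (\<psi> (?m *\<^sub>R y))))) =
      of_real (?m ^ CARD('d) * ?m powr (- real CARD('d) / 2)) * cis (\<omega> * t / ?m) * (LINT y|lborel. h y * (chirp a ?m y * of_real (\<psi> (?m *\<^sub>R y))))"
    by (simp only: scaleR_conv_of_real of_real_mult mult.assoc)
  finally show ?thesis unfolding pm .
qed

context standing_wave
begin

text \<open>Chosen such that \<open>pconf a \<omega> t (pgrad a t j)\<close> is the weak partial derivative of \<open>pconf a \<omega> t f\<close>.\<close>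

definition pgrad :: "real \<Rightarrow> real \<Rightarrow> 'd \<Rightarrow> real^'d \<Rightarrow> complex" where
  "pgrad a t j y = of_real (1 / (1 - a * t)) * g j y - \<i> * of_real (a / 2) * (of_real (y $ j) * f y)"

lemma fm [measurable]: "f \<in> borel_measurable borel" and gm [measurable]: "g j \<in> borel_measurable borel"
  using L2f L2g[of j] by (auto simp: L2_def)

lemma L2_coordinate: "L2 (\<lambda>y. of_real (y $ j) * f y)"
  unfolding L2_def
proof
  show "integrable lborel (\<lambda>y. (cmod (of_real (y $ j) * f y))\<^sup>2)"
  proof (rule Bochner_Integration.integrable_bound)
    show "integrable lborel (\<lambda>y. (cmod (of_real (norm y) * f y))\<^sup>2)" using L2xf by (simp add: L2_def)
    show "AE y in lborel. norm ((cmod (of_real (y $ j) * f y))\<^sup>2) \<le> norm ((cmod (of_real (norm y) * f y))\<^sup>2)"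
    proof (intro AE_I2)
      fix y :: "real^'d"
      have "\<bar>y $ j\<bar>\<^sup>2 \<le> (norm y)\<^sup>2" by (intro power_mono component_le_norm_cart) auto
      then show "norm ((cmod (of_real (y $ j) * f y))\<^sup>2) \<le> norm ((cmod (of_real (norm y) * f y))\<^sup>2)"
        by (simp add: norm_mult power_mult_distrib mult_right_mono)
    qed
  qed measurable
qed measurable

lemma L2_pgrad: "L2 (pgrad a t j)"
proof -
  have "L2 (\<lambda>y. of_real (1 / (1 - a * t)) * g j y + (- \<i> * of_real (a / 2)) * (of_real (y $ j) * f y))"
    by (intro L2_add L2_cmult L2g L2_coordinate)
  then show ?thesis by (simp add: pgrad_def[abs_def])
qed

lemma pgrad_measurable [measurable]: "pgrad a t j \<in> borel_measurable borel"
  using L2_pgrad by (simp add: L2_def)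

lemma pconf_weak_partial:
  assumes at: "a * t < 1"
  shows "has_weak_partial (pconf a \<omega> t f) j (pconf a \<omega> t (pgrad a t j))"
  unfolding has_weak_partial_def
proof (intro allI impI)
  fix \<phi> :: "real^'d \<Rightarrow> real" assume "test_fun \<phi>"
  then obtain D where b: "C1_bump UNIV \<phi> D" using test_fun_imp_bump by blast
  let ?m = "1 - a * t"
  have m: "?m > 0" using at by simp
  have [measurable]: "\<phi> \<in> borel_measurable borel" "(\<lambda>x. D x $ j) \<in> borel_measurable borel"
    using L2_bump(1)[OF b] L2_bump(2)[OF b, of j] by (auto simp: L2_def borel_measurable_complex_iff)
  define \<Phi> where "\<Phi> y = chirp a ?m y * of_real (\<phi> (?m *\<^sub>R y))" for y
  define \<Psi> where "\<Psi> j y = of_real ?m * (chirp a ?m y * of_real (D (?m *\<^sub>R y) $ j)) - \<i> * of_real (a * ?m / 2) * of_real (y $ j) * (chirp a ?m y * of_real (\<phi> (?m *\<^sub>R y)))" for j y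
  have B: "complex_bump \<Phi> \<Psi>" unfolding \<Phi>_def[abs_def] \<Psi>_def[abs_def] by (rule complex_bump_chirp[OF b m])
  \<comment> \<open>The product rule for the chirped bump, solved for the term with
    \<open>D\<close>; the remainder is a multiple of y_j \<open>\<Phi>\<close>.\<close>
  have ED: "chirp a ?m y * of_real (D (?m *\<^sub>R y) $ j) = of_real (1 / ?m) * \<Psi> j y + \<i> * of_real (a / 2) * (of_real (y $ j) * \<Phi> y)" for y
  proof -
    have "E = of_real (1 / M) * (of_real M * E - \<i> * of_real (a * M / 2) * Y * F) + \<i> * of_real (a / 2) * (Y * F)" if "M > 0" for M and E Y F :: complex
      using that by (simp add: field_simps)
    from this[OF m] show ?thesis unfolding \<Psi>_def \<Phi>_def by blast
  qed
  let ?K = "of_real (?m powr (real CARD('d) / 2)) * cis (\<omega> * t / ?m)"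
  have i1: "integrable lborel (\<lambda>y. f y * \<Psi> j y)" by (rule L2_mult_integrable[OF L2f complex_bump_L2(2)[OF B]])
  have i2: "integrable lborel (\<lambda>y. of_real (y $ j) * f y * \<Phi> y)" by (rule L2_mult_integrable[OF L2_coordinate complex_bump_L2(1)[OF B]])
  have i3: "integrable lborel (\<lambda>y. g j y * \<Phi> y)" by (rule L2_mult_integrable[OF L2g complex_bump_L2(1)[OF B]])
  have "(LINT x|lborel. pconf a \<omega> t f x * of_real (pd \<phi> j x)) = ?K * (LINT y|lborel. f y * (chirp a ?m y * of_real (D (?m *\<^sub>R y) $ j)))"
    unfolding pd_eq_bump[OF b] by (rule pconf_pairing[OF _ _ at]) auto
  also have "(LINT y|lborel. f y * (chirp a ?m y * of_real (D (?m *\<^sub>R y) $ j))) =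
      (LINT y|lborel. of_real (1 / ?m) * (f y * \<Psi> j y) + \<i> * of_real (a / 2) * (of_real (y $ j) * f y * \<Phi> y))"
    unfolding ED by (simp add: algebra_simps)
  also have "\<dots> = of_real (1 / ?m) * (LINT y|lborel. f y * \<Psi> j y) + \<i> * of_real (a / 2) * (LINT y|lborel. of_real (y $ j) * f y * \<Phi> y)"
    using i1 i2 by (simp only: Bochner_Integration.integral_add integrable_mult_right integral_mult_right_zero)
  also have "(LINT y|lborel. f y * \<Psi> j y) = - (LINT y|lborel. g j y * \<Phi> y)" by (rule complex_bump_weak[OF weak L2f L2g B])
  finally have L: "(LINT x|lborel. pconf a \<omega> t f x * of_real (pd \<phi> j x)) =
     ?K * (of_real (1 / ?m) * - (LINT y|lborel. g j y * \<Phi> y) + \<i> * of_real (a / 2) * (LINT y|lborel. of_real (y $ j) * f y * \<Phi> y))" .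
  have "(LINT x|lborel. pconf a \<omega> t (pgrad a t j) x * of_real (\<phi> x)) = ?K * (LINT y|lborel. pgrad a t j y * \<Phi> y)"
    unfolding \<Phi>_def by (rule pconf_pairing[OF _ _ at]) auto
  also have "(LINT y|lborel. pgrad a t j y * \<Phi> y) = (LINT y|lborel. of_real (1 / ?m) * (g j y * \<Phi> y) - \<i> * of_real (a / 2) * (of_real (y $ j) * f y * \<Phi> y))"
    unfolding pgrad_def by (simp add: algebra_simps)
  also have "\<dots> = of_real (1 / ?m) * (LINT y|lborel. g j y * \<Phi> y) - \<i> * of_real (a / 2) * (LINT y|lborel. of_real (y $ j) * f y * \<Phi> y)"
    using i3 i2 by (simp only: Bochner_Integration.integral_diff integrable_mult_right integral_mult_right_zero)
  finally have R: "(LINT x|lborel. pconf a \<omega> t (pgrad a t j) x * of_real (\<phi> x)) =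
     ?K * (of_real (1 / ?m) * (LINT y|lborel. g j y * \<Phi> y) - \<i> * of_real (a / 2) * (LINT y|lborel. of_real (y $ j) * f y * \<Phi> y))" .
  have alg: "k * (x * - y + z * w) = - (k * (x * y - z * w))" for k x y z w :: complex by (simp add: algebra_simps)
  show "(LINT x|lborel. pconf a \<omega> t f x * of_real (pd \<phi> j x)) = - (LINT x|lborel. pconf a \<omega> t (pgrad a t j) x * of_real (\<phi> x))"
    unfolding L R by (rule alg)
qed

lemma pconf_H1:
  assumes "a * t < 1"
  shows "H1 (pconf a \<omega> t f)" "AE x in lborel. wpd (pconf a \<omega> t f) j x = pconf a \<omega> t (pgrad a t j) x"
  using H1_wpd_rep[of "pconf a \<omega> t f" "\<lambda>j. pconf a \<omega> t (pgrad a t j)", OF pconf_L2(1)[OF L2f assms] pconf_L2(1)[OF L2_pgrad assms] pconf_weak_partial[OF assms]]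
  by auto

text \<open>Both parameters may vary: time continuity keeps \<open>A\<close> constant, while
  convergence of the initial data keeps the time 0 and lets \<open>A\<close> tend to 0. Convergent
  coefficients are bounded, which gives a majorant built from |g_j|^2 and |y_j f|^2.\<close>

lemma pgrad_norm_tendsto:
  assumes a: "A \<longlonglongrightarrow> a" and b: "(\<lambda>n. 1 / (1 - A n * X n)) \<longlonglongrightarrow> 1 / (1 - a * t)"
  shows "(\<lambda>n. LINT y|lborel. (cmod (pgrad (A n) (X n) j y))\<^sup>2) \<longlonglongrightarrow> (LINT y|lborel. (cmod (pgrad a t j y))\<^sup>2)"
proof -
  obtain M1 where M1: "\<And>n. \<bar>1 / (1 - A n * X n)\<bar> \<le> M1" using convergent_imp_Bseq[OF convergentI[OF b]] by (auto simp: Bseq_def)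
  obtain M2 where M2: "\<And>n. \<bar>A n\<bar> \<le> M2" using convergent_imp_Bseq[OF convergentI[OF a]] by (auto simp: Bseq_def)
  show ?thesis
  proof (rule integral_dominated_convergence[where w="\<lambda>y. 2 * (M1 * cmod (g j y))\<^sup>2 + 2 * (M2 * cmod (of_real (y $ j) * f y))\<^sup>2"])
    show "integrable lborel (\<lambda>y. 2 * (M1 * cmod (g j y))\<^sup>2 + 2 * (M2 * cmod (of_real (y $ j) * f y))\<^sup>2)"
      using L2g[of j] L2_coordinate[of j] unfolding L2_def power_mult_distrib
      by (intro Bochner_Integration.integrable_add integrable_mult_right) auto
    show "AE y in lborel. (\<lambda>n. (cmod (pgrad (A n) (X n) j y))\<^sup>2) \<longlonglongrightarrow> (cmod (pgrad a t j y))\<^sup>2"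
      unfolding pgrad_def
      by (intro AE_I2 tendsto_power tendsto_norm tendsto_diff tendsto_mult[OF tendsto_of_real[OF b] tendsto_const]
          tendsto_mult[OF tendsto_mult[OF tendsto_const tendsto_of_real[OF tendsto_divide[OF a tendsto_const]]] tendsto_const]) simp
    show "AE y in lborel. norm ((cmod (pgrad (A n) (X n) j y))\<^sup>2) \<le> 2 * (M1 * cmod (g j y))\<^sup>2 + 2 * (M2 * cmod (of_real (y $ j) * f y))\<^sup>2" for n
    proof (intro AE_I2)
      fix y
      have "cmod (pgrad (A n) (X n) j y) \<le> cmod (of_real (1 / (1 - A n * X n)) * g j y) + cmod (\<i> * of_real (A n / 2) * (of_real (y $ j) * f y))"
        unfolding pgrad_def by (rule norm_triangle_ineq4)
      also have "\<dots> = \<bar>1 / (1 - A n * X n)\<bar> * cmod (g j y) + (\<bar>A n\<bar> / 2) * cmod (of_real (y $ j) * f y)"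
        by (simp only: norm_mult norm_of_real norm_ii mult_1 abs_divide abs_numeral) 
      also have "\<dots> \<le> M1 * cmod (g j y) + M2 * cmod (of_real (y $ j) * f y)"
        using M1[of n] M2[of n] by (intro add_mono mult_right_mono) auto
      finally have "(cmod (pgrad (A n) (X n) j y))\<^sup>2 \<le> (M1 * cmod (g j y) + M2 * cmod (of_real (y $ j) * f y))\<^sup>2"
        by (intro power_mono) auto
      also have "\<dots> \<le> 2 * (M1 * cmod (g j y))\<^sup>2 + 2 * (M2 * cmod (of_real (y $ j) * f y))\<^sup>2"
        using sum_squares_bound[of "M1 * cmod (g j y)" "M2 * cmod (of_real (y $ j) * f y)"] by (simp add: power2_sum)
      finally show "norm ((cmod (pgrad (A n) (X n) j y))\<^sup>2) \<le> 2 * (M1 * cmod (g j y))\<^sup>2 + 2 * (M2 * cmod (of_real (y $ j) * f y))\<^sup>2" by simp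
    qed
  qed measurable
qed

lemma tendsto_punctured:
  assumes "continuous_on (- {0}) h" "X \<longlonglongrightarrow> x" "x \<noteq> (0::real^'d)"
  shows "(\<lambda>n. h (X n)) \<longlonglongrightarrow> h x"
proof -
  have "isCont h x" using assms(1,3) by (simp add: continuous_on_eq_continuous_at open_Compl)
  then show ?thesis using assms(2) by (rule isCont_tendsto_compose)
qed

text \<open>Pointwise convergence off the origin comes from the continuity of \<open>f\<close> and
  \<open>g j\<close>. The L2 norm of the wave is conserved and those of the gradients converge;
  \<open>L2_convergence\<close> combines the two.\<close>

lemma pconf_continuous:
  assumes t: "a * t < 1" and Xt: "\<And>n. a * X n < 1" and X: "X \<longlonglongrightarrow> t"
  shows "(\<lambda>n. H1_dist (pconf a \<omega> (X n) f) (pconf a \<omega> t f)) \<longlonglongrightarrow> 0"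
proof -
  have m: "(\<lambda>n. 1 - a * X n) \<longlonglongrightarrow> 1 - a * t" by (intro tendsto_intros X)
  have ne: "1 - a * t \<noteq> 0" "1 - a * t > 0" using t by auto
  have mi: "(\<lambda>n. 1 / (1 - a * X n)) \<longlonglongrightarrow> 1 / (1 - a * t)" by (intro tendsto_intros m ne)
  have pt: "(\<lambda>n. pconf a \<omega> (X n) (h n) x) \<longlonglongrightarrow> pconf a \<omega> t k x"
    if h: "(\<lambda>n. h n (x /\<^sub>R (1 - a * X n))) \<longlonglongrightarrow> k (x /\<^sub>R (1 - a * t))" for h :: "nat \<Rightarrow> real^'d \<Rightarrow> complex" and k x
    unfolding pconf_def
    by (intro tendsto_mult tendsto_of_real tendsto_powr tendsto_const m ne h tendsto_cis tendsto_intros X) (use ne in auto)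
  have arg: "(\<lambda>n. x /\<^sub>R (1 - a * X n)) \<longlonglongrightarrow> x /\<^sub>R (1 - a * t)" for x :: "real^'d"
    by (intro tendsto_intros m ne)
  have fp: "(\<lambda>n. f (x /\<^sub>R (1 - a * X n))) \<longlonglongrightarrow> f (x /\<^sub>R (1 - a * t))" if "x \<noteq> 0" for x
    by (rule tendsto_punctured[OF fc arg]) (use that ne in auto)
  have gp: "(\<lambda>n. pgrad a (X n) j (x /\<^sub>R (1 - a * X n))) \<longlonglongrightarrow> pgrad a t j (x /\<^sub>R (1 - a * t))" if "x \<noteq> 0" for x j
  proof -
    have "(\<lambda>n. g j (x /\<^sub>R (1 - a * X n))) \<longlonglongrightarrow> g j (x /\<^sub>R (1 - a * t))"
      by (rule tendsto_punctured[OF gc arg]) (use that ne in auto)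
    then show ?thesis unfolding pgrad_def
      by (intro tendsto_diff tendsto_mult[OF tendsto_of_real[OF mi]] tendsto_mult[OF tendsto_const]
          tendsto_mult[OF tendsto_of_real fp[OF that]] tendsto_vec_nth arg)
  qed
  have 0: "AE x in lborel. x \<noteq> (0::real^'d)" by (rule AE_lborel_singleton)
  have c0: "(\<lambda>n. LINT x|lborel. (cmod (pconf a \<omega> (X n) f x - pconf a \<omega> t f x))\<^sup>2) \<longlonglongrightarrow> 0"
  proof (rule L2_convergence[OF pconf_L2(1)[OF L2f Xt] pconf_L2(1)[OF L2f t]])
    show "AE x in lborel. (\<lambda>n. pconf a \<omega> (X n) f x) \<longlonglongrightarrow> pconf a \<omega> t f x"
      using 0 by eventually_elim (rule pt[where h="\<lambda>_. f" and k=f, OF fp])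
    show "(\<lambda>n. LINT x|lborel. (cmod (pconf a \<omega> (X n) f x))\<^sup>2) \<longlonglongrightarrow> (LINT x|lborel. (cmod (pconf a \<omega> t f x))\<^sup>2)"
      unfolding pconf_L2(2)[OF L2f Xt] pconf_L2(2)[OF L2f t] by simp
  qed
  have c1: "(\<lambda>n. LINT x|lborel. (cmod (pconf a \<omega> (X n) (pgrad a (X n) j) x - pconf a \<omega> t (pgrad a t j) x))\<^sup>2) \<longlonglongrightarrow> 0" for j
  proof (rule L2_convergence[OF pconf_L2(1)[OF L2_pgrad Xt] pconf_L2(1)[OF L2_pgrad t]])
    show "AE x in lborel. (\<lambda>n. pconf a \<omega> (X n) (pgrad a (X n) j) x) \<longlonglongrightarrow> pconf a \<omega> t (pgrad a t j) x"
      using 0 by eventually_elim (rule pt[where h="\<lambda>n. pgrad a (X n) j" and k="pgrad a t j", OF gp])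
    show "(\<lambda>n. LINT x|lborel. (cmod (pconf a \<omega> (X n) (pgrad a (X n) j) x))\<^sup>2) \<longlonglongrightarrow> (LINT x|lborel. (cmod (pconf a \<omega> t (pgrad a t j) x))\<^sup>2)"
      unfolding pconf_L2(2)[OF L2_pgrad Xt] pconf_L2(2)[OF L2_pgrad t]
      by (rule pgrad_norm_tendsto[OF tendsto_const mi])
  qed
  have "H1_dist (pconf a \<omega> (X n) f) (pconf a \<omega> t f) = sqrt ((LINT x|lborel. (cmod (pconf a \<omega> (X n) f x - pconf a \<omega> t f x))\<^sup>2)
      + (\<Sum>j\<in>UNIV. LINT x|lborel. (cmod (pconf a \<omega> (X n) (pgrad a (X n) j) x - pconf a \<omega> t (pgrad a t j) x))\<^sup>2))" for n
    by (rule H1_dist_rep) (auto intro: pconf_H1[OF Xt] pconf_H1[OF t] wpd_props(1) pconf_L2(1)[OF L2_pgrad Xt] pconf_L2(1)[OF L2_pgrad t])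
  moreover have "(\<lambda>n. sqrt ((LINT x|lborel. (cmod (pconf a \<omega> (X n) f x - pconf a \<omega> t f x))\<^sup>2)
      + (\<Sum>j\<in>UNIV. LINT x|lborel. (cmod (pconf a \<omega> (X n) (pgrad a (X n) j) x - pconf a \<omega> t (pgrad a t j) x))\<^sup>2))) \<longlonglongrightarrow> sqrt (0 + (\<Sum>j\<in>(UNIV::'d set). 0))"
    by (intro tendsto_intros c0 c1)
  ultimately show ?thesis by simp
qed

text \<open>At time 0 there is no dilation, only the chirp with small parameter, so pointwise
  convergence holds everywhere without any continuity of \<open>f\<close>.\<close>

lemma pconf_initial_tendsto:
  assumes A: "A \<longlonglongrightarrow> 0" and Q: "H1 Q" "AE x in lborel. Q x = f x" "\<And>j. AE x in lborel. wpd Q j x = g j x"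
  shows "(\<lambda>n. H1_dist (pconf (A n) \<omega> 0 f) Q) \<longlonglongrightarrow> 0"
proof -
  have z: "A n * 0 < 1" for n by simp
  have Qm: "Q \<in> borel_measurable borel" using Q(1) by (simp add: H1_def L2_def)
  have p0: "pgrad 0 0 j = g j" for j by (simp add: pgrad_def fun_eq_iff)
  have pt: "(\<lambda>n. pconf (A n) \<omega> 0 (h n) x) \<longlonglongrightarrow> k x" if h: "(\<lambda>n. h n x) \<longlonglongrightarrow> k x" for h :: "nat \<Rightarrow> real^'d \<Rightarrow> complex" and k x
  proof -
    have "(\<lambda>n. cis (- (A n / 4 * (x \<bullet> x))) * h n x) \<longlonglongrightarrow> cis (- (0 / 4 * (x \<bullet> x))) * k x"
      by (intro tendsto_mult h tendsto_cis tendsto_intros A) auto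
    then show ?thesis by (simp add: pconf_def)
  qed
  have c0: "(\<lambda>n. LINT x|lborel. (cmod (pconf (A n) \<omega> 0 f x - f x))\<^sup>2) \<longlonglongrightarrow> 0"
  proof (rule L2_convergence[OF pconf_L2(1)[OF L2f z] L2f])
    show "AE x in lborel. (\<lambda>n. pconf (A n) \<omega> 0 f x) \<longlonglongrightarrow> f x" by (intro AE_I2 pt) simp
    show "(\<lambda>n. LINT x|lborel. (cmod (pconf (A n) \<omega> 0 f x))\<^sup>2) \<longlonglongrightarrow> (LINT x|lborel. (cmod (f x))\<^sup>2)"
      unfolding pconf_L2(2)[OF L2f z] by simp
  qed
  have c1: "(\<lambda>n. LINT x|lborel. (cmod (pconf (A n) \<omega> 0 (pgrad (A n) 0 j) x - g j x))\<^sup>2) \<longlonglongrightarrow> 0" for j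
  proof (rule L2_convergence[OF pconf_L2(1)[OF L2_pgrad z] L2g])
    have "(\<lambda>n. pgrad (A n) 0 j x) \<longlonglongrightarrow> of_real (1 / (1 - 0)) * g j x - \<i> * of_real (0 / 2) * (of_real (x $ j) * f x)" for x
      unfolding pgrad_def mult_zero_right by (intro tendsto_intros A) auto
    then show "AE x in lborel. (\<lambda>n. pconf (A n) \<omega> 0 (pgrad (A n) 0 j) x) \<longlonglongrightarrow> g j x" by (intro AE_I2 pt) simp
    have "(\<lambda>n. LINT y|lborel. (cmod (pgrad (A n) 0 j y))\<^sup>2) \<longlonglongrightarrow> (LINT y|lborel. (cmod (pgrad 0 0 j y))\<^sup>2)"
      by (rule pgrad_norm_tendsto[OF A]) simp
    then show "(\<lambda>n. LINT x|lborel. (cmod (pconf (A n) \<omega> 0 (pgrad (A n) 0 j) x))\<^sup>2) \<longlonglongrightarrow> (LINT x|lborel. (cmod (g j x))\<^sup>2)"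
      unfolding pconf_L2(2)[OF L2_pgrad z] p0 .
  qed
  have "H1_dist (pconf (A n) \<omega> 0 f) Q = sqrt ((LINT x|lborel. (cmod (pconf (A n) \<omega> 0 f x - f x))\<^sup>2)
      + (\<Sum>j\<in>UNIV. LINT x|lborel. (cmod (pconf (A n) \<omega> 0 (pgrad (A n) 0 j) x - g j x))\<^sup>2))" for n
    by (rule H1_dist_rep[OF _ Qm _ Q(2)]) (auto intro: pconf_H1[OF z] Q wpd_props(1) pconf_L2(1)[OF L2_pgrad z] L2g)
  moreover have "(\<lambda>n. sqrt ((LINT x|lborel. (cmod (pconf (A n) \<omega> 0 f x - f x))\<^sup>2)
      + (\<Sum>j\<in>UNIV. LINT x|lborel. (cmod (pconf (A n) \<omega> 0 (pgrad (A n) 0 j) x - g j x))\<^sup>2))) \<longlonglongrightarrow> sqrt (0 + (\<Sum>j\<in>(UNIV::'d set). 0))"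
    by (intro tendsto_intros c0 c1)
  ultimately show ?thesis by simp
qed

text \<open>One component with nonzero \<open>g j\<close> suffices: its share of the transformed
  gradient grows like 1/(1 - a t), while the chirp contributes a term of fixed L2 norm.\<close>

lemma pconf_blowup:
  assumes a: "a > 0"
  shows "filterlim (\<lambda>t. grad_norm (pconf a \<omega> t f)) at_top (at_left (1 / a))"
proof -
  obtain j where j: "\<not> (AE x in lborel. g j x = 0)" using nontriv by blast
  define G where "G = (LINT y|lborel. (cmod (g j y))\<^sup>2)"
  define Y where "Y = (LINT y|lborel. (cmod (of_real (y $ j) * f y))\<^sup>2)"
  have iG: "integrable lborel (\<lambda>y. (cmod (g j y))\<^sup>2)" using L2g[of j] by (simp add: L2_def)
  have iY: "integrable lborel (\<lambda>y. (cmod (of_real (y $ j) * f y))\<^sup>2)" using L2_coordinate[of j] by (simp add: L2_def)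
  have G: "G > 0"
  proof -
    have "G \<noteq> 0" unfolding G_def using integral_nonneg_eq_0_iff_AE[OF iG] j by simp
    moreover have "G \<ge> 0" unfolding G_def by (simp add: integral_nonneg_AE)
    ultimately show ?thesis by simp
  qed
  \<comment> \<open>From |u|^2/2 - |v|^2 <= |u - v|^2, with u the dilated gradient and v the chirp
    term.\<close>
  have lower: "sqrt ((1 / (1 - a * t))\<^sup>2 * (G / 2) - (a / 2)\<^sup>2 * Y) \<le> grad_norm (pconf a \<omega> t f)" if t: "t < 1 / a" for t
  proof -
    have at: "a * t < 1" using t a by (simp add: field_simps)
    let ?l = "1 / (1 - a * t)"
    have "(LINT y|lborel. ?l\<^sup>2 / 2 * (cmod (g j y))\<^sup>2 - (a/2)\<^sup>2 * (cmod (of_real (y $ j) * f y))\<^sup>2) \<le> (LINT y|lborel. (cmod (pgrad a t j y))\<^sup>2)"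
    proof (rule integral_mono)
      show "integrable lborel (\<lambda>y. ?l\<^sup>2 / 2 * (cmod (g j y))\<^sup>2 - (a/2)\<^sup>2 * (cmod (of_real (y $ j) * f y))\<^sup>2)"
        using iG iY by (intro Bochner_Integration.integrable_diff integrable_mult_right)
      show "integrable lborel (\<lambda>y. (cmod (pgrad a t j y))\<^sup>2)" using L2_pgrad[of a t j] by (simp add: L2_def)
      fix y
      let ?u = "of_real ?l * g j y" and ?v = "\<i> * of_real (a / 2) * (of_real (y $ j) * f y)"
      have "cmod ?u \<le> cmod (?u - ?v) + cmod ?v" using norm_triangle_ineq[of "?u - ?v" ?v] by simp
      then have "(cmod ?u)\<^sup>2 \<le> (cmod (?u - ?v) + cmod ?v)\<^sup>2" by (intro power_mono) auto
      also have "\<dots> \<le> 2 * (cmod (?u - ?v))\<^sup>2 + 2 * (cmod ?v)\<^sup>2"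
        using sum_squares_bound[of "cmod (?u - ?v)" "cmod ?v"] by (simp add: power2_sum)
      finally have "(cmod ?u)\<^sup>2 / 2 - (cmod ?v)\<^sup>2 \<le> (cmod (?u - ?v))\<^sup>2" by simp
      moreover have "(cmod ?u)\<^sup>2 = ?l\<^sup>2 * (cmod (g j y))\<^sup>2" by (simp only: norm_mult norm_of_real power_mult_distrib power2_abs)
      moreover have "(cmod ?v)\<^sup>2 = (a/2)\<^sup>2 * (cmod (of_real (y $ j) * f y))\<^sup>2"
        by (simp only: norm_mult[of _ "of_real (y $ j) * f y"] norm_mult[of \<i>] norm_ii mult_1 norm_of_real power_mult_distrib power2_abs)
      ultimately show "?l\<^sup>2 / 2 * (cmod (g j y))\<^sup>2 - (a/2)\<^sup>2 * (cmod (of_real (y $ j) * f y))\<^sup>2 \<le> (cmod (pgrad a t j y))\<^sup>2"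
        unfolding pgrad_def by simp
    qed
    also have "(LINT y|lborel. ?l\<^sup>2 / 2 * (cmod (g j y))\<^sup>2 - (a/2)\<^sup>2 * (cmod (of_real (y $ j) * f y))\<^sup>2) = ?l\<^sup>2 * (G / 2) - (a / 2)\<^sup>2 * Y"
      unfolding G_def Y_def
      using Bochner_Integration.integral_diff[OF integrable_mult_right[OF iG, of "?l\<^sup>2 / 2"] integrable_mult_right[OF iY, of "(a/2)\<^sup>2"]] by simp
    also have "(LINT y|lborel. (cmod (pgrad a t j y))\<^sup>2) = (LINT x|lborel. (cmod (pconf a \<omega> t (pgrad a t j) x))\<^sup>2)"
      by (rule pconf_L2(2)[OF L2_pgrad at, symmetric])
    also have "\<dots> = (LINT x|lborel. (cmod (wpd (pconf a \<omega> t f) j x))\<^sup>2)"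
    proof (rule integral_cong_AE)
      have "wpd (pconf a \<omega> t f) j \<in> borel_measurable borel" using wpd_props(1)[OF pconf_H1(1)[OF at], of j] by (simp add: L2_def)
      then show "(\<lambda>x. (cmod (wpd (pconf a \<omega> t f) j x))\<^sup>2) \<in> borel_measurable lborel" by measurable
      show "AE x in lborel. (cmod (pconf a \<omega> t (pgrad a t j) x))\<^sup>2 = (cmod (wpd (pconf a \<omega> t f) j x))\<^sup>2"
        using pconf_H1(2)[OF at, of j] by eventually_elim simp
    qed measurable
    also have "\<dots> \<le> (\<Sum>j\<in>UNIV. LINT x|lborel. (cmod (wpd (pconf a \<omega> t f) j x))\<^sup>2)"
      by (rule member_le_sum) (auto intro: integral_nonneg_AE)
    finally show ?thesis unfolding grad_norm_def by (intro real_sqrt_le_mono)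
  qed
  have "filterlim (\<lambda>t. 1 - a * t) (at_right 0) (at_left (1 / a))"
    unfolding filterlim_at
  proof
    have "((\<lambda>t. 1 - a * t) \<longlongrightarrow> 1 - a * (1 / a)) (at_left (1/a))" by (intro tendsto_intros)
    then show "((\<lambda>t. 1 - a * t) \<longlongrightarrow> 0) (at_left (1/a))" using a by simp
    show "\<forall>\<^sub>F t in at_left (1/a). 1 - a * t \<in> {0<..} \<and> 1 - a * t \<noteq> 0"
      using a by (auto simp: eventually_at_filter field_simps intro!: always_eventually)
  qed
  then have "filterlim (\<lambda>t. inverse (1 - a * t)) at_top (at_left (1 / a))"
    by (rule filterlim_compose[OF filterlim_inverse_at_top_right])
  then have l: "filterlim (\<lambda>t. 1 / (1 - a * t)) at_top (at_left (1 / a))" by (simp add: inverse_eq_divide)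
  have "filterlim (\<lambda>t. (G / 2) * (1 / (1 - a * t))\<^sup>2) at_top (at_left (1 / a))"
    using G by (intro filterlim_tendsto_pos_mult_at_top[OF tendsto_const] filterlim_pow_at_top l) auto
  then have "filterlim (\<lambda>t. - ((a / 2)\<^sup>2 * Y) + (G / 2) * (1 / (1 - a * t))\<^sup>2) at_top (at_left (1 / a))"
    by (rule filterlim_tendsto_add_at_top[OF tendsto_const])
  then have "filterlim (\<lambda>t. sqrt (- ((a / 2)\<^sup>2 * Y) + (G / 2) * (1 / (1 - a * t))\<^sup>2)) at_top (at_left (1 / a))"
    by (rule filterlim_compose[OF sqrt_at_top])
  then show ?thesis
  proof (rule filterlim_at_top_mono)
    show "\<forall>\<^sub>F t in at_left (1/a). sqrt (- ((a / 2)\<^sup>2 * Y) + (G / 2) * (1 / (1 - a * t))\<^sup>2) \<le> grad_norm (pconf a \<omega> t f)"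
      unfolding eventually_at_filter
      by (intro always_eventually allI impI) (use lower in \<open>simp add: algebra_simps\<close>)
  qed
qed

end

section \<open>The evolution equation for the transformed wave\<close>

context standing_wave
begin

text \<open>In the variable y only the chirp and \<phi>(s y) depend on the scale s, so no derivative
  in s falls on \<open>f\<close>. For s near \<open>m\<close> the supports stay in one ball, which
  yields the majorant.\<close>

lemma pconf_pairing_derivative:
  fixes \<phi> :: "real^'d \<Rightarrow> real" and a :: real
  assumes b: "C1_bump UNIV \<phi> D" and m: "0 < m"
  defines "k \<equiv> \<lambda>s y. f y * (chirp a s y * of_real (\<phi> (s *\<^sub>R y)))"
    and "k' \<equiv> \<lambda>s y. f y * (chirp a s y * of_real (y \<bullet> D (s *\<^sub>R y))) - \<i> * of_real (a / 4) * (f y * (of_real (y \<bullet> y) * (chirp a s y * of_real (\<phi> (s *\<^sub>R y)))))"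
  shows "((\<lambda>s. LINT y|lborel. k s y) has_vector_derivative (LINT y|lborel. k' m y)) (at m)"
proof -
  have g: "has_cont_gradient \<phi> D" using b by (simp add: C1_bump_def)
  note [measurable] = has_cont_gradient_measurable[OF g]
  obtain K where K: "compact K" "\<And>x. x \<notin> K \<Longrightarrow> \<phi> x = 0" "\<And>x. x \<notin> K \<Longrightarrow> D x = 0" using bump_support[OF b] by metis
  obtain R where R: "\<And>x. x \<in> K \<Longrightarrow> norm x \<le> R" using compact_imp_bounded[OF K(1)] by (auto simp: bounded_iff)
  have "compact (\<phi> ` K)" "compact (D ` K)" by (intro compact_continuous_image has_cont_gradient_continuous[OF g] K(1))+
  then have "bounded (\<phi> ` K)" "bounded (D ` K)" by (auto intro: compact_imp_bounded)
  then obtain M1 M2 where M: "\<And>x. x \<in> K \<Longrightarrow> \<bar>\<phi> x\<bar> \<le> M1" "\<And>x. x \<in> K \<Longrightarrow> norm (D x) \<le> M2"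
    by (auto simp: bounded_iff)
  have M1: "\<bar>\<phi> x\<bar> \<le> \<bar>M1\<bar>" and M2: "norm (D x) \<le> \<bar>M2\<bar>" for x
    using M[of x] K(2,3)[of x] by (cases "x \<in> K"; auto)+
  \<comment> \<open>For s > m/2 the condition |s y| <= R forces |y| <= 2 R / m.\<close>
  define R' where "R' = 2 * R / m"
  define B where "B = R' * \<bar>M2\<bar> + \<bar>a\<bar> / 4 * (R'\<^sup>2 * \<bar>M1\<bar>)"
  have chirp_m: "chirp a s \<in> borel_measurable borel" for s
    unfolding chirp_def[abs_def] by (intro borel_measurable_continuous_onI continuous_intros)
  note [measurable] = chirp_m
  have nc: "cmod (chirp a s y) = 1" for s y by (simp add: chirp_def)
  show ?thesis
  proof (rule has_vector_derivative_LINT[where e="m/2" and w="\<lambda>y. B * cmod (f y * of_real (indicator (cball 0 R') y))"])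
    show "0 < m / 2" using m by simp
    fix s assume "s \<in> ball m (m/2)"
    then have "\<bar>m - s\<bar> < m / 2" by (simp add: dist_real_def)
    then have s: "s > m / 2" by linarith
    then have s0: "s > 0" using m by simp
    have out: "s *\<^sub>R y \<notin> K" if "y \<notin> cball 0 R'" for y
    proof
      assume "s *\<^sub>R y \<in> K"
      then have "s * norm y \<le> R" using R[of "s *\<^sub>R y"] s0 by simp
      moreover have "m / 2 * norm y \<le> s * norm y" using s by (intro mult_right_mono) auto
      ultimately have "norm y \<le> R'" using m by (simp add: R'_def field_simps)
      then show False using that by simp
    qed
    show "((\<lambda>s. k s y) has_vector_derivative k' s y) (at s)" for y
    proof -
      have "((\<lambda>s. - (a * s / 4) * (y \<bullet> y)) has_real_derivative - (a / 4) * (y \<bullet> y)) (at s)"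
        by (auto intro!: derivative_eq_intros)
      from has_vector_derivative_cis[OF this]
      have c: "((\<lambda>s. chirp a s y) has_vector_derivative (of_real (- (a / 4) * (y \<bullet> y)) * \<i> * chirp a s y)) (at s)"
        unfolding chirp_def .
      have "((\<lambda>s. s *\<^sub>R y) has_derivative (\<lambda>h. h *\<^sub>R y)) (at s)" by (auto intro!: derivative_eq_intros)
      from has_derivative_compose[OF this has_cont_gradient_derivative[OF g, of "s *\<^sub>R y" UNIV]]
      have "((\<lambda>s. \<phi> (s *\<^sub>R y)) has_vector_derivative (y \<bullet> D (s *\<^sub>R y))) (at s)"
        unfolding has_vector_derivative_def by (simp add: inner_commute)
      then have p: "((\<lambda>s. complex_of_real (\<phi> (s *\<^sub>R y))) has_vector_derivative of_real (y \<bullet> D (s *\<^sub>R y))) (at s)"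
        by (rule bounded_linear.has_vector_derivative[OF bounded_linear_of_real])
      from bounded_linear.has_vector_derivative[OF bounded_linear_mult_right has_vector_derivative_mult[OF c p], of "f y"]
      have "((\<lambda>s. k s y) has_vector_derivative (f y * (chirp a s y * of_real (y \<bullet> D (s *\<^sub>R y)) + of_real (- (a / 4) * (y \<bullet> y)) * \<i> * chirp a s y * of_real (\<phi> (s *\<^sub>R y))))) (at s)"
        unfolding k_def .
      moreover have "f y * (chirp a s y * of_real (y \<bullet> D (s *\<^sub>R y)) + of_real (- (a / 4) * (y \<bullet> y)) * \<i> * chirp a s y * of_real (\<phi> (s *\<^sub>R y))) = k' s y"
        unfolding k'_def by (simp add: algebra_simps)
      ultimately show ?thesis by simp
    qed
    show "integrable lborel (k s)"
      unfolding k_def by (rule L2_mult_integrable[OF L2f complex_bump_L2(1)[OF complex_bump_chirp[OF b s0]]])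
    show "cmod (k' s y) \<le> B * cmod (f y * of_real (indicator (cball 0 R') y))" for y
    proof (cases "y \<in> cball 0 R'")
      case True
      then have y: "norm y \<le> R'" by simp
      have "\<bar>y \<bullet> D (s *\<^sub>R y)\<bar> \<le> R' * \<bar>M2\<bar>"
      proof -
        have "0 \<le> R'" using y norm_ge_zero[of y] by linarith
        then show ?thesis by (rule order.trans[OF Cauchy_Schwarz_ineq2 mult_mono[OF y M2 _ norm_ge_zero]])
      qed
      moreover have "\<bar>y \<bullet> y\<bar> * \<bar>\<phi> (s *\<^sub>R y)\<bar> \<le> R'\<^sup>2 * \<bar>M1\<bar>"
        using y by (intro mult_mono M1) (auto simp: power2_norm_eq_inner[symmetric] intro: power_mono)
      ultimately have "cmod (f y) * \<bar>y \<bullet> D (s *\<^sub>R y)\<bar> + \<bar>a\<bar> / 4 * (cmod (f y) * (\<bar>y \<bullet> y\<bar> * \<bar>\<phi> (s *\<^sub>R y)\<bar>)) \<le> cmod (f y) * (R' * \<bar>M2\<bar>) + \<bar>a\<bar> / 4 * (cmod (f y) * (R'\<^sup>2 * \<bar>M1\<bar>))"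
        by (intro add_mono mult_left_mono) auto
      moreover have "cmod (k' s y) \<le> cmod (f y) * \<bar>y \<bullet> D (s *\<^sub>R y)\<bar> + \<bar>a\<bar> / 4 * (cmod (f y) * (\<bar>y \<bullet> y\<bar> * \<bar>\<phi> (s *\<^sub>R y)\<bar>))"
        unfolding k'_def by (rule order.trans[OF norm_triangle_ineq4]) (simp add: norm_mult nc)
      moreover have "B * cmod (f y * of_real (indicator (cball 0 R') y)) = cmod (f y) * (R' * \<bar>M2\<bar>) + \<bar>a\<bar> / 4 * (cmod (f y) * (R'\<^sup>2 * \<bar>M1\<bar>))"
        using True by (simp add: B_def algebra_simps)
      ultimately show ?thesis by linarith
    next
      case False
      then show ?thesis using K(2,3)[OF out[OF False]] by (simp add: k'_def)
    qed
  next
    show "k' m \<in> borel_measurable borel" unfolding k'_def by measurable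
    have "integrable lborel (\<lambda>y. f y * of_real (indicator (cball 0 R') y))"
      by (rule L2_mult_integrable[OF L2f L2_bounded_compact[where M=1 and R=R']]) (auto simp: indicator_def)
    then show "integrable lborel (\<lambda>y. B * cmod (f y * of_real (indicator (cball 0 R') y)))"
      by (intro integrable_mult_right integrable_norm)
  qed
qed

text \<open>The potential is homogeneous of degree -2, which produces 1/(1 - a t)^2; the convention
  1/0 = 0 makes the identity hold at the origin as well.\<close>

lemma pconf_hardy: "of_real (1 / (norm x)\<^sup>2) * pconf a \<omega> t f x = pconf a \<omega> t (\<lambda>y. of_real (1 / (1 - a * t)\<^sup>2) * (of_real (1 / (norm y)\<^sup>2) * f y)) x"
  if "a * t < 1"
proof -
  have "1 - a * t \<noteq> 0" using that by simp
  then have "1 / (1 - a * t)\<^sup>2 * (1 / (norm (x /\<^sub>R (1 - a * t)))\<^sup>2) = 1 / (norm x)\<^sup>2"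
    by (simp add: power_mult_distrib power_inverse field_simps)
  then have "complex_of_real (1 / (norm x)\<^sup>2) = of_real (1 / (1 - a * t)\<^sup>2) * of_real (1 / (norm (x /\<^sub>R (1 - a * t)))\<^sup>2)"
    by (simp only: of_real_mult[symmetric])
  then show ?thesis unfolding pconf_def by (simp only: mult_ac)
qed

text \<open>Here the critical power enters: (m^(-d/2))^(4/d) = m^-2, the same factor as for the
  potential.\<close>

lemma pconf_nonlin: "nonlin TYPE('d) (pconf a \<omega> t f x) = pconf a \<omega> t (\<lambda>y. of_real (1 / (1 - a * t)\<^sup>2) * nonlin TYPE('d) (f y)) x"
  if "a * t < 1"
proof -
  let ?m = "1 - a * t" and ?d = "real CARD('d)"
  have m: "?m > 0" using that by simp
  have "cmod (pconf a \<omega> t f x) = ?m powr (- ?d / 2) * cmod (f (x /\<^sub>R ?m))"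
    by (simp add: pconf_def norm_mult)
  then have "cmod (pconf a \<omega> t f x) powr (4 / ?d) = (?m powr (- ?d / 2)) powr (4 / ?d) * cmod (f (x /\<^sub>R ?m)) powr (4 / ?d)"
    by (simp add: powr_mult)
  also have "(?m powr (- ?d / 2)) powr (4 / ?d) = ?m powr (-2)" by (simp add: powr_powr)
  also have "\<dots> = 1 / ?m\<^sup>2" using m by (simp add: powr_minus_divide)
  finally have "complex_of_real (cmod (pconf a \<omega> t f x) powr (4 / ?d)) = of_real (1 / ?m\<^sup>2) * of_real (cmod (f (x /\<^sub>R ?m)) powr (4 / ?d))"
    by (simp only: of_real_mult)
  then show ?thesis unfolding nonlin_def by (simp only: pconf_def mult_ac)
qed

text \<open>All pairings reduce to integrals in y: \<open>Z\<close>, \<open>W1\<close>,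
  \<open>W2\<close> from the time derivative and \<open>G\<Psi>\<close>, \<open>Hd\<close>,
  \<open>NL\<close> from the equation. They are linked by the standing wave equation tested with
  \<open>\<Phi>\<close> and by the weak gradient of \<open>f\<close> tested with y_j
  \<open>\<Phi>\<close>; the rest is algebra.\<close>

lemma pconf_equation:
  assumes t: "0 < t" "a * t < 1" and "test_fun \<phi>"
  shows "\<exists>D'. ((\<lambda>s. LINT x|lborel. pconf a \<omega> s f x * of_real (\<phi> x)) has_vector_derivative D') (at t) \<and>
    \<i> * D' = op_pair c (pconf a \<omega> t f) \<phi> - (LINT x|lborel. nonlin TYPE('d) (pconf a \<omega> t f x) * of_real (\<phi> x))"
proof -
  obtain D where b: "C1_bump UNIV \<phi> D" using test_fun_imp_bump[OF assms(3)] by blast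
  define m where "m = 1 - a * t"
  have m: "m > 0" using t by (simp add: m_def)
  have g: "has_cont_gradient \<phi> D" using b by (simp add: C1_bump_def)
  note [measurable] = has_cont_gradient_measurable(1)[OF g]
  have Dm[measurable]: "(\<lambda>x. D x $ j) \<in> borel_measurable borel" for j
    using L2_bump(2)[OF b, of j] by (simp add: L2_def borel_measurable_complex_iff)
  define \<Phi> where "\<Phi> y = chirp a m y * of_real (\<phi> (m *\<^sub>R y))" for y
  define \<Psi> where "\<Psi> j y = of_real m * (chirp a m y * of_real (D (m *\<^sub>R y) $ j)) - \<i> * of_real (a * m / 2) * of_real (y $ j) * (chirp a m y * of_real (\<phi> (m *\<^sub>R y)))" for j y
  have Bp: "complex_bump \<Phi> \<Psi>" unfolding \<Phi>_def[abs_def] \<Psi>_def[abs_def] by (rule complex_bump_chirp[OF b m])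
  define E where "E j y = chirp a m y * of_real (D (m *\<^sub>R y) $ j)" for j y
  have ED: "E j y = of_real (1 / m) * \<Psi> j y + \<i> * of_real (a / 2) * (of_real (y $ j) * \<Phi> y)" for j y
    unfolding \<Psi>_def \<Phi>_def E_def using m by (simp add: field_simps)
  have L2\<Phi>: "L2 \<Phi>" and L2\<Psi>: "L2 (\<Psi> j)" for j by (rule complex_bump_L2[OF Bp])+
  have L2E: "L2 (E j)" for j
  proof -
    have "L2 (\<lambda>y. of_real (1 / m) * \<Psi> j y + \<i> * of_real (a / 2) * (of_real (y $ j) * \<Phi> y))"
      by (intro L2_add L2_cmult L2\<Psi> complex_bump_L2(1)[OF complex_bump_coordinate[OF Bp]])
    moreover have "E j = (\<lambda>y. of_real (1 / m) * \<Psi> j y + \<i> * of_real (a / 2) * (of_real (y $ j) * \<Phi> y))" by (rule ext) (rule ED)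
    ultimately show ?thesis by (simp only:)
  qed
  define \<kappa> where "\<kappa> s = of_real ((1 - a * s) powr (real CARD('d) / 2)) * cis (\<omega> * s / (1 - a * s))" for s
  \<comment> \<open>\<open>Z\<close> pairs \<open>f\<close> with the chirped test function;
    \<open>W1\<close> is its derivative in the scale through \<phi>(m y), and \<open>W2\<close>, up
    to a factor, the one through the chirp.\<close>
  define Z where "Z = (LINT y|lborel. f y * \<Phi> y)"
  define W1 where "W1 = (LINT y|lborel. f y * (chirp a m y * of_real (y \<bullet> D (m *\<^sub>R y))))"
  define W2 where "W2 = (LINT y|lborel. f y * (of_real (y \<bullet> y) * \<Phi> y))"
  have sumE: "f y * (chirp a m y * of_real (y \<bullet> D (m *\<^sub>R y))) = (\<Sum>j\<in>UNIV. of_real (y $ j) * f y * E j y)" for y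
    by (simp add: E_def inner_vec_def sum_distrib_left mult_ac)
  have iE: "integrable lborel (\<lambda>y. of_real (y $ j) * f y * E j y)" for j
    by (rule L2_mult_integrable[OF L2_coordinate L2E])
  have iW1: "integrable lborel (\<lambda>y. f y * (chirp a m y * of_real (y \<bullet> D (m *\<^sub>R y))))"
    unfolding sumE by (intro Bochner_Integration.integrable_sum iE)
  have W1: "W1 = (\<Sum>j\<in>UNIV. LINT y|lborel. of_real (y $ j) * f y * E j y)"
    unfolding W1_def sumE by (rule Bochner_Integration.integral_sum[OF iE])
  have sumY: "f y * (of_real (y \<bullet> y) * \<Phi> y) = (\<Sum>j\<in>UNIV. of_real (y $ j) * f y * (of_real (y $ j) * \<Phi> y))" for y
    by (simp add: inner_vec_def sum_distrib_left sum_distrib_right mult_ac)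
  have iW2: "integrable lborel (\<lambda>y. f y * (of_real (y \<bullet> y) * \<Phi> y))"
    unfolding sumY by (intro Bochner_Integration.integrable_sum L2_mult_integrable[OF L2_coordinate complex_bump_L2(1)[OF complex_bump_coordinate[OF Bp]]])
  have iZ: "integrable lborel (\<lambda>y. f y * \<Phi> y)" by (rule L2_mult_integrable[OF L2f L2\<Phi>])
  have pair: "(LINT x|lborel. pconf a \<omega> s f x * of_real (\<phi> x)) = \<kappa> s * (LINT y|lborel. f y * (chirp a (1 - a * s) y * of_real (\<phi> ((1 - a * s) *\<^sub>R y))))" if "a * s < 1" for s
    unfolding \<kappa>_def by (rule pconf_pairing[OF fm _ that]) measurable
  have dZ: "((\<lambda>s. LINT y|lborel. f y * (chirp a s y * of_real (\<phi> (s *\<^sub>R y)))) has_vector_derivative (W1 - \<i> * of_real (a / 4) * W2)) (at m)"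
  proof -
    have "(LINT y|lborel. f y * (chirp a m y * of_real (y \<bullet> D (m *\<^sub>R y))) - \<i> * of_real (a / 4) * (f y * (of_real (y \<bullet> y) * (chirp a m y * of_real (\<phi> (m *\<^sub>R y)))))) = W1 - \<i> * of_real (a / 4) * W2"
      unfolding W1_def W2_def using iW1 iW2 unfolding \<Phi>_def
      by (simp only: Bochner_Integration.integral_diff integrable_mult_right integral_mult_right_zero)
    then show ?thesis using pconf_pairing_derivative[OF b m, of a] by simp
  qed
  have mu: "((\<lambda>s. 1 - a * s) has_vector_derivative (- a)) (at t)"
    by (auto intro!: derivative_eq_intros simp: has_real_derivative_iff_has_vector_derivative[symmetric])
  have dZt: "((\<lambda>s. LINT y|lborel. f y * (chirp a (1 - a * s) y * of_real (\<phi> ((1 - a * s) *\<^sub>R y)))) has_vector_derivative ((- a) *\<^sub>R (W1 - \<i> * of_real (a / 4) * W2))) (at t)"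
    using vector_diff_chain_at[OF mu, of "\<lambda>s. LINT y|lborel. f y * (chirp a s y * of_real (\<phi> (s *\<^sub>R y)))"] dZ
    unfolding m_def o_def by blast
  have d\<kappa>: "(\<kappa> has_vector_derivative (\<kappa> t * (\<i> * of_real (\<omega> / m\<^sup>2) - of_real (a * real CARD('d) / (2 * m))))) (at t)"
  proof -
    have "((\<lambda>s. (1 - a * s) powr (real CARD('d) / 2)) has_real_derivative (- (a * real CARD('d) / (2 * m)) * m powr (real CARD('d) / 2))) (at t)"
    proof -
      have "((\<lambda>s. 1 - a * s) has_real_derivative (- a)) (at t)" by (auto intro!: derivative_eq_intros)
      from DERIV_fun_powr[OF this, of "real CARD('d) / 2"] m
      have "((\<lambda>s. (1 - a * s) powr (real CARD('d) / 2)) has_real_derivative (real CARD('d) / 2 * m powr (real CARD('d) / 2 - 1) * - a)) (at t)"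
        by (simp add: m_def)
      moreover have "real CARD('d) / 2 * m powr (real CARD('d) / 2 - 1) * - a = - (a * real CARD('d) / (2 * m)) * m powr (real CARD('d) / 2)"
      proof -
        have "m powr (real CARD('d) / 2 - 1) = m powr (real CARD('d) / 2) / m"
          unfolding powr_diff using m by simp
        then show ?thesis using m by (simp only:) (simp add: field_simps)
      qed
      ultimately show ?thesis by (simp only:)
    qed
    then have "((\<lambda>s. (1 - a * s) powr (real CARD('d) / 2)) has_vector_derivative (- (a * real CARD('d) / (2 * m)) * m powr (real CARD('d) / 2))) (at t)"
      by (simp add: has_real_derivative_iff_has_vector_derivative)
    then have 1: "((\<lambda>s. complex_of_real ((1 - a * s) powr (real CARD('d) / 2))) has_vector_derivative of_real (- (a * real CARD('d) / (2 * m)) * m powr (real CARD('d) / 2))) (at t)"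
      by (rule bounded_linear.has_vector_derivative[OF bounded_linear_of_real])
    have "((\<lambda>s. \<omega> * s / (1 - a * s)) has_real_derivative (\<omega> / m\<^sup>2)) (at t)"
    proof -
      have "((\<lambda>s. \<omega> * s / (1 - a * s)) has_real_derivative ((\<omega> * (1 - a * t) - (\<omega> * t) * (- a)) / ((1 - a * t) * (1 - a * t)))) (at t)"
        using m by (auto intro!: derivative_eq_intros simp: m_def)
      moreover have "\<omega> * (1 - a * t) - (\<omega> * t) * (- a) = \<omega>" by (simp add: algebra_simps)
      ultimately show ?thesis by (simp add: m_def power2_eq_square)
    qed
    from has_vector_derivative_cis[OF this]
    have 2: "((\<lambda>s. cis (\<omega> * s / (1 - a * s))) has_vector_derivative (of_real (\<omega> / m\<^sup>2) * \<i> * cis (\<omega> * t / (1 - a * t)))) (at t)" .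
    have e: "P * (w * \<i> * C) + (- q * P) * C = P * C * (\<i> * w - q)" for P w C q :: complex by (simp add: algebra_simps)
    have "\<kappa> t * (\<i> * of_real (\<omega> / m\<^sup>2) - of_real (a * real CARD('d) / (2 * m))) =
       of_real ((1 - a * t) powr (real CARD('d) / 2)) * (of_real (\<omega> / m\<^sup>2) * \<i> * cis (\<omega> * t / (1 - a * t))) +
       of_real (- (a * real CARD('d) / (2 * m)) * m powr (real CARD('d) / 2)) * cis (\<omega> * t / (1 - a * t))"
      unfolding \<kappa>_def of_real_mult of_real_minus m_def[symmetric] by (rule e[symmetric])
    then show ?thesis using has_vector_derivative_mult[OF 1 2] unfolding \<kappa>_def[abs_def] by simp
  qed
  define D' where "D' = \<kappa> t * ((- a) *\<^sub>R (W1 - \<i> * of_real (a / 4) * W2)) + \<kappa> t * (\<i> * of_real (\<omega> / m\<^sup>2) - of_real (a * real CARD('d) / (2 * m))) * Z"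
  have der: "((\<lambda>s. LINT x|lborel. pconf a \<omega> s f x * of_real (\<phi> x)) has_vector_derivative D') (at t)"
  proof -
    have "((\<lambda>s. \<kappa> s * (LINT y|lborel. f y * (chirp a (1 - a * s) y * of_real (\<phi> ((1 - a * s) *\<^sub>R y))))) has_vector_derivative D') (at t)"
      using has_vector_derivative_mult[OF d\<kappa> dZt] unfolding D'_def Z_def \<Phi>_def m_def by simp
    \<comment> \<open>The pairing formula holds for a s < 1, an open condition, so the derivative at
      t carries over.\<close>
    moreover have "open {s. a * s < 1}" by (intro open_Collect_less continuous_intros)
    ultimately show ?thesis
      by (rule has_vector_derivative_transform_within_open) (use t pair in auto)
  qed
  define G\<Psi> where "G\<Psi> = (\<Sum>j\<in>UNIV. LINT y|lborel. g j y * \<Psi> j y)"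
  define Hd where "Hd = (LINT y|lborel. of_real (1 / (norm y)^2) * f y * \<Phi> y)"
  define NL where "NL = (LINT y|lborel. nonlin TYPE('d) (f y) * \<Phi> y)"
  have GE: "G\<Psi> - of_real c * Hd + of_real \<omega> * Z = NL"
    unfolding G\<Psi>_def Hd_def Z_def NL_def by (rule complex_bump_eq[OF Bp])
  \<comment> \<open>Integration by parts of \<open>f\<close> against y_j \<open>\<Phi>\<close>,
    summed over j: the divergence of y contributes d Z, and the remaining terms come from y . grad
    \<Phi>.\<close>
  have GY: "(\<Sum>j\<in>UNIV. LINT y|lborel. g j y * (of_real (y $ j) * \<Phi> y)) = - (of_real (real CARD('d)) * Z + of_real m * W1 - \<i> * of_real (a * m / 2) * W2)"
  proof -
    have i: "integrable lborel (\<lambda>y. of_real (y $ j) * f y * \<Psi> j y)" for j by (rule L2_mult_integrable[OF L2_coordinate L2\<Psi>])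
    have 1: "(LINT y|lborel. g j y * (of_real (y $ j) * \<Phi> y)) = - ((LINT y|lborel. of_real (y $ j) * f y * \<Psi> j y) + Z)" for j
    proof -
      \<comment> \<open>The partial of y_j \<open>\<Phi>\<close> in direction j has the extra
        summand \<open>\<Phi>\<close>; the condition \<open>j = j\<close> is the shape in which the
        product with a coordinate delivers it.\<close>
      have "(LINT y|lborel. f y * (of_real (y $ j) * \<Psi> j y + (if j = j then \<Phi> y else 0))) = - (LINT y|lborel. g j y * (of_real (y $ j) * \<Phi> y))"
        by (rule complex_bump_weak[OF weak L2f L2g complex_bump_coordinate[OF Bp]])
      note l = this
      have "(LINT y|lborel. f y * (of_real (y $ j) * \<Psi> j y + (if j = j then \<Phi> y else 0))) = (LINT y|lborel. of_real (y $ j) * f y * \<Psi> j y + f y * \<Phi> y)"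
        by (simp add: algebra_simps)
      also have "\<dots> = (LINT y|lborel. of_real (y $ j) * f y * \<Psi> j y) + Z"
        unfolding Z_def by (rule Bochner_Integration.integral_add[OF i iZ])
      finally have r: "(LINT y|lborel. f y * (of_real (y $ j) * \<Psi> j y + (if j = j then \<Phi> y else 0))) = (LINT y|lborel. of_real (y $ j) * f y * \<Psi> j y) + Z" .
      have neg: "y = - z" if "x = - y" "x = z" for x y z :: complex using that by simp
      show ?thesis by (rule neg[OF l r])
    qed
    have "(\<Sum>j\<in>UNIV. LINT y|lborel. of_real (y $ j) * f y * \<Psi> j y) = (LINT y|lborel. (\<Sum>j\<in>UNIV. of_real (y $ j) * f y * \<Psi> j y))"
      by (rule Bochner_Integration.integral_sum[symmetric, OF i])
    also have "(\<lambda>y. \<Sum>j\<in>UNIV. of_real (y $ j) * f y * \<Psi> j y) = (\<lambda>y. of_real m * (f y * (chirp a m y * of_real (y \<bullet> D (m *\<^sub>R y)))) - \<i> * of_real (a * m / 2) * (f y * (of_real (y \<bullet> y) * \<Phi> y)))"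
    proof
      fix y
      have "of_real (y $ j) * f y * \<Psi> j y = of_real m * (of_real (y $ j) * f y * E j y) - \<i> * of_real (a * m / 2) * (of_real (y $ j) * f y * (of_real (y $ j) * \<Phi> y))" for j
        unfolding \<Psi>_def E_def \<Phi>_def by (simp add: algebra_simps)
      then show "(\<Sum>j\<in>UNIV. of_real (y $ j) * f y * \<Psi> j y) = of_real m * (f y * (chirp a m y * of_real (y \<bullet> D (m *\<^sub>R y)))) - \<i> * of_real (a * m / 2) * (f y * (of_real (y \<bullet> y) * \<Phi> y))"
        unfolding sumE sumY by (simp only: sum_subtractf sum_distrib_left)
    qed
    also have "(LINT y|lborel. of_real m * (f y * (chirp a m y * of_real (y \<bullet> D (m *\<^sub>R y)))) - \<i> * of_real (a * m / 2) * (f y * (of_real (y \<bullet> y) * \<Phi> y))) = of_real m * W1 - \<i> * of_real (a * m / 2) * W2"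
      unfolding W1_def W2_def using iW1 iW2
      by (simp only: Bochner_Integration.integral_diff integrable_mult_right integral_mult_right_zero)
    finally have 2: "(\<Sum>j\<in>UNIV. LINT y|lborel. of_real (y $ j) * f y * \<Psi> j y) = of_real m * W1 - \<i> * of_real (a * m / 2) * W2" .
    have "(\<Sum>j\<in>UNIV. LINT y|lborel. g j y * (of_real (y $ j) * \<Phi> y)) = - ((\<Sum>j\<in>UNIV. LINT y|lborel. of_real (y $ j) * f y * \<Psi> j y) + of_real (real CARD('d)) * Z)"
      unfolding 1 sum_negf sum.distrib by simp
    then show ?thesis unfolding 2 by (simp add: algebra_simps)
  qed
  have G1: "(\<Sum>j\<in>UNIV. LINT y|lborel. g j y * E j y) = of_real (1 / m) * G\<Psi> + \<i> * of_real (a / 2) * (\<Sum>j\<in>UNIV. LINT y|lborel. g j y * (of_real (y $ j) * \<Phi> y))"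
  proof -
    have "(LINT y|lborel. g j y * E j y) = of_real (1 / m) * (LINT y|lborel. g j y * \<Psi> j y) + \<i> * of_real (a / 2) * (LINT y|lborel. g j y * (of_real (y $ j) * \<Phi> y))" for j
    proof -
      have "g j y * E j y = of_real (1 / m) * (g j y * \<Psi> j y) + \<i> * of_real (a / 2) * (g j y * (of_real (y $ j) * \<Phi> y))" for y
        unfolding ED by (simp add: algebra_simps)
      then show ?thesis
        using L2_mult_integrable[OF L2g L2\<Psi>, of j] L2_mult_integrable[OF L2g complex_bump_L2(1)[OF complex_bump_coordinate[OF Bp]], of j j]
        by (simp only: Bochner_Integration.integral_add integrable_mult_right integral_mult_right_zero)
    qed
    then show ?thesis unfolding G\<Psi>_def by (simp only: sum.distrib sum_distrib_left)
  qed
  have grad: "(\<Sum>j\<in>UNIV. LINT x|lborel. wpd (pconf a \<omega> t f) j x * of_real (pd \<phi> j x)) = \<kappa> t * (of_real (1 / m) * (\<Sum>j\<in>UNIV. LINT y|lborel. g j y * E j y) - \<i> * of_real (a / 2) * W1)"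
  proof -
    have "(LINT x|lborel. wpd (pconf a \<omega> t f) j x * of_real (pd \<phi> j x)) = \<kappa> t * (of_real (1 / m) * (LINT y|lborel. g j y * E j y) - \<i> * of_real (a / 2) * (LINT y|lborel. of_real (y $ j) * f y * E j y))" for j
    proof -
      have wm[measurable]: "wpd (pconf a \<omega> t f) j \<in> borel_measurable borel" using wpd_props(1)[OF pconf_H1(1)[OF t(2)], of j] by (simp add: L2_def)
      have "(LINT x|lborel. wpd (pconf a \<omega> t f) j x * of_real (pd \<phi> j x)) = (LINT x|lborel. pconf a \<omega> t (pgrad a t j) x * of_real (D x $ j))"
        unfolding pd_eq_bump[OF b]
      proof (rule integral_cong_AE)
        show "AE x in lborel. wpd (pconf a \<omega> t f) j x * of_real (D x $ j) = pconf a \<omega> t (pgrad a t j) x * of_real (D x $ j)"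
          using pconf_H1(2)[OF t(2), of j] by eventually_elim simp
      qed measurable
      also have "\<dots> = \<kappa> t * (LINT y|lborel. pgrad a t j y * E j y)"
        unfolding \<kappa>_def E_def m_def by (rule pconf_pairing[OF pgrad_measurable Dm t(2)])
      also have "(LINT y|lborel. pgrad a t j y * E j y) = of_real (1 / m) * (LINT y|lborel. g j y * E j y) - \<i> * of_real (a / 2) * (LINT y|lborel. of_real (y $ j) * f y * E j y)"
      proof -
        have "pgrad a t j y * E j y = of_real (1 / m) * (g j y * E j y) - \<i> * of_real (a / 2) * (of_real (y $ j) * f y * E j y)" for y
          unfolding pgrad_def m_def by (simp add: algebra_simps)
        then show ?thesis using L2_mult_integrable[OF L2g L2E, of j j] iE[of j]
          by (simp only: Bochner_Integration.integral_diff integrable_mult_right integral_mult_right_zero)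
      qed
      finally show ?thesis .
    qed
    then show ?thesis unfolding W1 by (simp only: sum_distrib_left[symmetric] sum_subtractf)
  qed
  have hardy: "(LINT x|lborel. of_real (1 / (norm x)^2) * pconf a \<omega> t f x * of_real (\<phi> x)) = \<kappa> t * (of_real (1 / m\<^sup>2) * Hd)"
  proof -
    have "(LINT x|lborel. of_real (1 / (norm x)^2) * pconf a \<omega> t f x * of_real (\<phi> x)) = \<kappa> t * (LINT y|lborel. of_real (1 / m\<^sup>2) * (of_real (1 / (norm y)\<^sup>2) * f y) * \<Phi> y)"
      unfolding pconf_hardy[OF t(2)] \<kappa>_def \<Phi>_def m_def by (rule pconf_pairing[OF _ _ t(2)]) measurable
    also have "(LINT y|lborel. of_real (1 / m\<^sup>2) * (of_real (1 / (norm y)\<^sup>2) * f y) * \<Phi> y) = of_real (1 / m\<^sup>2) * Hd"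
      unfolding Hd_def mult.assoc by (rule integral_mult_right_zero)
    finally show ?thesis .
  qed
  have nl: "(LINT x|lborel. nonlin TYPE('d) (pconf a \<omega> t f x) * of_real (\<phi> x)) = \<kappa> t * (of_real (1 / m\<^sup>2) * NL)"
  proof -
    have [measurable]: "(\<lambda>y. nonlin TYPE('d) (f y)) \<in> borel_measurable borel" unfolding nonlin_def by measurable
    have "(LINT x|lborel. nonlin TYPE('d) (pconf a \<omega> t f x) * of_real (\<phi> x)) = \<kappa> t * (LINT y|lborel. of_real (1 / m\<^sup>2) * nonlin TYPE('d) (f y) * \<Phi> y)"
      unfolding pconf_nonlin[OF t(2)] \<kappa>_def \<Phi>_def m_def by (rule pconf_pairing[OF _ _ t(2)]) measurable
    also have "(LINT y|lborel. of_real (1 / m\<^sup>2) * nonlin TYPE('d) (f y) * \<Phi> y) = of_real (1 / m\<^sup>2) * NL"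
      unfolding NL_def mult.assoc by (rule integral_mult_right_zero)
    finally show ?thesis .
  qed
  have "\<i> * D' = op_pair c (pconf a \<omega> t f) \<phi> - (LINT x|lborel. nonlin TYPE('d) (pconf a \<omega> t f x) * of_real (\<phi> x))"
  proof -
    \<comment> \<open>With letters for the integrals, the terms in w1, w2 and d agree on both sides,
      and what remains is the standing wave equation multiplied by k / M^2.\<close>
    have alg: "\<i> * (k * (- A * (w1 - \<i> * (A / 4) * w2)) + k * (\<i> * (w / M\<^sup>2) - A * d / (2 * M)) * z) =
       k * (1 / M * (1 / M * G + \<i> * (A / 2) * (- (d * z + M * w1 - \<i> * (A * M / 2) * w2))) - \<i> * (A / 2) * w1) - C * (k * (1 / M\<^sup>2 * h)) - k * (1 / M\<^sup>2 * N)"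
      if M: "M \<noteq> 0" and N: "G - C * h + w * z = N" for k A w1 w2 w M d z G C h N :: complex
    proof -
      have ii: "\<i> * (\<i> * x) = - x" for x by (simp flip: mult.assoc)
      show ?thesis unfolding N[symmetric] using M by (simp add: field_simps power2_eq_square ii)
    qed
    have "of_real m \<noteq> (0::complex)" using m by simp
    from alg[OF this GE, where k="\<kappa> t" and A="of_real a" and ?w1.0=W1 and ?w2.0=W2 and d="of_real (real CARD('d))"]
    show ?thesis unfolding D'_def op_pair_def grad G1 GY hardy nl scaleR_conv_of_real
      by (simp only: of_real_minus of_real_divide of_real_mult of_real_power of_real_numeral of_real_1)
  qed
  with der show ?thesis by blast
qed

lemma pconf_blows_up:
  assumes a: "a > 0"
  shows "blows_up c (pconf a \<omega> 0 f)"
  unfolding blows_up_def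
proof (intro exI conjI)
  show "filterlim (\<lambda>t. grad_norm (pconf a \<omega> t f)) at_top (at_left (1 / a))" by (rule pconf_blowup[OF a])
  have lt: "a * t < 1" if "t < 1 / a" for t using that a by (simp add: field_simps)
  show "nls_solution c (pconf a \<omega> 0 f) (1 / a) (\<lambda>t. pconf a \<omega> t f)"
    unfolding nls_solution_def
  proof (intro conjI ballI allI impI)
    show "0 < 1 / a" using a by simp
    show "AE x in lborel. pconf a \<omega> 0 f x = pconf a \<omega> 0 f x" by simp
    fix t assume t: "t \<in> {0..<1 / a}"
    then show "H1 (pconf a \<omega> t f)" by (intro pconf_H1(1) lt) auto
    show "((\<lambda>s. H1_dist (pconf a \<omega> s f) (pconf a \<omega> t f)) \<longlongrightarrow> 0) (at t within {0..<1 / a})"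
      unfolding tendsto_at_iff_sequentially
    proof (intro allI impI)
      fix X assume X: "\<forall>i. X i \<in> {0..<1 / a} - {t}" "X \<longlonglongrightarrow> t"
      show "((\<lambda>s. H1_dist (pconf a \<omega> s f) (pconf a \<omega> t f)) \<circ> X) \<longlonglongrightarrow> 0"
        unfolding o_def by (rule pconf_continuous[OF lt lt X(2)]) (use X(1) t in auto)
    qed
  next
    fix \<phi> :: "real^'d \<Rightarrow> real" and t assume "test_fun \<phi>" "t \<in> {0<..<1 / a}"
    then show "\<exists>D. ((\<lambda>s. LINT x|lborel. pconf a \<omega> s f x * of_real (\<phi> x)) has_vector_derivative D) (at t) \<and>
        \<i> * D = op_pair c (pconf a \<omega> t f) \<phi> - (LINT x|lborel. nonlin TYPE('d) (pconf a \<omega> t f x) * of_real (\<phi> x))"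
      by (intro pconf_equation lt) auto
  qed
qed

end

section \<open>The unstable sequence of initial data\<close>

theorem theorem4p3:
  fixes c \<omega> :: real and Q :: "real^'d \<Rightarrow> complex"
  assumes "CARD('d) \<ge> 3"
    and "c \<noteq> 0" and "c < lam (real CARD('d))"
    and "\<omega> > 0"
    and "H1 Q" and "radial Q" and "ground_eq c \<omega> Q"
    and "\<not> (AE x in lborel. Q x = 0)"
  shows "\<exists>u0 :: nat \<Rightarrow> real^'d \<Rightarrow> complex.
           (\<forall>n. H1 (u0 n)) \<and>
           ((\<lambda>n. H1_dist (u0 n) Q) \<longlonglongrightarrow> 0) \<and>
           (\<forall>n. blows_up c (u0 n))"
proof -
  obtain f g where "standing_wave c \<omega> f g" and Q: "AE x in lborel. Q x = f x" "\<And>j. AE x in lborel. wpd Q j x = g j x"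
    using radial_standing_wave[OF assms(1,4,5,6,7,8)] by blast
  interpret standing_wave c \<omega> f g by fact
  \<comment> \<open>The chirp parameter a = 1/(n+1) tends to 0, and being positive it gives blow-up,
    at time n + 1.\<close>
  have "(\<lambda>n. H1_dist (pconf (inverse (real (Suc n))) \<omega> 0 f) Q) \<longlonglongrightarrow> 0"
    by (rule pconf_initial_tendsto[OF LIMSEQ_inverse_real_of_nat \<open>H1 Q\<close> Q])
  then show ?thesis
    by (intro exI[of _ "\<lambda>n. pconf (inverse (real (Suc n))) \<omega> 0 f"] conjI allI pconf_H1(1) pconf_blows_up) auto
qed



end
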